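(* Let $n\ge 3$, let $C_n$ be the cycle graph on $n$ vertices, let $W_{n+1}$ be the wheel graph on $n+1$ vertices, and let $r$ be a positive integer. Then the $\mathbb N$-graded Betti numbers of $R_{W_{n+1}}/I_r(W_{n+1})$ are given, for $i\ge 0$, by $$\beta_{i,i+d}(R_{W_{n+1}}/I_r(W_{n+1}))=\begin{cases}\beta_{i,i+d}(R_{C_n}/I_r(C_n))+\beta_{i-1,i+d-1}(R_{C_n}/I_r(C_n))+\binom{i+d-2}{d-1}\binom{n}{i+d-1} & \text{for } d=r,\\ \beta_{i,i+d}(R_{C_n}/I_r(C_n))+\beta_{i-1,i+d-1}(R_{C_n}/I_r(C_n)) & \text{for } d\ge r+1.\end{cases}$$
   Context: $\mathbb K$ is a field. For a finite simple graph $G$ with vertex set $V(G)$, $R_G$ is the polynomial ring over $\mathbb K$ whose variables are the vertices of $G$ (standard grading). For a positive integer $r$, $I_r(G)\subseteq R_G$ is the square-free monomial ideal generated by the monomials $\prod_{x\in A}x$, where $A$ ranges over all subsets $A\subseteq V(G)$ with $|A|=r+1$ such that the induced subgraph $G[A]$ is connected ($I_r(G)=0$ if there are none). The wheel graph $W_{n+1}$ is obtained from $C_n$ by adding one new vertex adjacent to all $n$ vertices of $C_n$. $\beta_{i,j}(R/I)$ denotes the $(i,j)$-th graded Betti number, i.e. the multiplicity of $R(-j)$ in homological degree $i$ of the graded minimal free resolution of $R/I$; it is $0$ if $i<0$. Binomial coefficients $\binom{a}{b}$ are $0$ when $a<0$ or $b>a$. *)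

theory Defs
  imports
    "HOL-Algebra.QuotRing"
    "HOL-Algebra.Module"
    "HOL-Library.Poly_Mapping"
    "Graph_Theory.Graph_Theory"
begin

section \<open>Polynomial rings with a given set of variables\<close>

text \<open>A monomial is a finitely supported exponent function, a polynomial a finitely supported
  family of coefficients indexed by monomials. The type has all of \<open>'v\<close> as variables; the
  polynomial ring in the variables \<open>V\<close> is cut out as a carrier.\<close>

type_synonym ('v, 'k) mpoly = "('v \<Rightarrow>\<^sub>0 nat) \<Rightarrow>\<^sub>0 'k"

definition mpoly_var :: "'v \<Rightarrow> ('v, 'k::field) mpoly" where
  "mpoly_var x = Poly_Mapping.single (Poly_Mapping.single x 1) 1"

definition mpoly_ring :: "'v set \<Rightarrow> ('v, 'k::field) mpoly ring" where
  "mpoly_ring V =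
    \<lparr>carrier = {p. \<forall>m\<in>Poly_Mapping.keys p. Poly_Mapping.keys m \<subseteq> V},
     monoid.mult = (*), monoid.one = 1, ring.zero = 0, ring.add = (+)\<rparr>"

definition mono_deg :: "('v \<Rightarrow>\<^sub>0 nat) \<Rightarrow> int" where
  "mono_deg m = (\<Sum>x\<in>Poly_Mapping.keys m. int (Poly_Mapping.lookup m x))"

text \<open>The zero polynomial is homogeneous of every degree, and it is the only homogeneous polynomial
  of negative degree.\<close>

definition homogeneous :: "int \<Rightarrow> ('v, 'k::field) mpoly \<Rightarrow> bool" where
  "homogeneous e p \<longleftrightarrow> (\<forall>m\<in>Poly_Mapping.keys p. mono_deg m = e)"

definition irrelevant_ideal :: "'v set \<Rightarrow> ('v, 'k::field) mpoly set" where
  "irrelevant_ideal V = Idl\<^bsub>mpoly_ring V\<^esub> (mpoly_var ` V)"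


section \<open>Graded modules\<close>

record ('a, 'b) graded_module = "('a, 'b) module" +
  component :: "int \<Rightarrow> 'b set"

text \<open>The cyclic module \<open>R/I\<close> for the polynomial ring \<open>R\<close> in the variables \<open>V\<close>, graded by the images
  of the homogeneous polynomials.\<close>

definition quotient_module ::
  "'v set \<Rightarrow> ('v, 'k::field) mpoly set \<Rightarrow> (('v, 'k) mpoly, ('v, 'k) mpoly set) graded_module" where
  "quotient_module V I = (let R = mpoly_ring V in
    \<lparr>carrier = carrier (R Quot I),
     monoid.mult = monoid.mult (R Quot I), monoid.one = \<one>\<^bsub>R Quot I\<^esub>,
     ring.zero = \<zero>\<^bsub>R Quot I\<^esub>, ring.add = ring.add (R Quot I),
     smult = (\<lambda>a X. (I +>\<^bsub>R\<^esub> a) \<otimes>\<^bsub>R Quot I\<^esub> X),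
     component = (\<lambda>e. {I +>\<^bsub>R\<^esub> p | p. p \<in> carrier R \<and> homogeneous e p})\<rparr>)"

text \<open>The graded free module \<open>R(-s\<^sub>0) \<oplus> \<dots> \<oplus> R(-s\<^sub>l)\<close> for a list \<open>s = [s\<^sub>0, \<dots>, s\<^sub>l]\<close>:
  its \<open>k\<close>-th basis vector is homogeneous of degree \<open>s\<^sub>k\<close>. Vectors are functions that vanish
  outside the index range. A module record extends a ring record; the two fields for the ring
  multiplication play no role.\<close>

definition graded_free ::
  "'v set \<Rightarrow> int list \<Rightarrow> (('v, 'k::field) mpoly, nat \<Rightarrow> ('v, 'k) mpoly) graded_module" where
  "graded_free V s =
    \<lparr>carrier = {u. (\<forall>k<length s. u k \<in> carrier (mpoly_ring V)) \<and> (\<forall>k\<ge>length s. u k = 0)},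
     monoid.mult = undefined, monoid.one = undefined,
     ring.zero = (\<lambda>k. 0), ring.add = (\<lambda>u v k. u k + v k),
     smult = (\<lambda>a u k. a * u k),
     component = (\<lambda>e. {u. (\<forall>k<length s. u k \<in> carrier (mpoly_ring V) \<and> homogeneous (e - s ! k) (u k))
                        \<and> (\<forall>k\<ge>length s. u k = 0)})\<rparr>"

text \<open>Linear maps that are homogeneous of degree 0.\<close>

definition graded_hom ::
  "('a, 'm) ring_scheme \<Rightarrow> ('a, 'b) graded_module \<Rightarrow> ('a, 'c) graded_module \<Rightarrow> ('b \<Rightarrow> 'c) set" where
  "graded_hom R M N =
    {f \<in> hom (add_monoid M) (add_monoid N).
       (\<forall>a\<in>carrier R. \<forall>x\<in>carrier M. f (a \<odot>\<^bsub>M\<^esub> x) = a \<odot>\<^bsub>N\<^esub> f x) \<and>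
       (\<forall>e. f ` component M e \<subseteq> component N e)}"

text \<open>The submodule \<open>I M\<close> of \<open>M\<close>.\<close>

definition ideal_smult ::
  "('a, 'm) ring_scheme \<Rightarrow> 'a set \<Rightarrow> ('a, 'b, 'n) module_scheme \<Rightarrow> 'b set" where
  "ideal_smult R I M =
    \<Inter> {N. submodule N R M \<and> (\<forall>a\<in>I. \<forall>x\<in>carrier M. a \<odot>\<^bsub>M\<^esub> x \<in> N)}"


section \<open>Minimal graded free resolutions and graded Betti numbers\<close>

text \<open>An exact complex \<open>\<dots> \<rightarrow> F\<^sub>2 \<rightarrow> F\<^sub>1 \<rightarrow> F\<^sub>0 \<rightarrow> M \<rightarrow> 0\<close> of graded modules and maps of
  degree 0, where \<open>F\<^sub>i\<close> is free of finite rank with shifts \<open>s i\<close>, \<open>d i\<close> maps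
  \<open>F\<^sub>i\<^sub>+\<^sub>1\<close> to \<open>F\<^sub>i\<close>, and \<open>\<epsilon>\<close> is the augmentation. It is minimal if the image of \<open>d i\<close> lies in
  \<open>\<mm> F\<^sub>i\<close>, where \<open>\<mm>\<close> is the ideal generated by the variables.\<close>

definition minimal_graded_free_resolution ::
  "'v set \<Rightarrow> (('v, 'k::field) mpoly, 'b) graded_module \<Rightarrow> (nat \<Rightarrow> int list) \<Rightarrow>
   (nat \<Rightarrow> (nat \<Rightarrow> ('v, 'k) mpoly) \<Rightarrow> (nat \<Rightarrow> ('v, 'k) mpoly)) \<Rightarrow>
   ((nat \<Rightarrow> ('v, 'k) mpoly) \<Rightarrow> 'b) \<Rightarrow> bool" where
  "minimal_graded_free_resolution V M s d \<epsilon> \<longleftrightarrow>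
    (let R = mpoly_ring V; F = (\<lambda>i. graded_free V (s i)) in
      \<epsilon> \<in> graded_hom R (F 0) M \<and>
      (\<forall>i. d i \<in> graded_hom R (F (Suc i)) (F i)) \<and>
      \<epsilon> ` carrier (F 0) = carrier M \<and>
      d 0 ` carrier (F 1) = a_kernel (F 0) M \<epsilon> \<and>
      (\<forall>i. d (Suc i) ` carrier (F (Suc (Suc i))) = a_kernel (F (Suc i)) (F i) (d i)) \<and>
      (\<forall>i. d i ` carrier (F (Suc i)) \<subseteq> ideal_smult R (irrelevant_ideal V) (F i)))"

text \<open>The multiplicity of \<open>R(-j)\<close> in homological degree \<open>i\<close>. It does not depend on the choice
  of the resolution.\<close>

definition graded_betti ::
  "'v set \<Rightarrow> (('v, 'k::field) mpoly, 'b) graded_module \<Rightarrow> int \<Rightarrow> int \<Rightarrow> nat" where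
  "graded_betti V M i j =
    (if i < 0 then 0
     else (THE b. \<exists>s d \<epsilon>. minimal_graded_free_resolution V M s d \<epsilon> \<and>
                           b = count_list (s (nat i)) j))"


section \<open>Graphs and their ideals of connected subsets\<close>

text \<open>A simple graph is a symmetric loop-free digraph without parallel arcs (\<^locale>\<open>pair_graph\<close>).\<close>

definition cycle_graph :: "nat \<Rightarrow> nat pair_pre_digraph" where
  "cycle_graph n =
    \<lparr>pverts = {0..<n},
     parcs = {(x, y). x < n \<and> y < n \<and> (y = (x + 1) mod n \<or> x = (y + 1) mod n)}\<rparr>"

text \<open>The wheel with \<open>n + 1\<close> vertices; the hub is the vertex \<open>n\<close>.\<close>

definition wheel_graph :: "nat \<Rightarrow> nat pair_pre_digraph" where
  "wheel_graph n =
    \<lparr>pverts = insert n (pverts (cycle_graph n)),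
     parcs = parcs (cycle_graph n) \<union> {n} \<times> pverts (cycle_graph n) \<union> pverts (cycle_graph n) \<times> {n}\<rparr>"

lemma pair_graph_cycle_graph: "n \<ge> 2 \<Longrightarrow> pair_graph (cycle_graph n)"
proof
  show "finite (parcs (cycle_graph n))"
    by (rule finite_subset[of _ "{0..<n} \<times> {0..<n}"]) (auto simp: cycle_graph_def)
qed (auto simp: cycle_graph_def symmetric_def sym_def mod_Suc split: if_splits)

lemma pair_graph_wheel_graph:
  assumes "n \<ge> 2"
  shows "pair_graph (wheel_graph n)"
proof -
  interpret C: pair_graph "cycle_graph n"
    using assms by (rule pair_graph_cycle_graph)
  have n: "n \<notin> pverts (cycle_graph n)"
    by (simp add: cycle_graph_def)
  show ?thesis
  proof
    show "symmetric (with_proj (wheel_graph n))"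
      using C.pair_sym_arcs by (auto simp: wheel_graph_def symmetric_def sym_def)
  qed (use n C.pair_no_loops C.in_arcsD1 C.in_arcsD2 in \<open>auto simp: wheel_graph_def\<close>)
qed

definition connected_ideal :: "'v pair_pre_digraph \<Rightarrow> nat \<Rightarrow> ('v, 'k::field) mpoly set" where
  "connected_ideal G r = Idl\<^bsub>mpoly_ring (pverts G)\<^esub>
    {\<Prod>x\<in>A. mpoly_var x | A. A \<subseteq> pverts G \<and> card A = r + 1 \<and>
                           Digraph_Component.connected (with_proj G \<restriction> A)}"

text \<open>\<open>\<beta>\<^sub>i\<^sub>,\<^sub>j(R\<^sub>G/I\<^sub>r(G))\<close> over the field \<open>'k\<close>, which is passed as a type argument.\<close>

definition graph_betti ::
  "'k::field itself \<Rightarrow> 'v pair_pre_digraph \<Rightarrow> nat \<Rightarrow> int \<Rightarrow> int \<Rightarrow> nat" where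
  "graph_betti K G r i j =
    graded_betti (pverts G) (quotient_module (pverts G) (connected_ideal G r :: ('v, 'k) mpoly set)) i j"


section \<open>Binomial coefficients with integer arguments\<close>

text \<open>Needed because \<open>i + d - 2\<close> may be \<open>-1\<close>, where the coefficient has to vanish even if the
  lower argument is 0; this convention also differs from that of \<^const>\<open>gbinomial\<close>.\<close>

definition int_binomial :: "int \<Rightarrow> int \<Rightarrow> nat" where
  "int_binomial a b = (if a < 0 \<or> b < 0 \<or> b > a then 0 else nat a choose nat b)"

end

theory Submission
  imports Defs "HOL-Library.Function_Algebras"
begin

text \<open>Let \<open>S\<close> be the polynomial ring of the cycle, \<open>y\<close> the hub, \<open>J = I\<^sub>r(C\<^sub>n)\<close> and \<open>L\<close> the ideal of all
  square-free monomials of degree \<open>r\<close> in \<open>S\<close>. Every set containing the hub is connected, so the ideal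
  of the wheel is \<open>J + y L\<close>, and \<open>J \<subseteq> L\<close> gives an exact sequence
  \<open>0 \<rightarrow> y J \<rightarrow> J \<oplus> y L \<rightarrow> J + y L \<rightarrow> 0\<close>. Its mapping cone resolves \<open>J + y L\<close>, and it is minimal because the
  resolution of \<open>L\<close> is linear while \<open>J\<close> is generated in degree \<open>r + 1\<close>. The same cone, with the
  ideals of square-free monomials of degrees \<open>r\<close> and \<open>r - 1\<close> in one variable less, yields the linear
  resolution of \<open>L\<close> and Pascal-type recursions for its Betti numbers.

  Resolutions are built as scalar data: a square-free multigraded complex is exact if and only if it
  is an exact complex of vector spaces in every multidegree, and only the support of the multidegree
  matters. That every minimal graded resolution has the same shifts follows from the comparison
  theorem: an endomorphism of a minimal resolution that lifts the identity is the identity modulo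
  the variables.\<close>

section \<open>Covers of monotone families of vector spaces\<close>

text \<open>The three summands of the formula are the three blocks of the cone. In homological
  degree \<open>i\<close> the block of \<open>y L\<close> contributes the Betti number of the
  quotient by \<open>L\<close> at \<open>(i, i + d - 1)\<close>. The strand of \<open>L\<close> is
  linear and starts with \<open>r\<close> variables in degree 1, so this is nonzero only for
  \<open>d = r\<close>, where it equals the product of binomials. The block of \<open>y J\<close> is
  shifted by one homologically and by one through \<open>y\<close>, which is the source of the term
  at \<open>(i - 1, i + d - 1)\<close>. The Betti numbers of \<open>J\<close> are never computed:
  \<open>J\<close> enters through an arbitrary minimal resolution, of which only the sizes of the
  multidegrees matter. In homological degree \<open>i + 1\<close> these are at least
  \<open>r + 1 + i\<close>, against exactly \<open>r + i\<close> for \<open>L\<close>, so the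
  comparison map has no constant entries there and nothing cancels in the cone. Since
  \<open>graded_betti\<close> is a definite description over all resolutions, a value is available
  only once a minimal resolution is exhibited and shown to share its shifts with every other one.
  Multidegrees that are subsets of a finite set reduce the first task to linear algebra over the
  field.\<close>

lemma (in vector_space) relative_basis:
  assumes "subspace L" "subspace Z" "L \<subseteq> Z" "Z \<subseteq> span E" "finite E"
  obtains B where "finite B" "B \<subseteq> Z"
    "\<And>z. z \<in> Z \<Longrightarrow> \<exists>v. z - (\<Sum>b\<in>B. scale (v b) b) \<in> L"
    "\<And>v. (\<Sum>b\<in>B. scale (v b) b) \<in> L \<Longrightarrow> \<forall>b\<in>B. v b = 0"
proof -
  \<comment> \<open>A basis \<open>B0\<close> of \<open>L\<close> is extended to a basis
    \<open>B1\<close> of \<open>Z\<close>; the added vectors represent a basis of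
    \<open>Z / L\<close>. The finite set \<open>E\<close> bounds their number.\<close>
  obtain B0 where B0: "B0 \<subseteq> L" "independent B0" "L \<subseteq> span B0"
    using maximal_independent_subset[of L] by blast
  obtain B1 where B1: "B0 \<subseteq> B1" "B1 \<subseteq> Z" "independent B1" "Z \<subseteq> span B1"
    using maximal_independent_subset_extend[of B0 Z] B0 assms(3) by blast
  have fin: "finite B1"
    using independent_span_bound[OF \<open>finite E\<close> B1(3)] B1(2) assms(4) by blast
  have fin0: "finite B0" using fin B1(1) finite_subset by blast
  have split: "(\<Sum>b\<in>B1. scale (v b) b) = (\<Sum>b\<in>B1 - B0. scale (v b) b) + (\<Sum>b\<in>B0. scale (v b) b)" for v
    using sum.subset_diff[OF B1(1) fin] by blast
  show ?thesis
  proof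
    show "finite (B1 - B0)" "B1 - B0 \<subseteq> Z" using fin B1 by auto
  next
    fix z assume "z \<in> Z"
    then obtain v where v: "z = (\<Sum>b\<in>B1. scale (v b) b)"
      using B1(4) span_finite[OF fin] by (auto simp: subset_iff image_iff)
    have "(\<Sum>b\<in>B0. scale (v b) b) \<in> L"
      using assms(1) B0(1) by (intro subspace_sum subspace_scale) auto
    then show "\<exists>v. z - (\<Sum>b\<in>B1 - B0. scale (v b) b) \<in> L"
      using v split[of v] by (intro exI[of _ v]) simp
  next
    fix v assume "(\<Sum>b\<in>B1 - B0. scale (v b) b) \<in> L"
    then have "(\<Sum>b\<in>B1 - B0. scale (v b) b) \<in> span B0" using B0(3) by blast
    then obtain w where w: "(\<Sum>b\<in>B1 - B0. scale (v b) b) = (\<Sum>b\<in>B0. scale (w b) b)"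
      using span_finite[OF fin0] by (auto simp: subset_iff image_iff)
    \<comment> \<open>A combination of the new vectors that lies in \<open>L\<close> is rewritten in
      \<open>B0\<close>, which gives one vanishing combination of all of \<open>B1\<close>.\<close>
    define u where "u b = (if b \<in> B0 then - w b else v b)" for b
    have "(\<Sum>b\<in>B1. scale (u b) b) = (\<Sum>b\<in>B1 - B0. scale (v b) b) + (\<Sum>b\<in>B0. scale (- w b) b)"
      unfolding split by (intro arg_cong2[of _ _ _ _ "(+)"] sum.cong) (auto simp: u_def)
    also have "\<dots> = 0" using w by (simp add: scale_minus_left sum_negf)
    finally have "\<forall>b\<in>B1. u b = 0"
      using independent_explicit_finite_subsets[of B1] B1(3) fin by blast
    then show "\<forall>b\<in>B1 - B0. v b = 0" by (auto simp: u_def)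
  qed
qed

section \<open>Spaces of functions and of chains\<close>

definition fscale :: "'k::field \<Rightarrow> ('x \<Rightarrow> 'k) \<Rightarrow> 'x \<Rightarrow> 'k" where
  "fscale r f = (\<lambda>x. r * f x)"

interpretation fv: vector_space fscale
  by unfold_locales (auto simp: fscale_def algebra_simps fun_eq_iff)

lemma sum_fun_apply: "(\<Sum>i\<in>S. f i) x = (\<Sum>i\<in>S. f i x)"
  for f :: "'i \<Rightarrow> 'x \<Rightarrow> 'k::comm_monoid_add"
  by (induction S rule: infinite_finite_induct) auto

text \<open>The part in multidegree \<open>W\<close> of the free module whose basis element \<open>x \<in> X\<close> has multidegree \<open>a x\<close>;
  the monomial factor \<open>W - a x\<close> in front of \<open>x\<close> is left implicit.\<close>

definition chains_in :: "'x set \<Rightarrow> ('x \<Rightarrow> 'v set) \<Rightarrow> 'v set \<Rightarrow> ('x \<Rightarrow> 'k::field) set" where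
  "chains_in X a W = {u. \<forall>x. u x \<noteq> 0 \<longrightarrow> x \<in> X \<and> a x \<subseteq> W}"

text \<open>A row vector times the matrix with rows \<open>c x\<close>. Vectors are rows throughout,
  so a composite map has the rows \<open>bnd Y d (c x)\<close>.\<close>

definition bnd :: "'x set \<Rightarrow> ('x \<Rightarrow> 'y \<Rightarrow> 'k::field) \<Rightarrow> ('x \<Rightarrow> 'k) \<Rightarrow> 'y \<Rightarrow> 'k" where
  "bnd X c u = (\<lambda>l. \<Sum>x\<in>X. u x * c x l)"

definition unit_vec :: "'x \<Rightarrow> 'x \<Rightarrow> 'k::field" where
  "unit_vec x = (\<lambda>y. if y = x then 1 else 0)"

lemma bnd_add: "bnd X c (u + v) = bnd X c u + bnd X c v"
  by (simp add: bnd_def fun_eq_iff algebra_simps sum.distrib)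

lemma bnd_uminus: "bnd X c (- u) = - bnd X c u"
  by (simp add: bnd_def fun_eq_iff sum_negf)

lemma bnd_zero [simp]: "bnd X c 0 = 0"
  by (simp add: bnd_def fun_eq_iff)

lemma bnd_fscale: "bnd X c (fscale r u) = fscale r (bnd X c u)"
  by (simp add: bnd_def fscale_def fun_eq_iff sum_distrib_left algebra_simps)

lemma bnd_unit_vec: "finite X \<Longrightarrow> x \<in> X \<Longrightarrow> bnd X c (unit_vec x) = c x"
  by (simp add: bnd_def unit_vec_def fun_eq_iff if_distrib[of "\<lambda>t. t * _"] cong: if_cong)

lemma bnd_alt: "bnd X c u = (\<Sum>x\<in>X. fscale (u x) (c x))"
  by (simp add: bnd_def fscale_def fun_eq_iff sum_fun_apply)

lemma bnd_bnd: "bnd Y d (bnd X c u) = bnd X (\<lambda>x. bnd Y d (c x)) u"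
  unfolding bnd_def fun_eq_iff
  by (auto simp: sum_distrib_left sum_distrib_right mult.assoc intro: sum.swap)

lemma bnd_cong: "(\<And>x. x \<in> X \<Longrightarrow> u x \<noteq> 0 \<Longrightarrow> c x = d x) \<Longrightarrow> bnd X c u = bnd X d u"
  unfolding bnd_def fun_eq_iff by (auto intro!: sum.cong) (metis mult_eq_0_iff)

lemma chains_inD: "u \<in> chains_in X a W \<Longrightarrow> u x \<noteq> 0 \<Longrightarrow> x \<in> X \<and> a x \<subseteq> W"
  by (simp add: chains_in_def)

lemma chains_mono: "W \<subseteq> W' \<Longrightarrow> chains_in X a W \<subseteq> chains_in X a W'"
  by (auto simp: chains_in_def)

lemma subspace_chains: "fv.subspace (chains_in X a W :: ('x \<Rightarrow> 'k::field) set)"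
proof (rule fv.subspaceI)
  fix u v :: "'x \<Rightarrow> 'k" assume *: "u \<in> chains_in X a W" "v \<in> chains_in X a W"
  have "x \<in> X \<and> a x \<subseteq> W" if "(u + v) x \<noteq> 0" for x
  proof -
    have "u x \<noteq> 0 \<or> v x \<noteq> 0" using that by auto
    then show ?thesis using *[THEN chains_inD] by blast
  qed
  then show "u + v \<in> chains_in X a W" by (simp add: chains_in_def)
qed (auto simp: chains_in_def fscale_def)

lemma unit_vec_chains: "x \<in> X \<Longrightarrow> a x \<subseteq> W \<Longrightarrow> unit_vec x \<in> chains_in X a W"
  by (auto simp: chains_in_def unit_vec_def)

lemma bnd_chains:
  assumes "u \<in> chains_in X a W" "\<And>x y. x \<in> X \<Longrightarrow> c x y \<noteq> 0 \<Longrightarrow> y \<in> Y \<and> b y \<subseteq> a x"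
  shows "bnd X c u \<in> chains_in Y b W"
proof -
  have "y \<in> Y \<and> b y \<subseteq> W" if "bnd X c u y \<noteq> 0" for y
  proof -
    have "\<exists>x\<in>X. u x * c x y \<noteq> 0" using that unfolding bnd_def by (meson sum.neutral)
    then show ?thesis using assms by (fastforce simp: chains_in_def)
  qed
  then show ?thesis by (auto simp: chains_in_def)
qed

lemma chains_span:
  assumes "finite X" "u \<in> chains_in X a W"
  shows "u \<in> fv.span (unit_vec ` X)"
proof -
  have "u = (\<Sum>x\<in>X. fscale (u x) (unit_vec x))"
    using assms by (auto simp: chains_in_def fun_eq_iff sum_fun_apply fscale_def unit_vec_def
        if_distrib[of "\<lambda>t. _ * t"] cong: if_cong)
  also have "\<dots> \<in> fv.span (unit_vec ` X)"
    by (intro fv.span_sum fv.span_scale fv.span_base) auto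
  finally show ?thesis .
qed

text \<open>This is the choice of minimal generators of a multigraded module living in square-free
  degrees. In each degree \<open>W\<close> a basis of \<open>Z W\<close> modulo the span of all
  \<open>Z W'\<close> with \<open>W' \<subset> W\<close> is added, and induction on \<open>W\<close>
  shows that these generate. The last conclusion is minimality: in a relation of degree
  \<open>a' x\<close> the generators of smaller degree contribute to that span, so the coefficients
  in degree \<open>a' x\<close> itself vanish.\<close>

lemma minimal_cover:
  fixes Z :: "'v set \<Rightarrow> ('x \<Rightarrow> 'k::field) set"
  assumes finV: "finite V" and finX: "finite X"
    and sub: "\<And>W. W \<subseteq> V \<Longrightarrow> fv.subspace (Z W)"
    and ch: "\<And>W. W \<subseteq> V \<Longrightarrow> Z W \<subseteq> chains_in X a W"
    and mono: "\<And>W W'. W' \<subseteq> W \<Longrightarrow> W \<subseteq> V \<Longrightarrow> Z W' \<subseteq> Z W"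
  obtains X' :: "nat set" and a' c' where "finite X'"
    "\<And>x. x \<in> X' \<Longrightarrow> a' x \<subseteq> V" "\<And>x. x \<in> X' \<Longrightarrow> c' x \<in> Z (a' x)" "\<And>x. x \<notin> X' \<Longrightarrow> c' x = 0"
    "\<And>W z. W \<subseteq> V \<Longrightarrow> z \<in> Z W \<Longrightarrow> \<exists>v\<in>chains_in X' a' W. bnd X' c' v = z"
    "\<And>v x. x \<in> X' \<Longrightarrow> v \<in> chains_in X' a' (a' x) \<Longrightarrow> bnd X' c' v = 0 \<Longrightarrow> v x = 0"
proof -
  define L where "L W = fv.span (\<Union>W'\<in>{W'. W' \<subset> W}. Z W')" for W
  have LZ: "L W \<subseteq> Z W" if "W \<subseteq> V" for W
    unfolding L_def using that mono sub by (intro fv.span_minimal) blast+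
  define good where "good W B \<longleftrightarrow> finite B \<and> B \<subseteq> Z W \<and> (\<forall>z\<in>Z W. \<exists>v. z - (\<Sum>b\<in>B. fscale (v b) b) \<in> L W) \<and>
      (\<forall>v. (\<Sum>b\<in>B. fscale (v b) b) \<in> L W \<longrightarrow> (\<forall>b\<in>B. v b = 0))" for W B
  have "\<exists>B. good W B" if "W \<subseteq> V" for W
  proof (rule fv.relative_basis[of "L W" "Z W" "unit_vec ` X"])
    show "fv.subspace (L W)" by (simp add: L_def)
    show "Z W \<subseteq> fv.span (unit_vec ` X)" using chains_span[OF finX] ch[OF that] by blast
  next
    fix B assume "finite B" "B \<subseteq> Z W"
      "\<And>z. z \<in> Z W \<Longrightarrow> \<exists>v. z - (\<Sum>b\<in>B. fscale (v b) b) \<in> L W"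
      "\<And>v. (\<Sum>b\<in>B. fscale (v b) b) \<in> L W \<Longrightarrow> \<forall>b\<in>B. v b = 0"
    then show ?thesis unfolding good_def by blast
  qed (use sub that LZ finX in auto)
  then obtain B where good: "\<And>W. W \<subseteq> V \<Longrightarrow> good W (B W)" by metis
  have B: "finite (B W)" "B W \<subseteq> Z W"
    "z \<in> Z W \<Longrightarrow> \<exists>v. z - (\<Sum>b\<in>B W. fscale (v b) b) \<in> L W"
    "(\<Sum>b\<in>B W. fscale (v b) b) \<in> L W \<Longrightarrow> \<forall>b\<in>B W. v b = 0" if "W \<subseteq> V" for W z v
    using good[OF that] unfolding good_def by blast+
  \<comment> \<open>One vector may be chosen in several degrees, so a generator is a pair of a
    degree and a vector. Enumerating the pairs gives index type \<open>nat\<close> whatever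
    \<open>'x\<close> is, which lets the construction be iterated.\<close>
  define P where "P = Sigma (Pow V) B"
  have "finite P" unfolding P_def using finV B(1) by auto
  then obtain h where h: "bij_betw h {0..<card P} P" using ex_bij_betw_nat_finite by blast
  define X' where "X' = {0..<card P}"
  define a' where "a' = fst \<circ> h"
  define c' where "c' x = (if x \<in> X' then snd (h x) else 0)" for x
  have hX: "h ` X' = P" using h by (auto simp: X'_def bij_betw_def)
  have hP: "h x \<in> P" if "x \<in> X'" for x using h that by (auto simp: X'_def bij_betw_def)
  have fX: "finite X'" by (simp add: X'_def)
  have a'V: "a' x \<subseteq> V" if "x \<in> X'" for x using hP[OF that] by (auto simp: a'_def P_def)
  have c'B: "c' x \<in> B (a' x)" if "x \<in> X'" for x
    using hP[OF that] that by (auto simp: a'_def c'_def P_def)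
  have c'Z: "c' x \<in> Z (a' x)" if "x \<in> X'" for x
    using c'B[OF that] B(2) a'V[OF that] by blast
  define S where "S W = bnd X' c' ` chains_in X' a' W" for W
  have subS: "fv.subspace (S W)" for W
    using subspace_chains[of X' a' W] unfolding fv.subspace_def S_def
    by (auto simp flip: bnd_add bnd_fscale intro!: imageI) (metis bnd_zero image_eqI)
  have Smono: "S W \<subseteq> S W'" if "W \<subseteq> W'" for W W' using chains_mono[OF that] unfolding S_def by blast
  have bS: "b \<in> S W" if "W \<subseteq> V" "b \<in> B W" for b W
  proof -
    have "(W, b) \<in> P" using that by (auto simp: P_def)
    then obtain x where x: "x \<in> X'" "h x = (W, b)" unfolding hX[symmetric] by auto
    then have "b = bnd X' c' (unit_vec x)" "unit_vec x \<in> chains_in X' a' W"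
      using fX by (auto simp: bnd_unit_vec c'_def a'_def intro!: unit_vec_chains)
    then show ?thesis unfolding S_def by blast
  qed
  have ZS: "Z W \<subseteq> S W" if "W \<subseteq> V" for W
  proof -
    have "finite W" using that finV finite_subset by blast
    then show ?thesis using that
    proof (induction W rule: finite_psubset_induct)
      case (psubset W)
      have LS: "L W \<subseteq> S W" unfolding L_def
      proof (rule fv.span_minimal[OF _ subS])
        show "(\<Union>W'\<in>{W'. W' \<subset> W}. Z W') \<subseteq> S W"
        proof (rule UN_least)
          fix W' assume "W' \<in> {W'. W' \<subset> W}"
          then have W': "W' \<subset> W" by simp
          have "Z W' \<subseteq> S W'" using psubset.IH[OF W'] W' psubset.prems by (meson order.trans psubset_imp_subset)
          also have "\<dots> \<subseteq> S W" using Smono W' by (meson psubset_imp_subset)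
          finally show "Z W' \<subseteq> S W" .
        qed
      qed
      show ?case
      proof
        fix z assume "z \<in> Z W"
        then obtain v where v: "z - (\<Sum>b\<in>B W. fscale (v b) b) \<in> L W"
          using B(3) psubset.prems by blast
        have "(\<Sum>b\<in>B W. fscale (v b) b) \<in> S W"
          using bS[OF psubset.prems] by (intro fv.subspace_sum[OF subS] fv.subspace_scale[OF subS])
        then have "(z - (\<Sum>b\<in>B W. fscale (v b) b)) + (\<Sum>b\<in>B W. fscale (v b) b) \<in> S W"
          using v LS by (intro fv.subspace_add[OF subS]) auto
        then show "z \<in> S W" by simp
      qed
    qed
  qed
  show ?thesis
  proof (rule that[OF fX a'V c'Z])
    show "\<And>x. x \<notin> X' \<Longrightarrow> c' x = 0" by (simp add: c'_def)
    show "\<exists>v\<in>chains_in X' a' W. bnd X' c' v = z" if "W \<subseteq> V" "z \<in> Z W" for W z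
      using ZS[OF that(1)] that(2) unfolding S_def by blast
    fix v x assume x: "x \<in> X'" and v: "v \<in> chains_in X' a' (a' x)" and 0: "bnd X' c' v = 0"
    define W where "W = a' x"
    have WV: "W \<subseteq> V" using a'V x W_def by auto
    \<comment> \<open>The generators of degree exactly \<open>W\<close>; all others with a nonzero
      coefficient have a degree properly inside \<open>W\<close>.\<close>
    define X1 where "X1 = {y\<in>X'. a' y = W}"
    have split: "bnd X' c' v = (\<Sum>y\<in>X' - X1. fscale (v y) (c' y)) + (\<Sum>y\<in>X1. fscale (v y) (c' y))"
      unfolding bnd_alt using fX by (intro sum.subset_diff) (auto simp: X1_def)
    have rest: "(\<Sum>y\<in>X' - X1. fscale (v y) (c' y)) \<in> L W" unfolding L_def
    proof (rule fv.span_sum)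
      fix y assume y: "y \<in> X' - X1"
      show "fscale (v y) (c' y) \<in> fv.span (\<Union>W'\<in>{W'. W' \<subset> W}. Z W')"
      proof (cases "v y = 0")
        case True
        then have "fscale (v y) (c' y) = 0" by (simp add: fscale_def fun_eq_iff)
        then show ?thesis by (simp only: fv.span_zero)
      next
        case False
        have "a' y \<subseteq> W" unfolding W_def using chains_inD[OF v False] by (rule conjunct2)
        moreover have "a' y \<noteq> W" using y unfolding X1_def by blast
        ultimately have "a' y \<subset> W" by blast
        moreover have "c' y \<in> Z (a' y)" using c'Z y by blast
        ultimately have "c' y \<in> (\<Union>W'\<in>{W'. W' \<subset> W}. Z W')" by blast
        then show ?thesis by (intro fv.span_scale fv.span_base)
      qed
    qed
    have "(\<Sum>y\<in>X1. fscale (v y) (c' y)) = - (\<Sum>y\<in>X' - X1. fscale (v y) (c' y))"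
      using split 0 by (simp add: eq_neg_iff_add_eq_0 add.commute)
    then have "(\<Sum>y\<in>X1. fscale (v y) (c' y)) \<in> L W"
      using fv.span_neg[OF rest[unfolded L_def]] by (simp add: L_def)
    moreover have bij: "bij_betw c' X1 (B W)"
    proof (rule bij_betwI')
      show "(c' y = c' y') = (y = y')" if "y \<in> X1" "y' \<in> X1" for y y'
        using that h by (auto simp: X1_def c'_def a'_def X'_def bij_betw_def inj_on_def prod_eq_iff)
      show "c' y \<in> B W" if "y \<in> X1" for y using that c'B by (auto simp: X1_def)
      show "\<exists>y\<in>X1. b = c' y" if "b \<in> B W" for b
      proof -
        have "(W, b) \<in> P" using that WV by (auto simp: P_def)
        then obtain y where "y \<in> X'" "h y = (W, b)" unfolding hX[symmetric] by auto
        then show ?thesis by (intro bexI[of _ y]) (auto simp: X1_def c'_def a'_def)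
      qed
    qed
    ultimately have "(\<Sum>b\<in>B W. fscale (v (inv_into X1 c' b)) b) \<in> L W"
      by (subst sum.reindex_bij_betw[OF bij, symmetric]) (simp add: bij_betw_inv_into_left[OF bij])
    then have "\<forall>b\<in>B W. v (inv_into X1 c' b) = 0" using B(4)[OF WV, of "\<lambda>b. v (inv_into X1 c' b)"] by simp
    moreover have "x \<in> X1" using x by (simp add: X1_def W_def)
    ultimately show "v x = 0"
      using bij by (metis bij_betw_apply bij_betw_inv_into_left)
  qed
qed


section \<open>Square-free resolutions\<close>

text \<open>The scalar data of a minimal multigraded free resolution of the quotient by the square-free
  monomial ideal of the up-set \<open>U\<close>: the matrix entry at \<open>(x, y)\<close> is \<open>c i x y\<close> times the monomial of
  \<open>a (i + 1) x - a i y\<close>. The single generator \<open>z\<close> in homological degree 0 is excluded from the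
  minimality condition, which admits the unit ideal.\<close>

locale sqfree_res =
  fixes V :: "'v set" and U :: "'v set set"
    and X :: "nat \<Rightarrow> 'x set" and a :: "nat \<Rightarrow> 'x \<Rightarrow> 'v set"
    and c :: "nat \<Rightarrow> 'x \<Rightarrow> 'x \<Rightarrow> 'k::field" and z :: 'x
  assumes fin_V: "finite V"
    and fin_X: "finite (X i)"
    and a_sub: "x \<in> X i \<Longrightarrow> a i x \<subseteq> V"
    and c_supp: "c i x y \<noteq> 0 \<Longrightarrow> x \<in> X (Suc i) \<and> y \<in> X i \<and> a i y \<subseteq> a (Suc i) x"
    and c_min: "c (Suc i) x y \<noteq> 0 \<Longrightarrow> a (Suc i) y \<noteq> a (Suc (Suc i)) x"
    and X_0: "X 0 = {z}" and a_0: "a 0 z = {}"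
    and aug: "W \<subseteq> V \<Longrightarrow> W \<in> U \<longleftrightarrow> (\<exists>v\<in>chains_in (X (Suc 0)) (a (Suc 0)) W. bnd (X (Suc 0)) (c 0) v \<noteq> 0)"
    and dd: "bnd (X (Suc i)) (c i) (c (Suc i) x) = 0"
    and exact: "W \<subseteq> V \<Longrightarrow> u \<in> chains_in (X (Suc i)) (a (Suc i)) W \<Longrightarrow> bnd (X (Suc i)) (c i) u = 0 \<Longrightarrow>
      \<exists>v\<in>chains_in (X (Suc (Suc i))) (a (Suc (Suc i))) W. bnd (X (Suc (Suc i))) (c (Suc i)) v = u"
begin

lemma bnd_c_chains:
  "u \<in> chains_in (X (Suc i)) (a (Suc i)) W \<Longrightarrow> bnd (X (Suc i)) (c i) u \<in> chains_in (X i) (a i) W"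
  by (rule bnd_chains) (use c_supp in blast)+

lemma row_chains: "c i x \<in> chains_in (X i) (a i) (a (Suc i) x)"
  using c_supp by (auto simp: chains_in_def)

text \<open>If the row of \<open>x\<close> vanished, \<open>unit_vec x\<close> would be a cycle in
  degree \<open>a (Suc i) x\<close>, hence a boundary within that degree. A generator hitting
  \<open>x\<close> would then have the same degree as \<open>x\<close>, against
  \<open>c_min\<close>.\<close>

lemma row_nonzero:
  assumes "x \<in> X (Suc i)"
  shows "c i x \<noteq> 0"
proof
  assume "c i x = 0"
  then have 0: "bnd (X (Suc i)) (c i) (unit_vec x) = 0"
    using bnd_unit_vec[OF fin_X assms, of "c i"] by (simp only:)
  obtain v where v: "v \<in> chains_in (X (Suc (Suc i))) (a (Suc (Suc i))) (a (Suc i) x)"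
      "bnd (X (Suc (Suc i))) (c (Suc i)) v = unit_vec x"
    using exact[OF a_sub[OF assms] unit_vec_chains[OF assms] 0] by blast
  have "(\<Sum>y\<in>X (Suc (Suc i)). v y * c (Suc i) y x) = 1"
    using fun_cong[OF v(2), of x] by (simp add: bnd_def unit_vec_def)
  then have "(\<Sum>y\<in>X (Suc (Suc i)). v y * c (Suc i) y x) \<noteq> 0" by simp
  then obtain y where y: "v y \<noteq> 0" "c (Suc i) y x \<noteq> 0"
    by (auto elim!: sum.not_neutral_contains_not_neutral)
  show False
    using chains_inD[OF v(1) y(1)] c_supp[OF y(2)] c_min[OF y(2)] by auto
qed

text \<open>The degrees of the first generators lie in \<open>U\<close>. Rows are nonzero, so each
  later generator has one below it, and by \<open>c_min\<close> the degree grows properly at that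
  step.\<close>

lemma card_a_ge:
  assumes "\<And>W. W \<subseteq> V \<Longrightarrow> W \<in> U \<Longrightarrow> s \<le> card W" "x \<in> X (Suc i)"
  shows "s + i \<le> card (a (Suc i) x)"
  using assms(2)
proof (induction i arbitrary: x)
  case 0
  have "bnd (X (Suc 0)) (c 0) (unit_vec x) \<noteq> 0"
    using row_nonzero[OF 0] by (simp add: bnd_unit_vec[OF fin_X 0])
  then have "a (Suc 0) x \<in> U"
    using aug[OF a_sub[OF 0]] unit_vec_chains[OF 0] by blast
  then show ?case using assms(1)[OF a_sub[OF 0]] by simp
next
  case (Suc i)
  obtain y where y: "c (Suc i) x y \<noteq> 0" using row_nonzero[OF Suc.prems] by (auto simp: fun_eq_iff)
  have "a (Suc i) y \<subset> a (Suc (Suc i)) x" using c_supp[OF y] c_min[OF y] by blast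
  moreover have "finite (a (Suc (Suc i)) x)"
    using a_sub[OF Suc.prems] fin_V finite_subset by blast
  ultimately have "card (a (Suc i) y) < card (a (Suc (Suc i)) x)" by (rule psubset_card_mono[rotated])
  then show ?case using Suc.IH[of y] c_supp[OF y] by simp
qed

end

text \<open>The cycles of each stage form a monotone family of subspaces, which
  \<open>minimal_cover\<close> covers by the next stage. A cover admits no relation with a nonzero
  coefficient in its own degree, and this becomes \<open>c_min\<close> one step later.\<close>

lemma sqfree_res_exists:
  assumes "finite V" and up: "\<And>W W'. W \<in> U \<Longrightarrow> W \<subseteq> W' \<Longrightarrow> W' \<subseteq> V \<Longrightarrow> W' \<in> U"
  obtains X :: "nat \<Rightarrow> nat set" and a and c :: "nat \<Rightarrow> nat \<Rightarrow> nat \<Rightarrow> 'k::field" where "sqfree_res V U X a c 0"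
proof -
  define cyc where "cyc X' a' c W = {u \<in> chains_in X' a' W. bnd X' c u = 0}"
    for X' :: "nat set" and a' :: "nat \<Rightarrow> 'a set" and c :: "nat \<Rightarrow> nat \<Rightarrow> 'k" and W
  \<comment> \<open>A state holds two consecutive free modules and the map \<open>c\<close> between
    them. \<open>P\<close> is the invariant of a single state, and \<open>Q\<close> says that the
    second state continues the first one exactly.\<close>
  define P where "P s = (case s of (X, a, X', a', c) \<Rightarrow> finite X' \<and>
      (\<forall>x\<in>X'. a' x \<subseteq> V \<and> c x \<in> chains_in X a (a' x)) \<and> (\<forall>x. x \<notin> X' \<longrightarrow> c x = 0) \<and>
      (\<forall>x v. x \<in> X' \<longrightarrow> v \<in> cyc X' a' c (a' x) \<longrightarrow> v x = 0))"
    for s :: "nat set \<times> (nat \<Rightarrow> 'a set) \<times> nat set \<times> (nat \<Rightarrow> 'a set) \<times> (nat \<Rightarrow> nat \<Rightarrow> 'k)"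
  define Q where "Q s t = (case s of (X, a, X', a', c) \<Rightarrow> case t of (Y, b, Y', b', e) \<Rightarrow>
      Y = X' \<and> b = a' \<and> (\<forall>y. bnd Y c (e y) = 0) \<and>
      (\<forall>W u. W \<subseteq> V \<longrightarrow> u \<in> cyc X' a' c W \<longrightarrow> (\<exists>v\<in>chains_in Y' b' W. bnd Y' e v = u)))"
    for s t :: "nat set \<times> (nat \<Rightarrow> 'a set) \<times> nat set \<times> (nat \<Rightarrow> 'a set) \<times> (nat \<Rightarrow> nat \<Rightarrow> 'k)"
  \<comment> \<open>The ideal as a family inside the free module of rank one; it is monotone because
    \<open>U\<close> is an up-set.\<close>
  define Z where "Z W = (if W \<in> U then chains_in {0::nat} (\<lambda>_. {}) W else {0 :: nat \<Rightarrow> 'k})" for W :: "'a set"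
  have step: "\<exists>t. P t \<and> Q s t" if "P s" for s
  proof -
    obtain X a X' a' c where s: "s = (X, a, X', a', c)" by (metis prod_cases5)
    have fX: "finite X'" using that by (simp add: P_def s)
    have sub: "fv.subspace (cyc X' a' c W)" for W
      using subspace_chains[of X' a' W] by (auto simp: fv.subspace_def cyc_def bnd_add bnd_fscale)
    obtain Y :: "nat set" and b e where Y: "finite Y" "\<And>x. x \<in> Y \<Longrightarrow> b x \<subseteq> V"
      "\<And>x. x \<in> Y \<Longrightarrow> e x \<in> cyc X' a' c (b x)" "\<And>x. x \<notin> Y \<Longrightarrow> e x = 0"
      "\<And>W z. W \<subseteq> V \<Longrightarrow> z \<in> cyc X' a' c W \<Longrightarrow> \<exists>v\<in>chains_in Y b W. bnd Y e v = z"
      "\<And>v x. x \<in> Y \<Longrightarrow> v \<in> chains_in Y b (b x) \<Longrightarrow> bnd Y e v = 0 \<Longrightarrow> v x = 0"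
    proof (rule minimal_cover[OF assms(1) fX, of "cyc X' a' c" a'])
      show "cyc X' a' c W \<subseteq> cyc X' a' c W'" if "W \<subseteq> W'" for W W'
        using chains_mono[OF that] by (auto simp: cyc_def)
    qed (use sub in \<open>auto simp: cyc_def\<close>)
    have "P (X', a', Y, b, e)"
      using Y by (auto simp: P_def cyc_def)
    moreover have "Q s (X', a', Y, b, e)"
    proof -
      have "bnd X' c (e y) = 0" for y
        using Y(3)[of y] Y(4)[of y] by (cases "y \<in> Y") (auto simp: cyc_def)
      then show ?thesis using Y(5) by (auto simp: Q_def s)
    qed
    ultimately show ?thesis by blast
  qed
  obtain Y :: "nat set" and b e where Y: "finite Y" "\<And>x. x \<in> Y \<Longrightarrow> b x \<subseteq> V"
      "\<And>x. x \<in> Y \<Longrightarrow> e x \<in> Z (b x)" "\<And>x. x \<notin> Y \<Longrightarrow> e x = 0"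
      "\<And>W z. W \<subseteq> V \<Longrightarrow> z \<in> Z W \<Longrightarrow> \<exists>v\<in>chains_in Y b W. bnd Y e v = z"
      "\<And>v x. x \<in> Y \<Longrightarrow> v \<in> chains_in Y b (b x) \<Longrightarrow> bnd Y e v = 0 \<Longrightarrow> v x = 0"
  proof (rule minimal_cover[OF assms(1), of "{0::nat}" Z "\<lambda>_. {}"])
    show "fv.subspace (Z W)" for W by (simp add: Z_def subspace_chains fv.subspace_0)
    have 0: "(0 :: nat \<Rightarrow> 'k) \<in> chains_in {0} (\<lambda>_. {}) W" for W :: "'a set" by (simp add: chains_in_def)
    show "Z W \<subseteq> chains_in {0} (\<lambda>_. {}) W" for W using 0 by (simp add: Z_def)
    show "Z W \<subseteq> Z W'" if "W \<subseteq> W'" "W' \<subseteq> V" for W W'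
      using up[OF _ that] chains_mono[OF that(1), of "{0}" "\<lambda>_. {}"] 0 by (auto simp: Z_def)
  qed auto
  define s0 where "s0 = ({0::nat}, (\<lambda>_. {}) :: nat \<Rightarrow> 'a set, Y, b, e)"
  have Z_sub: "Z W \<subseteq> chains_in {0} (\<lambda>_. {}) W" for W by (auto simp: Z_def chains_in_def)
  have P0: "P s0"
    unfolding s0_def P_def using Y(1,2,4,6) subsetD[OF Z_sub Y(3)] by (auto simp: cyc_def)
  obtain s where s: "\<And>n. P (s n)" "s 0 = s0" "\<And>n. Q (s n) (s (Suc n))"
    using dependent_nat_choice[of "\<lambda>n t. P t \<and> (n = 0 \<longrightarrow> t = s0)" "\<lambda>_. Q"] P0 step
    by (metis nat.distinct(1))
  define X where "X i = fst (s i)" for i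
  define a where "a i = fst (snd (s i))" for i
  define c where "c i = snd (snd (snd (snd (s i))))" for i
  have s_eq: "s i = (X i, a i, X (Suc i), a (Suc i), c i)" for i
    using s(3)[of i] by (auto simp: Q_def X_def a_def c_def split: prod.splits)
  have 00: "X 0 = {0}" "a 0 = (\<lambda>_. {})" "X (Suc 0) = Y" "a (Suc 0) = b" "c 0 = e"
    using s(2) s_eq[of 0] by (simp_all add: s0_def)
  have P: "finite (X (Suc i))" "x \<in> X (Suc i) \<Longrightarrow> a (Suc i) x \<subseteq> V"
    "x \<in> X (Suc i) \<Longrightarrow> c i x \<in> chains_in (X i) (a i) (a (Suc i) x)" "x \<notin> X (Suc i) \<Longrightarrow> c i x = 0"
    "x \<in> X (Suc i) \<Longrightarrow> v \<in> cyc (X (Suc i)) (a (Suc i)) (c i) (a (Suc i) x) \<Longrightarrow> v x = 0" for i x v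
    using s(1)[of i] by (simp_all add: P_def s_eq)
  have Q: "bnd (X (Suc i)) (c i) (c (Suc i) y) = 0"
    "W \<subseteq> V \<Longrightarrow> u \<in> cyc (X (Suc i)) (a (Suc i)) (c i) W \<Longrightarrow>
      \<exists>v\<in>chains_in (X (Suc (Suc i))) (a (Suc (Suc i))) W. bnd (X (Suc (Suc i))) (c (Suc i)) v = u" for i y W u
    using s(3)[of i] by (simp_all add: Q_def s_eq)
  have supp: "x \<in> X (Suc i) \<and> y \<in> X i \<and> a i y \<subseteq> a (Suc i) x" if "c i x y \<noteq> 0" for i x y
    using that P(4)[of x i] chains_inD[OF P(3), of x i y] by (cases "x \<in> X (Suc i)") auto
  show ?thesis
  proof (rule that, unfold_locales)
    show "finite (X i)" for i using P(1) 00(1) by (cases i) auto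
    show "a i x \<subseteq> V" if "x \<in> X i" for i x using P(2)[of x "i - 1"] that 00(1,2) by (cases i) auto
    show "a (Suc i) y \<noteq> a (Suc (Suc i)) x" if nz: "c (Suc i) x y \<noteq> 0" for i x y
    proof
      assume eq: "a (Suc i) y = a (Suc (Suc i)) x"
      \<comment> \<open>The row of \<open>x\<close> is itself a cycle in the degree of
        \<open>y\<close> with a nonzero coefficient at \<open>y\<close>, which the covering property
        excludes.\<close>
      have "c (Suc i) x \<in> cyc (X (Suc i)) (a (Suc i)) (c i) (a (Suc i) y)"
        using P(3)[of x "Suc i"] supp[OF nz] Q(1) by (simp add: cyc_def eq)
      then show False using P(5)[of y i] supp[OF nz] nz by blast
    qed
    show "(W \<in> U) = (\<exists>v\<in>chains_in (X (Suc 0)) (a (Suc 0)) W. bnd (X (Suc 0)) (c 0) v \<noteq> 0)"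
      if W: "W \<subseteq> V" for W
    proof
      assume "W \<in> U"
      then have "unit_vec 0 \<in> Z W" by (simp add: Z_def unit_vec_chains)
      then obtain v where "v \<in> chains_in Y b W" "bnd Y e v = unit_vec 0" using Y(5) W by blast
      moreover have "unit_vec (0::nat) \<noteq> (0 :: nat \<Rightarrow> 'k)"
        by (auto simp: unit_vec_def fun_eq_iff)
      ultimately show "\<exists>v\<in>chains_in (X (Suc 0)) (a (Suc 0)) W. bnd (X (Suc 0)) (c 0) v \<noteq> 0"
        unfolding 00 by force
    next
      assume "\<exists>v\<in>chains_in (X (Suc 0)) (a (Suc 0)) W. bnd (X (Suc 0)) (c 0) v \<noteq> 0"
      then obtain v where v: "v \<in> chains_in Y b W" "bnd Y e v \<noteq> 0" unfolding 00 by blast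
      then obtain y where "y \<in> Y" "v y \<noteq> 0" "e y \<noteq> 0"
        by (metis (no_types, lifting) bnd_alt fv.scale_eq_0_iff sum.neutral)
      then have "b y \<in> U" "b y \<subseteq> W" using Y(3)[of y] chains_inD[OF v(1)] by (auto simp: Z_def split: if_splits)
      then show "W \<in> U" using up W by blast
    qed
    show "bnd (X (Suc i)) (c i) (c (Suc i) x) = 0" for i x by (rule Q)
    show "\<exists>v\<in>chains_in (X (Suc (Suc i))) (a (Suc (Suc i))) W. bnd (X (Suc (Suc i))) (c (Suc i)) v = u"
      if "W \<subseteq> V" "u \<in> chains_in (X (Suc i)) (a (Suc i)) W" "bnd (X (Suc i)) (c i) u = 0" for W u i
      using Q(2)[OF that(1)] that(2,3) by (simp add: cyc_def)
  qed (use assms(1) supp 00 in auto)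
qed

text \<open>The comparison theorem for scalar data: exactness of the target in degree
  \<open>a (Suc i) x\<close> provides the image of \<open>x\<close>. The lift begins with the
  identity of the ring, which maps one ideal into the other because \<open>U\<close> is contained in
  \<open>U'\<close>.\<close>

lemma chain_map_exists:
  fixes c :: "nat \<Rightarrow> 'x \<Rightarrow> 'x \<Rightarrow> 'k::field" and c' :: "nat \<Rightarrow> 'y \<Rightarrow> 'y \<Rightarrow> 'k"
  assumes "sqfree_res V U X a c z" "sqfree_res V U' X' a' c' z'" "\<And>W. W \<subseteq> V \<Longrightarrow> W \<in> U \<Longrightarrow> W \<in> U'"
  obtains \<phi> where "\<And>i x y. \<phi> i x y \<noteq> 0 \<Longrightarrow> x \<in> X i \<and> y \<in> X' i \<and> a' i y \<subseteq> a i x"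
    "\<phi> 0 z z' = 1"
    "\<And>i x. x \<in> X (Suc i) \<Longrightarrow> bnd (X' (Suc i)) (c' i) (\<phi> (Suc i) x) = bnd (X i) (\<phi> i) (c i x)"
proof -
  interpret F: sqfree_res V U X a c z by fact
  interpret G: sqfree_res V U' X' a' c' z' by fact
  define supp where "supp i f \<longleftrightarrow> (\<forall>x y. f x y \<noteq> 0 \<longrightarrow> x \<in> X i \<and> y \<in> X' i \<and> a' i y \<subseteq> a i x)"
    for i and f :: "'x \<Rightarrow> 'y \<Rightarrow> 'k"
  define P where "P i f \<longleftrightarrow> supp i f \<and> (\<forall>x\<in>X (Suc i). \<exists>v\<in>chains_in (X' (Suc i)) (a' (Suc i)) (a (Suc i) x).
      bnd (X' (Suc i)) (c' i) v = bnd (X i) f (c i x))" for i f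
  define Q where "Q i f g \<longleftrightarrow> (\<forall>x\<in>X (Suc i). bnd (X' (Suc i)) (c' i) (g x) = bnd (X i) f (c i x))"
    for i f and g :: "'x \<Rightarrow> 'y \<Rightarrow> 'k"
  define f0 where "f0 x y = (if x = z \<and> y = z' then 1 else 0 :: 'k)" for x y
  have P0: "P 0 f0"
  proof -
    have "\<exists>v\<in>chains_in (X' (Suc 0)) (a' (Suc 0)) (a (Suc 0) x).
        bnd (X' (Suc 0)) (c' 0) v = bnd (X 0) f0 (c 0 x)" if x: "x \<in> X (Suc 0)" for x
    proof -
      have xV: "a (Suc 0) x \<subseteq> V" by (rule F.a_sub[OF x])
      have "bnd (X (Suc 0)) (c 0) (unit_vec x) \<noteq> 0"
        using F.row_nonzero[OF x] by (simp add: bnd_unit_vec[OF F.fin_X x])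
      then have "a (Suc 0) x \<in> U"
        using F.aug[OF xV] unit_vec_chains[OF x, of "a (Suc 0)"] by blast
      then obtain v where v: "v \<in> chains_in (X' (Suc 0)) (a' (Suc 0)) (a (Suc 0) x)"
          "bnd (X' (Suc 0)) (c' 0) v \<noteq> 0"
        using assms(3)[OF xV] G.aug[OF xV] by blast
      define r where "r = bnd (X' (Suc 0)) (c' 0) v z'"
      have off: "bnd (X' (Suc 0)) (c' 0) v y = 0" if "y \<noteq> z'" for y
        using chains_inD[OF G.bnd_c_chains[OF v(1)], of y] that G.X_0 by auto
      have r: "r \<noteq> 0" using v(2) off unfolding r_def by (metis ext zero_fun_def)
      \<comment> \<open>Boundaries in homological degree 0 are supported on the single generator
        \<open>z'\<close>, so any \<open>v\<close> with nonzero boundary can be rescaled to the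
        required value.\<close>
      have "bnd (X' (Suc 0)) (c' 0) (fscale (c 0 x z / r) v) = bnd (X 0) f0 (c 0 x)"
      proof
        fix y
        show "bnd (X' (Suc 0)) (c' 0) (fscale (c 0 x z / r) v) y = bnd (X 0) f0 (c 0 x) y"
          using r off[of y] unfolding bnd_fscale
          by (cases "y = z'") (auto simp: fscale_def F.X_0 bnd_def[of "{z}"] f0_def r_def)
      qed
      moreover have "fscale (c 0 x z / r) v \<in> chains_in (X' (Suc 0)) (a' (Suc 0)) (a (Suc 0) x)"
        using v(1) by (rule fv.subspace_scale[OF subspace_chains])
      ultimately show ?thesis by blast
    qed
    moreover have "supp 0 f0" by (auto simp: supp_def f0_def F.X_0 G.X_0 F.a_0 G.a_0)
    ultimately show ?thesis by (auto simp: P_def)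
  qed
  have step: "\<exists>g. P (Suc i) g \<and> Q i f g" if "P i f" for i f
  proof -
    have "\<forall>x\<in>X (Suc i). \<exists>v. v \<in> chains_in (X' (Suc i)) (a' (Suc i)) (a (Suc i) x) \<and>
        bnd (X' (Suc i)) (c' i) v = bnd (X i) f (c i x)"
      using that by (auto simp: P_def)
    from bchoice[OF this] obtain l where l: "\<And>x. x \<in> X (Suc i) \<Longrightarrow> l x \<in> chains_in (X' (Suc i)) (a' (Suc i)) (a (Suc i) x) \<and>
        bnd (X' (Suc i)) (c' i) (l x) = bnd (X i) f (c i x)"
      by blast
    define g where "g x = (if x \<in> X (Suc i) then l x else 0)" for x
    have supp: "supp (Suc i) g"
    proof -
      have "x \<in> X (Suc i) \<and> y \<in> X' (Suc i) \<and> a' (Suc i) y \<subseteq> a (Suc i) x" if "g x y \<noteq> 0" for x y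
      proof -
        have x: "x \<in> X (Suc i)" using that by (cases "x \<in> X (Suc i)") (auto simp: g_def)
        then show ?thesis using that chains_inD[OF conjunct1[OF l[OF x]], of y] by (simp add: g_def)
      qed
      then show ?thesis by (simp add: supp_def)
    qed
    have Q: "Q i f g" using l by (simp add: Q_def g_def)
    have "\<exists>v\<in>chains_in (X' (Suc (Suc i))) (a' (Suc (Suc i))) (a (Suc (Suc i)) x).
        bnd (X' (Suc (Suc i))) (c' (Suc i)) v = bnd (X (Suc i)) g (c (Suc i) x)" if x: "x \<in> X (Suc (Suc i))" for x
    proof (rule G.exact[OF F.a_sub[OF x]])
      show "bnd (X (Suc i)) g (c (Suc i) x) \<in> chains_in (X' (Suc i)) (a' (Suc i)) (a (Suc (Suc i)) x)"
        by (rule bnd_chains[OF F.row_chains]) (use supp in \<open>auto simp: supp_def\<close>)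
      have "bnd (X' (Suc i)) (c' i) (bnd (X (Suc i)) g (c (Suc i) x))
          = bnd (X (Suc i)) (\<lambda>y. bnd (X i) f (c i y)) (c (Suc i) x)"
        unfolding bnd_bnd by (rule bnd_cong) (use Q in \<open>auto simp: Q_def\<close>)
      also have "\<dots> = bnd (X i) f (bnd (X (Suc i)) (c i) (c (Suc i) x))" by (simp only: bnd_bnd)
      also have "\<dots> = 0" by (simp only: F.dd bnd_zero)
      finally show "bnd (X' (Suc i)) (c' i) (bnd (X (Suc i)) g (c (Suc i) x)) = 0" .
    qed
    then show ?thesis using supp Q by (auto simp: P_def)
  qed
  obtain \<phi> where \<phi>: "\<And>i. P i (\<phi> i)" "\<phi> 0 = f0" "\<And>i. Q i (\<phi> i) (\<phi> (Suc i))"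
    using dependent_nat_choice[of "\<lambda>i t. P i t \<and> (i = 0 \<longrightarrow> t = f0)" Q] P0 step
    by (metis nat.distinct(1))
  show ?thesis
  proof (rule that)
    show "\<phi> i x y \<noteq> 0 \<Longrightarrow> x \<in> X i \<and> y \<in> X' i \<and> a' i y \<subseteq> a i x" for i x y
      using \<phi>(1)[of i] by (simp add: P_def supp_def)
    show "\<phi> 0 z z' = 1" by (simp add: \<phi>(2) f0_def)
    show "bnd (X' (Suc i)) (c' i) (\<phi> (Suc i) x) = bnd (X i) (\<phi> i) (c i x)" if "x \<in> X (Suc i)" for i x
      using \<phi>(3)[of i] that by (simp add: Q_def)
  qed
qed


section \<open>The mapping cone\<close>

text \<open>The cone of \<open>y J \<rightarrow> J \<oplus> y L\<close>, with \<open>X\<close> resolving the quotient by \<open>J\<close> and \<open>X'\<close> the quotient by \<open>L\<close>. Both share the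
  ring as degree 0 part, hence the missing summands in low degrees.\<close>

definition cone_X :: "(nat \<Rightarrow> 'x set) \<Rightarrow> (nat \<Rightarrow> 'y set) \<Rightarrow> nat \<Rightarrow> ('x + 'y + 'x) set" where
  "cone_X X X' i = X i <+> ((if i = 0 then {} else X' i) <+> (if i \<le> 1 then {} else X (i - 1)))"

definition cone_a :: "'v \<Rightarrow> (nat \<Rightarrow> 'x \<Rightarrow> 'v set) \<Rightarrow> (nat \<Rightarrow> 'y \<Rightarrow> 'v set) \<Rightarrow> nat \<Rightarrow> 'x + 'y + 'x \<Rightarrow> 'v set" where
  "cone_a v a a' i = case_sum (a i) (case_sum (\<lambda>y. insert v (a' i y)) (\<lambda>x. insert v (a (i - 1) x)))"

text \<open>The blocks are \<open>J\<close>, \<open>y L\<close> and the shifted \<open>y J\<close>.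
  The first two carry \<open>c\<close> and \<open>c'\<close>. An element \<open>x\<close> of the
  third goes to its copy in the first block by the identity, to \<open>y L\<close> by
  \<open>- \<phi>\<close>, and into its own block by \<open>- c\<close>. For \<open>i = 0\<close>
  both resolutions end in the common generator \<open>z\<close>; for \<open>i = 1\<close> the part
  \<open>- c\<close> is dropped because its target is absent from the cone.\<close>

definition cone_c ::
  "(nat \<Rightarrow> 'x set) \<Rightarrow> (nat \<Rightarrow> 'x \<Rightarrow> 'x \<Rightarrow> 'k::field) \<Rightarrow> 'x \<Rightarrow> (nat \<Rightarrow> 'y \<Rightarrow> 'y \<Rightarrow> 'k) \<Rightarrow> 'y \<Rightarrow>
   (nat \<Rightarrow> 'x \<Rightarrow> 'y \<Rightarrow> 'k) \<Rightarrow> nat \<Rightarrow> 'x + 'y + 'x \<Rightarrow> 'x + 'y + 'x \<Rightarrow> 'k" where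
  "cone_c X c z c' z' \<phi> i =
    case_sum (\<lambda>x. case_sum (c i x) (\<lambda>_. 0))
      (case_sum
        (\<lambda>y. case_sum (\<lambda>x. if i = 0 \<and> x = z then c' 0 y z' else 0)
               (case_sum (\<lambda>l. if i = 0 then 0 else c' i y l) (\<lambda>_. 0)))
        (\<lambda>x. if i = 0 \<or> x \<notin> X i then 0
              else case_sum (unit_vec x) (case_sum (\<lambda>y. - \<phi> i x y) (\<lambda>l. if i = 1 then 0 else - c (i - 1) x l))))"

lemma sum_cone_X:
  assumes "finite (X i)" "finite (X' i)" "finite (X (i - 1))"
  shows "(\<Sum>h\<in>cone_X X X' i. f h) = (\<Sum>x\<in>X i. f (Inl x)) +
    (if i = 0 then 0 else \<Sum>y\<in>X' i. f (Inr (Inl y))) + (if i \<le> 1 then 0 else \<Sum>x\<in>X (i - 1). f (Inr (Inr x)))"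
  using assms by (simp add: cone_X_def sum.Plus o_def add.assoc)

context
  fixes V :: "'v set" and U U' and X :: "nat \<Rightarrow> 'x set" and X' :: "nat \<Rightarrow> 'y set" and a a' and c :: "nat \<Rightarrow> 'x \<Rightarrow> 'x \<Rightarrow> 'k::field"
    and c' z z' and v :: 'v and \<phi> :: "nat \<Rightarrow> 'x \<Rightarrow> 'y \<Rightarrow> 'k"
  assumes F: "sqfree_res V U X a c z" and G: "sqfree_res V U' X' a' c' z'" and v: "v \<notin> V"
    and UU': "\<And>W. W \<subseteq> V \<Longrightarrow> W \<in> U \<Longrightarrow> W \<in> U'"
    and \<phi>_supp: "\<And>i x y. \<phi> i x y \<noteq> 0 \<Longrightarrow> x \<in> X i \<and> y \<in> X' i \<and> a' i y \<subseteq> a i x"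
    and \<phi>_0: "\<phi> 0 z z' = 1"
    and \<phi>_comm: "\<And>i x. x \<in> X (Suc i) \<Longrightarrow> bnd (X' (Suc i)) (c' i) (\<phi> (Suc i) x) = bnd (X i) (\<phi> i) (c i x)"
    \<comment> \<open>Keeps an entry \<open>- \<phi>\<close> from joining equal degrees, the one way
      in which the cone could fail to be minimal.\<close>
    and \<phi>_strict: "\<And>i x y. \<phi> (Suc i) x y \<noteq> 0 \<Longrightarrow> a' (Suc i) y \<noteq> a (Suc i) x"
begin

interpretation F: sqfree_res V U X a c z by (rule F)
interpretation G: sqfree_res V U' X' a' c' z' by (rule G)

abbreviation "XH \<equiv> cone_X X X'"
abbreviation "aH \<equiv> cone_a v a a'"
abbreviation "cH \<equiv> cone_c X c z c' z' \<phi>"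

lemma bnd_cone_0:
  "bnd (XH (Suc 0)) (cH 0) u = case_sum
    (\<lambda>l. bnd (X (Suc 0)) (c 0) (u \<circ> Inl) l + (if l = z then bnd (X' (Suc 0)) (c' 0) (u \<circ> Inr \<circ> Inl) z' else 0))
    (\<lambda>_. 0)"
  by (rule ext, rename_tac h, case_tac h)
    (auto simp: bnd_def sum_cone_X F.fin_X G.fin_X cone_c_def split: sum.splits)

lemma bnd_cone_Suc:
  "bnd (XH (Suc (Suc i))) (cH (Suc i)) u = case_sum
    (\<lambda>l. bnd (X (Suc (Suc i))) (c (Suc i)) (u \<circ> Inl) l + (if l \<in> X (Suc i) then u (Inr (Inr l)) else 0))
    (case_sum
      (\<lambda>y. bnd (X' (Suc (Suc i))) (c' (Suc i)) (u \<circ> Inr \<circ> Inl) y - bnd (X (Suc i)) (\<phi> (Suc i)) (u \<circ> Inr \<circ> Inr) y)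
      (\<lambda>l. if i = 0 then 0 else - bnd (X (Suc i)) (c i) (u \<circ> Inr \<circ> Inr) l))"
proof (rule ext)
  fix h
  show "bnd (XH (Suc (Suc i))) (cH (Suc i)) u h = case_sum
    (\<lambda>l. bnd (X (Suc (Suc i))) (c (Suc i)) (u \<circ> Inl) l + (if l \<in> X (Suc i) then u (Inr (Inr l)) else 0))
    (case_sum
      (\<lambda>y. bnd (X' (Suc (Suc i))) (c' (Suc i)) (u \<circ> Inr \<circ> Inl) y - bnd (X (Suc i)) (\<phi> (Suc i)) (u \<circ> Inr \<circ> Inr) y)
      (\<lambda>l. if i = 0 then 0 else - bnd (X (Suc i)) (c i) (u \<circ> Inr \<circ> Inr) l)) h"
  proof (cases h)
    case (Inl l)
    have "(\<Sum>x\<in>X (Suc i). u (Inr (Inr x)) * unit_vec x l) = (if l \<in> X (Suc i) then u (Inr (Inr l)) else 0)"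
      by (simp add: unit_vec_def if_distrib[of "\<lambda>t. _ * t"] F.fin_X cong: if_cong)
    then show ?thesis
      by (simp add: Inl bnd_def sum_cone_X F.fin_X G.fin_X cone_c_def cong: sum.cong)
  next
    case (Inr h')
    then show ?thesis
      by (cases h') (simp_all add: bnd_def sum_cone_X F.fin_X G.fin_X cone_c_def sum_negf cong: sum.cong)
  qed
qed

lemma cone_comm:
  "bnd (X' (Suc i)) (c' i) (bnd (X (Suc i)) (\<phi> (Suc i)) u) = bnd (X i) (\<phi> i) (bnd (X (Suc i)) (c i) u)"
  unfolding bnd_bnd by (rule bnd_cong) (rule \<phi>_comm)

lemma phi_row_0: "bnd (X 0) (\<phi> 0) u z' = u z"
  by (simp add: F.X_0 bnd_def \<phi>_0)

lemma cone_supp: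
  assumes "cH i h k \<noteq> 0"
  shows "h \<in> XH (Suc i) \<and> k \<in> XH i \<and> aH i k \<subseteq> aH (Suc i) h"
proof (cases h)
  case (Inl x)
  then obtain l where "k = Inl l" "c i x l \<noteq> 0" using assms by (cases k) (auto simp: cone_c_def)
  then show ?thesis using F.c_supp[of i x l] Inl by (auto simp: cone_X_def cone_a_def)
next
  case (Inr h')
  show ?thesis
  proof (cases h')
    case (Inl y)
    show ?thesis
    proof (cases k)
      case (Inl l)
      then show ?thesis using \<open>h' = _\<close> Inr assms G.c_supp[of 0 y z']
        by (auto simp: cone_c_def cone_X_def cone_a_def F.X_0 F.a_0 split: if_splits)
    next
      case (Inr k')
      then show ?thesis using \<open>h' = _\<close> \<open>h = _\<close> assms G.c_supp[of i y "projl k'"]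
        by (cases k') (auto simp: cone_c_def cone_X_def cone_a_def split: if_splits)
    qed
  next
    case (Inr x)
    then have x: "i \<noteq> 0" "x \<in> X i" using assms \<open>h = _\<close> by (auto simp: cone_c_def split: if_splits)
    then have hX: "h \<in> XH (Suc i)" "aH (Suc i) h = insert v (a i x)"
      using Inr \<open>h = _\<close> by (auto simp: cone_X_def cone_a_def)
    show ?thesis
    proof (cases k)
      case (Inl l)
      then have "l = x" using Inr \<open>h = _\<close> assms x by (auto simp: cone_c_def unit_vec_def split: if_splits)
      then show ?thesis using hX x Inl by (auto simp: cone_X_def cone_a_def)
    next
      case k': (Inr k')
      show ?thesis
      proof (cases k')
        case (Inl y)
        then have "\<phi> i x y \<noteq> 0" using k' Inr \<open>h = _\<close> assms x by (auto simp: cone_c_def)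
        then show ?thesis using hX x Inl k' \<phi>_supp[of i x y] by (auto simp: cone_X_def cone_a_def)
      next
        case k'': (Inr l)
        then have l: "i \<noteq> 1" "c (i - 1) x l \<noteq> 0" using k' Inr \<open>h = _\<close> assms x by (auto simp: cone_c_def split: if_splits)
        then show ?thesis using hX x k' k'' F.c_supp[of "i - 1" x l] by (auto simp: cone_X_def cone_a_def)
      qed
    qed
  qed
qed

text \<open>Degrees coming from \<open>V\<close> avoid \<open>v\<close>, so inserting
  \<open>v\<close> is injective on them. The diagonal blocks inherit \<open>c_min\<close>, the
  identity block loses \<open>v\<close>, and the block of \<open>\<phi>\<close> is covered by
  \<open>\<phi>_strict\<close>.\<close>

lemma cone_strict:
  assumes "cH (Suc i) h k \<noteq> 0"
  shows "aH (Suc i) k \<noteq> aH (Suc (Suc i)) h"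
proof -
  have vF: "v \<notin> a j x" if "x \<in> X j" for j x using F.a_sub[OF that] v by blast
  have vG: "v \<notin> a' j y" if "y \<in> X' j" for j y using G.a_sub[OF that] v by blast
  show ?thesis
  proof (cases h)
    case (Inl x)
    then obtain l where "k = Inl l" "c (Suc i) x l \<noteq> 0" using assms by (cases k) (auto simp: cone_c_def)
    then show ?thesis using F.c_min[of i x l] Inl by (auto simp: cone_a_def)
  next
    case h: (Inr h')
    show ?thesis
    proof (cases h')
      case (Inl y)
      then obtain l where l: "k = Inr (Inl l)" "c' (Suc i) y l \<noteq> 0"
        using assms h by (auto simp: cone_c_def split: sum.splits if_splits)
      then show ?thesis
        using h Inl G.c_min[of i y l] vG[of l "Suc i"] vG[of y "Suc (Suc i)"] G.c_supp[OF l(2)]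
        by (auto simp: cone_a_def)
    next
      case h': (Inr x)
      then have x: "x \<in> X (Suc i)" using assms h by (auto simp: cone_c_def split: if_splits)
      show ?thesis
      proof (cases k)
        case (Inl l)
        then have "l = x" using h h' assms x by (auto simp: cone_c_def unit_vec_def split: if_splits)
        then show ?thesis using Inl h h' vF[OF x] by (auto simp: cone_a_def)
      next
        case k: (Inr k')
        show ?thesis
        proof (cases k')
          case (Inl y)
          then have y: "\<phi> (Suc i) x y \<noteq> 0" using k h h' assms x by (auto simp: cone_c_def)
          then show ?thesis using k h h' Inl \<phi>_strict[OF y] vF[OF x] \<phi>_supp[OF y] vG[of y "Suc i"]
            by (auto simp: cone_a_def)
        next
          case k': (Inr l)
          then have l: "i \<noteq> 0" "c i x l \<noteq> 0" using k h h' assms x by (auto simp: cone_c_def split: if_splits)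
          then obtain j where j: "i = Suc j" by (cases i) auto
          show ?thesis using k h h' k' F.c_min[of j x l] F.c_supp[OF l(2)] l vF[OF x] vF[of l i]
            by (auto simp: cone_a_def j)
        qed
      qed
    qed
  qed
qed

text \<open>From the third block, the path through the identity and the path through
  \<open>- c\<close> cancel in the first block, and the chain map identity for \<open>\<phi>\<close>
  cancels the two paths into the second.\<close>

lemma cone_dd: "bnd (XH (Suc i)) (cH i) (cH (Suc i) h) = 0"
proof (cases "h \<in> XH (Suc (Suc i))")
  case False
  then have "cH (Suc i) h = 0" using cone_supp[of "Suc i" h] by (auto simp: fun_eq_iff)
  then show ?thesis by simp
next
  case True
  have R: "bnd (X (Suc i)) (c i) (c (Suc i) x) l = 0" for i x l using F.dd[of i x] by (simp add: fun_eq_iff)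
  have R': "bnd (X' (Suc i)) (c' i) (c' (Suc i) x) l = 0" for i x l using G.dd[of i x] by (simp add: fun_eq_iff)
  have comps: "cH (Suc i) (Inl x) \<circ> Inl = c (Suc i) x" "cH (Suc i) (Inl x) \<circ> Inr \<circ> Inl = 0"
    "cH (Suc i) (Inl x) \<circ> Inr \<circ> Inr = 0" "cH (Suc i) (Inr (Inl y)) \<circ> Inl = 0"
    "cH (Suc i) (Inr (Inl y)) \<circ> Inr \<circ> Inl = c' (Suc i) y" "cH (Suc i) (Inr (Inl y)) \<circ> Inr \<circ> Inr = 0" for x y
    by (auto simp: cone_c_def fun_eq_iff)
  have compsR: "cH (Suc i) (Inr (Inr x)) \<circ> Inl = unit_vec x"
     "cH (Suc i) (Inr (Inr x)) \<circ> Inr \<circ> Inl = - \<phi> (Suc i) x"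
     "cH (Suc i) (Inr (Inr x)) \<circ> Inr \<circ> Inr = (if i = 0 then 0 else - c i x)" if "x \<in> X (Suc i)" for x
    using that by (auto simp: cone_c_def fun_eq_iff)
  show ?thesis
  proof (cases h)
    case (Inl x)
    show ?thesis
    proof (cases i)
      case 0
      show ?thesis
      proof
        fix k
        show "bnd (XH (Suc i)) (cH i) (cH (Suc i) h) k = 0 k"
          using R[of 0 x] unfolding Inl 0 bnd_cone_0 comps(1,2)[of x, unfolded 0]
          by (simp split: sum.splits)
      qed
    next
      case (Suc j)
      have "cH (Suc i) h (Inr (Inr l)) = 0" for l by (simp add: cone_c_def Inl)
      note RR = this[unfolded Inl Suc]
      show ?thesis
      proof
        fix k
        show "bnd (XH (Suc i)) (cH i) (cH (Suc i) h) k = 0 k"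
          using R[of i x] RR unfolding Inl Suc bnd_cone_Suc comps(1,2,3)[of x, unfolded Suc]
          by (simp split: sum.splits)
      qed
    qed
  next
    case h: (Inr h')
    show ?thesis
    proof (cases h')
      case (Inl y)
      show ?thesis
      proof (cases i)
        case 0
        show ?thesis
        proof
          fix k
          show "bnd (XH (Suc i)) (cH i) (cH (Suc i) h) k = 0 k"
            using R'[of 0 y] unfolding h Inl 0 bnd_cone_0 comps(4,5)[of y, unfolded 0]
            by (simp split: sum.splits)
        qed
      next
        case (Suc j)
        have "cH (Suc i) h (Inr (Inr l)) = 0" for l by (simp add: cone_c_def h Inl)
        note RR = this[unfolded h Inl Suc]
        show ?thesis
        proof
          fix k
          show "bnd (XH (Suc i)) (cH i) (cH (Suc i) h) k = 0 k"
            using R'[of i y] RR unfolding h Inl Suc bnd_cone_Suc comps(4,5,6)[of y, unfolded Suc]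
            by (simp split: sum.splits)
        qed
      qed
    next
      case h': (Inr x)
      then have x: "x \<in> X (Suc i)" using True h by (auto simp: cone_X_def)
      note cR = compsR[OF x]
      have ux: "bnd (X (Suc i)) (c i) (unit_vec x) = c i x" by (rule bnd_unit_vec[OF F.fin_X x])
      show ?thesis
      proof (cases i)
        case 0
        have off: "c 0 x l = 0" if "l \<noteq> z" for l using F.c_supp[of 0 x l] that F.X_0 by auto
        \<comment> \<open>At the end of the complex the copy of \<open>x\<close> and its image under
          \<open>- \<phi>\<close> both map to the common generator \<open>z\<close>, and this
          identity makes them cancel there.\<close>
        have "bnd (X' (Suc 0)) (c' 0) (\<phi> (Suc 0) x) z' = c 0 x z"
          using \<phi>_comm[of x 0] x 0 phi_row_0 by simp
        note comm = this
        show ?thesis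
        proof
          fix k
          show "bnd (XH (Suc i)) (cH i) (cH (Suc i) h) k = 0 k"
            using comm off unfolding h h' 0 bnd_cone_0 cR(1,2)[unfolded 0] ux[unfolded 0] bnd_uminus
            by (simp split: sum.splits)
        qed
      next
        case (Suc j)
        have RR: "cH (Suc i) h (Inr (Inr l)) = - c i x l" for l
          using fun_cong[OF cR(3), of l] by (simp add: h h' Suc)
        have off: "c i x l = 0" if "l \<notin> X i" for l using F.c_supp[of i x l] that by auto
        have comm: "bnd (X' (Suc i)) (c' i) (\<phi> (Suc i) x) y = bnd (X i) (\<phi> i) (c i x) y" for y
          using \<phi>_comm[OF x] by simp
        have cR3: "cH (Suc i) (Inr (Inr x)) \<circ> Inr \<circ> Inr = - c i x" using cR(3) Suc by simp
        show ?thesis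
        proof (rule ext)
          fix k
          show "bnd (XH (Suc i)) (cH i) (cH (Suc i) h) k = 0 k"
            using off RR comm R[of j x]
            unfolding Suc bnd_cone_Suc h h' cR(1,2)[unfolded Suc] cR3[unfolded Suc] ux[unfolded Suc] bnd_uminus
            by (simp split: sum.splits)
        qed
      qed
    qed
  qed
qed

text \<open>Degrees from \<open>V\<close> avoid \<open>v\<close>, so each block of a chain of degree
  \<open>W\<close> is a chain of degree \<open>W - {v}\<close>; the two blocks that carry the new
  variable vanish unless \<open>v \<in> W\<close>.\<close>

lemma cone_chains:
  assumes "u \<in> chains_in (XH i) (aH i) W"
  shows "u \<circ> Inl \<in> chains_in (X i) (a i) (W - {v})" "u \<circ> Inr \<circ> Inl \<in> chains_in (X' i) (a' i) (W - {v})"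
    "u \<circ> Inr \<circ> Inr \<in> chains_in (X (i - 1)) (a (i - 1)) (W - {v})"
    "v \<notin> W \<Longrightarrow> u \<circ> Inr \<circ> Inl = 0" "v \<notin> W \<Longrightarrow> u \<circ> Inr \<circ> Inr = 0" "i \<le> 1 \<Longrightarrow> u \<circ> Inr \<circ> Inr = 0"
proof -
  have vF: "a j x \<subseteq> W - {v}" if "x \<in> X j" "a j x \<subseteq> W" for j x using F.a_sub[OF that(1)] v that by blast
  have vG: "a' j y \<subseteq> W - {v}" if "y \<in> X' j" "a' j y \<subseteq> W" for j y using G.a_sub[OF that(1)] v that by blast
  note D = chains_inD[OF assms]
  have DL: "x \<in> X i \<and> a i x \<subseteq> W" if "u (Inl x) \<noteq> 0" for x
    using D[OF that] by (auto simp: cone_X_def cone_a_def)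
  have DM: "y \<in> X' i \<and> a' i y \<subseteq> W \<and> v \<in> W" if "u (Inr (Inl y)) \<noteq> 0" for y
    using D[OF that] by (auto simp: cone_X_def cone_a_def split: if_splits)
  have DR: "x \<in> X (i - 1) \<and> a (i - 1) x \<subseteq> W \<and> v \<in> W \<and> \<not> i \<le> 1" if "u (Inr (Inr x)) \<noteq> 0" for x
    using D[OF that] by (auto simp: cone_X_def cone_a_def split: if_splits)
  show "u \<circ> Inl \<in> chains_in (X i) (a i) (W - {v})"
    using vF DL by (simp add: chains_in_def)
  show "u \<circ> Inr \<circ> Inl \<in> chains_in (X' i) (a' i) (W - {v})"
    using vG DM by (simp add: chains_in_def)
  show "u \<circ> Inr \<circ> Inr \<in> chains_in (X (i - 1)) (a (i - 1)) (W - {v})"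
    using vF DR by (simp add: chains_in_def)
  show "u \<circ> Inr \<circ> Inl = 0" if "v \<notin> W" using DM that by (auto simp: fun_eq_iff)
  show "u \<circ> Inr \<circ> Inr = 0" if "v \<notin> W" using DR that by (auto simp: fun_eq_iff)
  show "u \<circ> Inr \<circ> Inr = 0" if "i \<le> 1" using DR that by (auto simp: fun_eq_iff)
qed

lemma cone_chainsI:
  assumes "f \<in> chains_in (X i) (a i) W" "g \<in> chains_in (X' i) (a' i) W" "f' \<in> chains_in (X (i - 1)) (a (i - 1)) W"
    "v \<notin> W \<Longrightarrow> g = 0" "v \<notin> W \<Longrightarrow> f' = 0" "i \<ge> 1" "i \<le> 1 \<Longrightarrow> f' = 0"
  shows "case_sum f (case_sum g f') \<in> chains_in (XH i) (aH i) W"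
proof -
  have "h \<in> XH i \<and> aH i h \<subseteq> W" if nz: "case_sum f (case_sum g f') h \<noteq> 0" for h
  proof (cases h)
    case (Inl x)
    then show ?thesis using nz chains_inD[OF assms(1), of x] by (auto simp: cone_X_def cone_a_def)
  next
    case h: (Inr h')
    show ?thesis
    proof (cases h')
      case (Inl y)
      then have "g y \<noteq> 0" using nz h by simp
      moreover from this have "v \<in> W" using assms(4) by (metis zero_fun_apply)
      ultimately show ?thesis using h Inl chains_inD[OF assms(2), of y] assms(6) by (auto simp: cone_X_def cone_a_def)
    next
      case (Inr x)
      then have "f' x \<noteq> 0" using nz h by simp
      moreover from this have "v \<in> W" using assms(5) by (metis zero_fun_apply)
      moreover from \<open>f' x \<noteq> 0\<close> have "\<not> i \<le> 1" using assms(7) by (metis zero_fun_apply)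
      ultimately show ?thesis using h Inr chains_inD[OF assms(3), of x] by (auto simp: cone_X_def cone_a_def)
    qed
  qed
  then show ?thesis by (simp add: chains_in_def)
qed

text \<open>If \<open>v \<notin> W\<close>, only the first block is present. If
  \<open>v \<in> W\<close>, the identity block cancels the first block against the third and leaves
  the resolution of \<open>L\<close>: a cycle \<open>(f, g, f')\<close> is the boundary of
  \<open>(0, g2, f)\<close>, where \<open>g2\<close> lifts \<open>g + \<phi> f\<close>.\<close>

lemma cone_exact:
  assumes W: "W \<subseteq> insert v V" and u: "u \<in> chains_in (XH (Suc i)) (aH (Suc i)) W"
    and 0: "bnd (XH (Suc i)) (cH i) u = 0"
  shows "\<exists>w\<in>chains_in (XH (Suc (Suc i))) (aH (Suc (Suc i))) W. bnd (XH (Suc (Suc i))) (cH (Suc i)) w = u"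
proof -
  define f where "f = u \<circ> Inl"
  define g where "g = u \<circ> Inr \<circ> Inl"
  define f' where "f' = u \<circ> Inr \<circ> Inr"
  have u_eq: "u = case_sum f (case_sum g f')"
    by (auto simp: f_def g_def f'_def fun_eq_iff split: sum.splits)
  note ch = cone_chains[OF u, folded f_def g_def f'_def]
  have WV: "W - {v} \<subseteq> V" using W by blast
  show ?thesis
  proof (cases "v \<in> W")
    case False
    then have g0: "g = 0" and f'0: "f' = 0" using ch by auto
    have g0': "u \<circ> Inr \<circ> Inl = 0" using g0 by (simp only: g_def)
    have 1: "bnd (X (Suc i)) (c i) f = 0"
    proof (cases i)
      case i0: 0
      show ?thesis
      proof
        fix l
        show "bnd (X (Suc i)) (c i) f l = 0 l"
          using fun_cong[OF 0, of "Inl l"] unfolding i0 bnd_cone_0 g0' f_def by (simp split: if_splits)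
      qed
    next
      case (Suc j)
      have "u (Inr (Inr l)) = 0" for l using f'0 by (simp add: f'_def fun_eq_iff)
      note uRR = this
      show ?thesis
      proof
        fix l
        show "bnd (X (Suc i)) (c i) f l = 0 l"
          using fun_cong[OF 0, of "Inl l"] uRR unfolding Suc bnd_cone_Suc f_def by (simp split: if_splits)
      qed
    qed
    obtain f2 where f2: "f2 \<in> chains_in (X (Suc (Suc i))) (a (Suc (Suc i))) (W - {v})"
        "bnd (X (Suc (Suc i))) (c (Suc i)) f2 = f"
      using F.exact[OF WV ch(1) 1] by blast
    let ?w = "case_sum f2 (case_sum 0 0)"
    have "?w \<in> chains_in (XH (Suc (Suc i))) (aH (Suc (Suc i))) W"
      using subsetD[OF chains_mono[of "W - {v}" W] f2(1)] by (intro cone_chainsI) (auto simp: chains_in_def)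
    moreover have w: "?w \<circ> Inl = f2" "?w \<circ> Inr \<circ> Inl = 0" "?w \<circ> Inr \<circ> Inr = 0" by (auto simp: fun_eq_iff)
    have "bnd (XH (Suc (Suc i))) (cH (Suc i)) ?w = u"
      unfolding bnd_cone_Suc w f2(2) u_eq g0 f'0 by (auto simp: fun_eq_iff split: sum.splits)
    ultimately show ?thesis by blast
  next
    case True
    let ?g = "g + bnd (X (Suc i)) (\<phi> (Suc i)) f"
    have "bnd (X (Suc i)) (\<phi> (Suc i)) f \<in> chains_in (X' (Suc i)) (a' (Suc i)) (W - {v})"
      by (rule bnd_chains[OF ch(1)]) (use \<phi>_supp in blast)
    then have 1: "?g \<in> chains_in (X' (Suc i)) (a' (Suc i)) (W - {v})"
      by (rule fv.subspace_add[OF subspace_chains ch(2)])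
    \<comment> \<open>The first block of the cycle condition determines \<open>f'\<close> from
      \<open>f\<close>; the second block then says that \<open>?g\<close> is a cycle.\<close>
    have df': "f' = - bnd (X (Suc i)) (c i) f \<and> bnd (X' (Suc i)) (c' i) ?g = 0" if pos: "i > 0"
    proof -
      obtain j where j: "i = Suc j" using pos by (cases i) auto
      have e1: "bnd (X (Suc i)) (c i) f l + (if l \<in> X i then f' l else 0) = 0" for l
        using fun_cong[OF 0, of "Inl l"] unfolding j bnd_cone_Suc f_def f'_def by (simp split: if_splits)
      have off: "f' l = 0" if "l \<notin> X i" for l using chains_inD[OF ch(3), of l] that by auto
      have f': "f' = - bnd (X (Suc i)) (c i) f"
      proof
        fix l
        show "f' l = (- bnd (X (Suc i)) (c i) f) l"
          using e1[of l] off[of l] by (cases "l \<in> X i") (simp_all add: eq_neg_iff_add_eq_0 add.commute)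
      qed
      have e2: "bnd (X' (Suc i)) (c' i) g = bnd (X i) (\<phi> i) f'"
        using fun_cong[OF 0, of "Inr (Inl _)"] by (auto simp: j bnd_cone_Suc fun_eq_iff g_def f'_def)
      have "bnd (X' (Suc i)) (c' i) ?g = 0"
        unfolding bnd_add e2 cone_comm f' bnd_uminus by simp
      then show ?thesis using f' by blast
    qed
    \<comment> \<open>For \<open>i = 0\<close> the only coordinate to check is \<open>z'\<close>,
      where the claim is the cycle condition at the common generator \<open>z\<close>.\<close>
    have 2: "bnd (X' (Suc i)) (c' i) ?g = 0"
    proof (cases "i = 0")
      case False
      then show ?thesis using df' by simp
    next
      case True
      show ?thesis
      proof
        fix y
        show "bnd (X' (Suc i)) (c' i) ?g y = 0 y"
        proof (cases "y = z'")
          case False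
          then show ?thesis using chains_inD[OF G.bnd_c_chains[OF 1], of y] True G.X_0 by auto
        next
          case y: True
          have "bnd (X' (Suc 0)) (c' 0) (bnd (X (Suc 0)) (\<phi> (Suc 0)) f) z' = bnd (X (Suc 0)) (c 0) f z"
            using cone_comm True phi_row_0 by simp
          then show ?thesis using fun_cong[OF 0, of "Inl z"]
            by (simp add: True y bnd_add bnd_cone_0 f_def[symmetric] g_def[symmetric] add.commute)
        qed
      qed
    qed
    obtain g2 where g2: "g2 \<in> chains_in (X' (Suc (Suc i))) (a' (Suc (Suc i))) (W - {v})"
        "bnd (X' (Suc (Suc i))) (c' (Suc i)) g2 = ?g"
      using G.exact[OF WV 1 2] by blast
    let ?w = "case_sum 0 (case_sum g2 f)"
    have "?w \<in> chains_in (XH (Suc (Suc i))) (aH (Suc (Suc i))) W"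
      using subsetD[OF chains_mono[of "W - {v}" W] g2(1)] subsetD[OF chains_mono[of "W - {v}" W] ch(1)] True
      by (intro cone_chainsI) (auto simp: chains_in_def)
    moreover have w: "?w \<circ> Inl = 0" "?w \<circ> Inr \<circ> Inl = g2" "?w \<circ> Inr \<circ> Inr = f" by (auto simp: fun_eq_iff)
    have off: "f l = 0" if "l \<notin> X (Suc i)" for l using chains_inD[OF ch(1), of l] that by auto
    have f'0: "i = 0 \<Longrightarrow> f' = 0" using ch(6) by simp
    have "bnd (XH (Suc (Suc i))) (cH (Suc i)) ?w = u"
      unfolding bnd_cone_Suc w g2(2) u_eq using off f'0 df'
      by (auto simp: fun_eq_iff split: sum.splits)
    ultimately show ?thesis by blast
  qed
qed

text \<open>A monomial divisible by \<open>y\<close> lies in \<open>J + y L\<close> if and only if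
  its part over \<open>V\<close> lies in \<open>L\<close>, because \<open>J \<subseteq> L\<close>;
  for the other monomials only \<open>J\<close> counts.\<close>

lemma cone_aug:
  assumes W: "W \<subseteq> insert v V"
  shows "(if v \<in> W then W - {v} \<in> U' else W \<in> U) \<longleftrightarrow>
    (\<exists>u\<in>chains_in (XH (Suc 0)) (aH (Suc 0)) W. bnd (XH (Suc 0)) (cH 0) u \<noteq> 0)"
proof
  have WV: "W - {v} \<subseteq> V" using W by blast
  assume *: "if v \<in> W then W - {v} \<in> U' else W \<in> U"
  show "\<exists>u\<in>chains_in (XH (Suc 0)) (aH (Suc 0)) W. bnd (XH (Suc 0)) (cH 0) u \<noteq> 0"
  proof (cases "v \<in> W")
    case True
    then obtain g where g: "g \<in> chains_in (X' (Suc 0)) (a' (Suc 0)) (W - {v})" "bnd (X' (Suc 0)) (c' 0) g \<noteq> 0"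
      using * G.aug[OF WV] by auto
    have "bnd (X' (Suc 0)) (c' 0) g y = 0" if "y \<noteq> z'" for y
      using chains_inD[OF G.bnd_c_chains[OF g(1)], of y] that G.X_0 by auto
    then have gz: "bnd (X' (Suc 0)) (c' 0) g z' \<noteq> 0" using g(2) by (metis ext zero_fun_def)
    let ?u = "case_sum 0 (case_sum g 0)"
    have "?u \<in> chains_in (XH (Suc 0)) (aH (Suc 0)) W"
      using subsetD[OF chains_mono[of "W - {v}" W] g(1)] True by (intro cone_chainsI) (auto simp: chains_in_def)
    moreover have w: "?u \<circ> Inl = 0" "?u \<circ> Inr \<circ> Inl = g" by (auto simp: fun_eq_iff)
    have "bnd (XH (Suc 0)) (cH 0) ?u (Inl z) \<noteq> 0" unfolding bnd_cone_0 w using gz by simp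
    ultimately show ?thesis by (metis zero_fun_apply)
  next
    case False
    then have "W \<subseteq> V" using W by blast
    then obtain f where f: "f \<in> chains_in (X (Suc 0)) (a (Suc 0)) W" "bnd (X (Suc 0)) (c 0) f \<noteq> 0"
      using * F.aug[of W] False by auto
    let ?u = "case_sum f (case_sum 0 0)"
    have "?u \<in> chains_in (XH (Suc 0)) (aH (Suc 0)) W" using f(1) by (intro cone_chainsI) (auto simp: chains_in_def)
    moreover have w: "?u \<circ> Inl = f" "?u \<circ> Inr \<circ> Inl = 0" by (auto simp: fun_eq_iff)
    obtain l where "bnd (X (Suc 0)) (c 0) f l \<noteq> 0" using f(2) by (auto simp: fun_eq_iff)
    then have "bnd (XH (Suc 0)) (cH 0) ?u (Inl l) \<noteq> 0" unfolding bnd_cone_0 w by auto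
    ultimately show ?thesis by (metis zero_fun_apply)
  qed
next
  have WV: "W - {v} \<subseteq> V" using W by blast
  assume "\<exists>u\<in>chains_in (XH (Suc 0)) (aH (Suc 0)) W. bnd (XH (Suc 0)) (cH 0) u \<noteq> 0"
  then obtain u where u: "u \<in> chains_in (XH (Suc 0)) (aH (Suc 0)) W" "bnd (XH (Suc 0)) (cH 0) u \<noteq> 0" by blast
  note ch = cone_chains[OF u(1)]
  show "if v \<in> W then W - {v} \<in> U' else W \<in> U"
  proof (cases "bnd (X (Suc 0)) (c 0) (u \<circ> Inl) = 0")
    case False
    then have "W - {v} \<in> U" using F.aug[OF WV] ch(1) by blast
    then show ?thesis using UU'[OF WV] by (auto simp: Diff_insert0)
  next
    case True
    have *: "bnd (X' (Suc 0)) (c' 0) (u \<circ> Inr \<circ> Inl) z' \<noteq> 0"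
    proof (rule contrapos_nn[OF u(2)])
      assume eq0: "bnd (X' (Suc 0)) (c' 0) (u \<circ> Inr \<circ> Inl) z' = 0"
      show "bnd (XH (Suc 0)) (cH 0) u = 0"
        unfolding bnd_cone_0 eq0 True by (auto simp: fun_eq_iff split: sum.splits)
    qed
    then have "W - {v} \<in> U'" using G.aug[OF WV] ch(2) by (metis zero_fun_apply)
    moreover have "v \<in> W" using * ch(4) by (metis bnd_zero zero_fun_apply)
    ultimately show ?thesis by simp
  qed
qed

lemma cone_res:
  "sqfree_res (insert v V) {W. if v \<in> W then W - {v} \<in> U' else W \<in> U} XH aH cH (Inl z)"
proof
  show "finite (insert v V)" using F.fin_V by simp
  show "finite (XH i)" for i using F.fin_X G.fin_X by (simp add: cone_X_def)
  show "aH i x \<subseteq> insert v V" if "x \<in> XH i" for i x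
    using that F.a_sub G.a_sub by (fastforce simp: cone_X_def cone_a_def split: if_splits)
  show "cH i x y \<noteq> 0 \<Longrightarrow> x \<in> XH (Suc i) \<and> y \<in> XH i \<and> aH i y \<subseteq> aH (Suc i) x" for i x y
    by (rule cone_supp)
  show "cH (Suc i) x y \<noteq> 0 \<Longrightarrow> aH (Suc i) y \<noteq> aH (Suc (Suc i)) x" for i x y
    by (rule cone_strict)
  show "XH 0 = {Inl z}" by (auto simp: cone_X_def F.X_0)
  show "aH 0 (Inl z) = {}" by (simp add: cone_a_def F.a_0)
  show "bnd (XH (Suc i)) (cH i) (cH (Suc i) x) = 0" for i x by (rule cone_dd)
qed (use cone_exact cone_aug in auto)

end


section \<open>Linear resolutions\<close>

definition betti_count :: "(nat \<Rightarrow> 'x set) \<Rightarrow> (nat \<Rightarrow> 'x \<Rightarrow> 'v set) \<Rightarrow> nat \<Rightarrow> nat \<Rightarrow> nat" where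
  "betti_count X a i j = card {x \<in> X i. card (a i x) = j}"

text \<open>The cone lives on a sum type, whereas its iteration and the passage to lists of shifts
  work with index sets \<open>{..<n}\<close> of naturals. The data are transported along bijections
  \<open>h i\<close>, with \<open>push\<close> and \<open>pull\<close> acting on chains.\<close>

lemma sqfree_res_reindex:
  fixes c :: "nat \<Rightarrow> 'x \<Rightarrow> 'x \<Rightarrow> 'k::field"
  assumes "sqfree_res V U X a c z"
  obtains X' :: "nat \<Rightarrow> nat set" and a' and c' :: "nat \<Rightarrow> nat \<Rightarrow> nat \<Rightarrow> 'k"
  where "sqfree_res V U X' a' c' 0" "\<And>i. X' i = {..<card (X i)}"
    "\<And>i j. betti_count X' a' i j = betti_count X a i j"
proof -
  interpret F: sqfree_res V U X a c z by fact
  define X' where "X' i = {..<card (X i)}" for i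
  obtain h where h: "\<And>i. bij_betw (h i) (X' i) (X i)"
    using ex_bij_betw_nat_finite[OF F.fin_X] unfolding X'_def atLeast0LessThan by metis
  define g where "g i = inv_into (X' i) (h i)" for i
  have gh: "g i (h i k) = k" if "k \<in> X' i" for i k
    unfolding g_def by (rule bij_betw_inv_into_left[OF h that])
  have hg: "h i (g i x) = x" if "x \<in> X i" for i x
    unfolding g_def by (rule bij_betw_inv_into_right[OF h that])
  have hX: "h i k \<in> X i" if "k \<in> X' i" for i k using bij_betw_apply[OF h that] .
  have gX: "g i x \<in> X' i" if "x \<in> X i" for i x
    unfolding g_def using bij_betw_apply[OF bij_betw_inv_into[OF h] that] .
  define a' where "a' i k = a i (h i k)" for i k
  define c' where "c' i k l = (if k \<in> X' (Suc i) \<and> l \<in> X' i then c i (h (Suc i) k) (h i l) else 0)" for i k l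
  define push where "push i u x = (if x \<in> X i then u (g i x) else 0)" for i and u :: "nat \<Rightarrow> 'k" and x
  define pull where "pull i u k = (if k \<in> X' i then u (h i k) else 0)" for i and u :: "'x \<Rightarrow> 'k" and k
  have pp: "pull i (push i u) = u" if "u \<in> chains_in (X' i) (a' i) W" for i u W
  proof
    fix k show "pull i (push i u) k = u k"
      using chains_inD[OF that, of k] by (auto simp: pull_def push_def hX gh)
  qed
  have push_ch: "push i u \<in> chains_in (X i) (a i) W" if "u \<in> chains_in (X' i) (a' i) W" for i u W
    using chains_inD[OF that] hg by (force simp: chains_in_def push_def a'_def)
  have pull_ch: "pull i u \<in> chains_in (X' i) (a' i) W" if "u \<in> chains_in (X i) (a i) W" for i u W
    using chains_inD[OF that] by (auto simp: chains_in_def pull_def a'_def)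
  have bnd': "bnd (X' (Suc i)) (c' i) u = pull i (bnd (X (Suc i)) (c i) (push (Suc i) u))" for i u
  proof
    fix l
    show "bnd (X' (Suc i)) (c' i) u l = pull i (bnd (X (Suc i)) (c i) (push (Suc i) u)) l"
    proof (cases "l \<in> X' i")
      case True
      have "pull i (bnd (X (Suc i)) (c i) (push (Suc i) u)) l
          = (\<Sum>x\<in>X (Suc i). u (g (Suc i) x) * c i x (h i l))"
        using True by (auto simp: pull_def bnd_def push_def intro: sum.cong)
      also have "\<dots> = (\<Sum>k\<in>X' (Suc i). u k * c' i k l)"
        unfolding sum.reindex_bij_betw[OF h, symmetric] using True by (intro sum.cong) (auto simp: gh c'_def)
      finally show ?thesis by (simp add: bnd_def)
    qed (simp add: bnd_def pull_def c'_def)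
  qed
  have push_pull: "push i (pull i u) = u" if "\<And>x. u x \<noteq> 0 \<Longrightarrow> x \<in> X i" for i u
    using that by (auto simp: push_def pull_def fun_eq_iff gX hg)
  have pull0: "pull i u = 0 \<longleftrightarrow> u = 0" if "\<And>x. u x \<noteq> 0 \<Longrightarrow> x \<in> X i" for i u
  proof
    assume "pull i u = 0"
    then have "push i (pull i u) = 0" by (simp add: push_def fun_eq_iff)
    then show "u = 0" using push_pull[OF that] by simp
  qed (simp add: pull_def fun_eq_iff)
  have bnd_supp: "bnd (X (Suc i)) (c i) u x \<noteq> 0 \<Longrightarrow> x \<in> X i" for i u x
    unfolding bnd_def by (auto elim!: sum.not_neutral_contains_not_neutral dest: F.c_supp)
  have pull0b: "pull i (bnd (X (Suc i)) (c i) u) = 0 \<longleftrightarrow> bnd (X (Suc i)) (c i) u = 0" for i u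
    by (rule pull0) (rule bnd_supp)
  have row: "c' i k = (if k \<in> X' (Suc i) then pull i (c i (h (Suc i) k)) else 0)" for i k
    by (auto simp: c'_def pull_def fun_eq_iff)
  have X'0: "X' 0 = {0}" by (simp add: X'_def F.X_0 lessThan_Suc)
  then have h0: "h 0 0 = z" using hX[of 0 0] F.X_0 by auto
  show ?thesis
  proof (rule that[of X' a' c'], unfold_locales)
    show "a' i x \<subseteq> V" if "x \<in> X' i" for i x using F.a_sub[OF hX[OF that]] by (simp add: a'_def)
    show "x \<in> X' (Suc i) \<and> y \<in> X' i \<and> a' i y \<subseteq> a' (Suc i) x" if "c' i x y \<noteq> 0" for i x y
      using that F.c_supp[of i "h (Suc i) x" "h i y"] by (auto simp: c'_def a'_def split: if_splits)
    show "a' (Suc i) y \<noteq> a' (Suc (Suc i)) x" if "c' (Suc i) x y \<noteq> 0" for i x y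
      using that F.c_min[of i "h (Suc (Suc i)) x" "h (Suc i) y"] by (auto simp: c'_def a'_def split: if_splits)
    show "(W \<in> U) = (\<exists>v\<in>chains_in (X' (Suc 0)) (a' (Suc 0)) W. bnd (X' (Suc 0)) (c' 0) v \<noteq> 0)" if W: "W \<subseteq> V" for W
    proof -
      have "(\<exists>v\<in>chains_in (X' (Suc 0)) (a' (Suc 0)) W. bnd (X' (Suc 0)) (c' 0) v \<noteq> 0)
        \<longleftrightarrow> (\<exists>v\<in>chains_in (X (Suc 0)) (a (Suc 0)) W. bnd (X (Suc 0)) (c 0) v \<noteq> 0)"
      proof (safe, goal_cases)
        case (1 v)
        then show ?case using push_ch[OF 1(1)] pull0b unfolding bnd' by blast
      next
        case (2 v)
        have *: "push (Suc 0) (pull (Suc 0) v) = v" using chains_inD[OF 2(1)] by (intro push_pull) blast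
        have "bnd (X' (Suc 0)) (c' 0) (pull (Suc 0) v) \<noteq> 0"
          unfolding bnd' pull0b * by (rule 2(2))
        then show ?case using pull_ch[OF 2(1)] by blast
      qed
      then show ?thesis using F.aug[OF W] by blast
    qed
    show "bnd (X' (Suc i)) (c' i) (c' (Suc i) x) = 0" for i x
    proof (cases "x \<in> X' (Suc (Suc i))")
      case True
      have "push (Suc i) (c' (Suc i) x) = c (Suc i) (h (Suc (Suc i)) x)"
        unfolding row using True F.c_supp by (simp add: push_pull)
      then show ?thesis unfolding bnd' by (simp add: F.dd) (simp add: pull_def fun_eq_iff)
    next
      case False
      then show ?thesis unfolding row by simp
    qed
    show "\<exists>v\<in>chains_in (X' (Suc (Suc i))) (a' (Suc (Suc i))) W. bnd (X' (Suc (Suc i))) (c' (Suc i)) v = u"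
      if asm: "W \<subseteq> V" "u \<in> chains_in (X' (Suc i)) (a' (Suc i)) W" "bnd (X' (Suc i)) (c' i) u = 0" for W u i
    proof -
      have "bnd (X (Suc i)) (c i) (push (Suc i) u) = 0"
        using asm(3) pull0b unfolding bnd' by blast
      then obtain v where v: "v \<in> chains_in (X (Suc (Suc i))) (a (Suc (Suc i))) W"
          "bnd (X (Suc (Suc i))) (c (Suc i)) v = push (Suc i) u"
        using F.exact[OF asm(1) push_ch[OF asm(2)]] by blast
      have "push (Suc (Suc i)) (pull (Suc (Suc i)) v) = v" using chains_inD[OF v(1)] by (intro push_pull) blast
      then have "bnd (X' (Suc (Suc i))) (c' (Suc i)) (pull (Suc (Suc i)) v) = u"
        unfolding bnd' using v(2) pp[OF asm(2)] by simp
      then show ?thesis using pull_ch[OF v(1)] by blast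
    qed
    show "betti_count X' a' i j = betti_count X a i j" for i j
    proof -
      have "bij_betw (h i) {k \<in> X' i. card (a' i k) = j} {x \<in> X i. card (a i x) = j}"
        unfolding a'_def using h[of i]
        by (auto simp: bij_betw_def inj_on_def image_iff)
      then show ?thesis unfolding betti_count_def by (rule bij_betw_same_card)
    qed
  qed (auto simp: F.fin_V X'_def X'0[unfolded X'_def] a'_def h0 F.a_0)
qed

text \<open>As \<open>v \<notin> V\<close>, inserting \<open>v\<close> raises the size of a degree
  by one; the three terms are the three blocks.\<close>

lemma betti_count_cone:
  assumes "sqfree_res V U X a c z" "sqfree_res V U' X' a' c' z'" "v \<notin> V"
  shows "betti_count (cone_X X X') (cone_a v a a') i j =
    betti_count X a i j + (if i = 0 \<or> j = 0 then 0 else betti_count X' a' i (j - 1)) +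
    (if i \<le> 1 \<or> j = 0 then 0 else betti_count X a (i - 1) (j - 1))"
proof -
  interpret F: sqfree_res V U X a c z by fact
  interpret G: sqfree_res V U' X' a' c' z' by fact
  have cF: "card (insert v (a k x)) = Suc (card (a k x))" if "x \<in> X k" for k x
    using F.a_sub[OF that] assms(3) F.fin_V by (metis card_insert_disjoint finite_subset in_mono)
  have cG: "card (insert v (a' k y)) = Suc (card (a' k y))" if "y \<in> X' k" for k y
    using G.a_sub[OF that] assms(3) F.fin_V by (metis card_insert_disjoint finite_subset in_mono)
  have "{h \<in> cone_X X X' i. card (cone_a v a a' i h) = j} =
    {x \<in> X i. card (a i x) = j} <+> ((if i = 0 \<or> j = 0 then {} else {y \<in> X' i. card (a' i y) = j - 1}) <+>
     (if i \<le> 1 \<or> j = 0 then {} else {x \<in> X (i - 1). card (a (i - 1) x) = j - 1}))"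
    using cF[of _ "i - 1"] cG[of _ i] by (auto simp: cone_X_def cone_a_def split: if_splits)
  then show ?thesis
    unfolding betti_count_def by (auto simp: card_Plus F.fin_X G.fin_X)
qed

text \<open>Degrees of different size are different, so the condition \<open>card\<close> supplies
  the strictness of the comparison map.\<close>

lemma cone_exists:
  fixes c :: "nat \<Rightarrow> 'x \<Rightarrow> 'x \<Rightarrow> 'k::field" and c' :: "nat \<Rightarrow> 'y \<Rightarrow> 'y \<Rightarrow> 'k"
  assumes F: "sqfree_res V U X a c z" and G: "sqfree_res V U' X' a' c' z'" and v: "v \<notin> V"
    and UU': "\<And>W. W \<subseteq> V \<Longrightarrow> W \<in> U \<Longrightarrow> W \<in> U'"
    and card: "\<And>i x y. x \<in> X (Suc i) \<Longrightarrow> y \<in> X' (Suc i) \<Longrightarrow> card (a' (Suc i) y) \<noteq> card (a (Suc i) x)"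
  obtains X'' :: "nat \<Rightarrow> nat set" and a'' and c'' :: "nat \<Rightarrow> nat \<Rightarrow> nat \<Rightarrow> 'k"
  where "sqfree_res (insert v V) {W. if v \<in> W then W - {v} \<in> U' else W \<in> U} X'' a'' c'' 0"
    "\<And>i. X'' i = {..<card (X'' i)}"
    "\<And>i j. betti_count X'' a'' i j =
    betti_count X a i j + (if i = 0 \<or> j = 0 then 0 else betti_count X' a' i (j - 1)) +
    (if i \<le> 1 \<or> j = 0 then 0 else betti_count X a (i - 1) (j - 1))"
proof -
  obtain \<phi> where \<phi>: "\<And>i x y. \<phi> i x y \<noteq> 0 \<Longrightarrow> x \<in> X i \<and> y \<in> X' i \<and> a' i y \<subseteq> a i x"
    "\<phi> 0 z z' = 1"
    "\<And>i x. x \<in> X (Suc i) \<Longrightarrow> bnd (X' (Suc i)) (c' i) (\<phi> (Suc i) x) = bnd (X i) (\<phi> i) (c i x)"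
    using chain_map_exists[OF F G UU'] by blast
  have "sqfree_res (insert v V) {W. if v \<in> W then W - {v} \<in> U' else W \<in> U}
    (cone_X X X') (cone_a v a a') (cone_c X c z c' z' \<phi>) (Inl z)"
    by (rule cone_res[OF F G v UU' \<phi>]) (use \<phi>(1) card in metis)+
  then obtain X'' :: "nat \<Rightarrow> nat set" and a'' and c'' :: "nat \<Rightarrow> nat \<Rightarrow> nat \<Rightarrow> 'k"
    where *: "sqfree_res (insert v V) {W. if v \<in> W then W - {v} \<in> U' else W \<in> U} X'' a'' c'' 0"
      "\<And>i. X'' i = {..<card (cone_X X X' i)}"
      "\<And>i j. betti_count X'' a'' i j = betti_count (cone_X X X') (cone_a v a a') i j"
    by (rule sqfree_res_reindex) blast
  show ?thesis
    by (rule that[OF *(1)]) (simp_all add: *(2,3) betti_count_cone[OF F G v])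
qed

text \<open>The index is shifted: \<open>linear_betti n r i\<close> belongs to homological degree \<open>i + 1\<close>.\<close>

definition linear_betti :: "nat \<Rightarrow> nat \<Rightarrow> nat \<Rightarrow> nat" where
  "linear_betti n r i = (if r = 0 then of_bool (i = 0) else (i + r - 1 choose (r - 1)) * (n choose (i + r)))"

text \<open>The summands mirror the blocks of the cone. For \<open>r > 0\<close> Pascal's rule is
  applied to \<open>Suc n\<close> and then to the other factor; for \<open>r = 0\<close> the value
  \<open>of_bool\<close> is the term \<open>n choose 0\<close>, which occurs only for
  \<open>i = 0\<close>.\<close>

lemma linear_betti_rec:
  "linear_betti (Suc n) (Suc r) i =
    linear_betti n (Suc r) i + linear_betti n r i + (if i = 0 then 0 else linear_betti n (Suc r) (i - 1))"
proof (cases r)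
  case 0
  then show ?thesis by (cases i) (auto simp: linear_betti_def)
next
  case (Suc r')
  show ?thesis
  proof (cases i)
    case 0
    then show ?thesis by (simp add: linear_betti_def Suc)
  next
    case (Suc i')
    have "(Suc (i' + Suc r') choose Suc r') = (i' + Suc r' choose r') + (i' + Suc r' choose Suc r')" by simp
    then show ?thesis by (simp add: linear_betti_def \<open>r = _\<close> Suc algebra_simps)
  qed
qed

lemma sqfree_res_cong:
  assumes "sqfree_res V U X a c z" "\<And>W. W \<subseteq> V \<Longrightarrow> W \<in> U \<longleftrightarrow> W \<in> U'"
  shows "sqfree_res V U' X a c z"
proof -
  interpret sqfree_res V U X a c z by fact
  show ?thesis
    by unfold_locales
      (use assms(2) aug fin_V fin_X a_sub c_supp c_min X_0 a_0 dd exact in \<open>simp_all\<close>)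
qed

text \<open>The identity of the ring, with one generator of degree \<open>{}\<close> in homological
  degrees 0 and 1. It serves \<open>r = 0\<close>, where the empty monomial generates.\<close>

lemma unit_res:
  assumes "finite V"
  shows "sqfree_res V UNIV (\<lambda>i. if i \<le> 1 then {0} else {}) (\<lambda>_ _. {})
    (\<lambda>i x y. if i = 0 \<and> x = 0 \<and> y = 0 then 1 else 0 :: 'k::field) (0::nat)"
proof (unfold_locales, goal_cases)
  case (8 W)
  show ?case using unit_vec_chains[of 0 "{0::nat}" "\<lambda>_. {}" W]
    by (auto intro!: bexI[of _ "unit_vec 0"] simp: bnd_def unit_vec_def fun_eq_iff)
next
  case (10 W u i)
  have "u = 0"
  proof
    fix x show "u x = 0 x"
      using chains_inD[OF 10(2), of x] fun_cong[OF 10(3), of 0] by (auto simp: bnd_def split: if_splits)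
  qed
  then show ?case by (intro bexI[of _ 0]) (auto simp: chains_in_def)
qed (auto simp: assms bnd_def fun_eq_iff split: if_splits)

text \<open>The zero ideal, which is the case of positive \<open>r\<close> over no
  variables.\<close>

lemma zero_res:
  assumes "finite V"
  shows "sqfree_res V {} (\<lambda>i. if i = 0 then {0} else {}) (\<lambda>_ _. {}) (\<lambda>_ _ _. 0 :: 'k::field) (0::nat)"
proof (unfold_locales, goal_cases)
  case (10 W u i)
  have "u = 0" using chains_inD[OF 10(2)] by (auto simp: fun_eq_iff)
  then show ?case by (intro bexI[of _ 0]) (auto simp: chains_in_def)
qed (auto simp: assms bnd_def fun_eq_iff)

lemma betti_count_pos:
  assumes "sqfree_res V U X a c z" "x \<in> X i"
  shows "betti_count X a i (card (a i x)) > 0"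
proof -
  interpret sqfree_res V U X a c z by fact
  show ?thesis using assms(2) fin_X[of i] by (auto simp: betti_count_def card_gt_0_iff)
qed

text \<open>A subset of \<open>insert v V\<close> with at least \<open>Suc r'\<close> elements
  either contains \<open>v\<close> and at least \<open>r'\<close> elements of \<open>V\<close>, or
  has all of them in \<open>V\<close>. This is the cone over the cases \<open>Suc r'\<close> and
  \<open>r'\<close>, so \<open>r\<close> is generalized in the induction. By linearity the degrees
  in question have sizes \<open>i + Suc r'\<close> and \<open>i + r'\<close>, which never
  agree.\<close>

lemma linear_res_exists:
  assumes "finite V"
  shows "\<exists>(X :: nat \<Rightarrow> nat set) a (c :: nat \<Rightarrow> nat \<Rightarrow> nat \<Rightarrow> 'k::field).
    sqfree_res V {W. r \<le> card W} X a c 0 \<and>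
    (\<forall>i j. betti_count X a (Suc i) j = (if j = i + r then linear_betti (card V) r i else 0))"
  using assms
proof (induction V arbitrary: r rule: finite_induct)
  case empty
  show ?case
  proof (cases r)
    case 0
    show ?thesis unfolding 0
      by (rule exI, rule exI, rule exI, rule conjI, rule sqfree_res_cong[OF unit_res])
        (auto simp: betti_count_def linear_betti_def)
  next
    case (Suc r')
    show ?thesis unfolding Suc
      by (rule exI, rule exI, rule exI, rule conjI, rule sqfree_res_cong[OF zero_res])
        (auto simp: betti_count_def linear_betti_def)
  qed
next
  case (insert v V)
  show ?case
  proof (cases r)
    case 0
    show ?thesis unfolding 0
      by (rule exI, rule exI, rule exI, rule conjI, rule sqfree_res_cong[OF unit_res])
        (auto simp: betti_count_def linear_betti_def insert.hyps(1))
  next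
    case (Suc r')
    obtain X :: "nat \<Rightarrow> nat set" and a and c :: "nat \<Rightarrow> nat \<Rightarrow> nat \<Rightarrow> 'k"
      where F: "sqfree_res V {W. Suc r' \<le> card W} X a c 0"
        "\<And>i j. betti_count X a (Suc i) j = (if j = i + Suc r' then linear_betti (card V) (Suc r') i else 0)"
      using insert.IH[of "Suc r'"] by blast
    obtain X' :: "nat \<Rightarrow> nat set" and a' and c' :: "nat \<Rightarrow> nat \<Rightarrow> nat \<Rightarrow> 'k"
      where G: "sqfree_res V {W. r' \<le> card W} X' a' c' 0"
        "\<And>i j. betti_count X' a' (Suc i) j = (if j = i + r' then linear_betti (card V) r' i else 0)"
      using insert.IH[of r'] by blast
    have cards: "card (a' (Suc i) y) \<noteq> card (a (Suc i) x)" if "x \<in> X (Suc i)" "y \<in> X' (Suc i)" for i x y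
      using betti_count_pos[where i = "Suc i", OF F(1) that(1)] betti_count_pos[where i = "Suc i", OF G(1) that(2)]
      by (auto simp: F(2) G(2) split: if_splits)
    obtain X'' :: "nat \<Rightarrow> nat set" and a'' and c'' :: "nat \<Rightarrow> nat \<Rightarrow> nat \<Rightarrow> 'k"
      where H: "sqfree_res (insert v V) {W. if v \<in> W then W - {v} \<in> {W. r' \<le> card W} else W \<in> {W. Suc r' \<le> card W}} X'' a'' c'' 0"
      "\<And>i j. betti_count X'' a'' i j =
        betti_count X a i j + (if i = 0 \<or> j = 0 then 0 else betti_count X' a' i (j - 1)) +
        (if i \<le> 1 \<or> j = 0 then 0 else betti_count X a (i - 1) (j - 1))"
      by (rule cone_exists[OF F(1) G(1) insert.hyps(2) _ cards]) auto
    have "sqfree_res (insert v V) {W. r \<le> card W} X'' a'' c'' 0"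
    proof (rule sqfree_res_cong[OF H(1)])
      fix W assume "W \<subseteq> insert v V"
      then have "finite W" using insert.hyps(1) finite_subset by blast
      then show "W \<in> {W. if v \<in> W then W - {v} \<in> {W. r' \<le> card W} else W \<in> {W. Suc r' \<le> card W}} \<longleftrightarrow>
          W \<in> {W. r \<le> card W}"
        using card_Suc_Diff1[of W v] by (auto simp: Suc)
    qed
    moreover have "betti_count X'' a'' (Suc i) j = (if j = i + r then linear_betti (card (insert v V)) r i else 0)" for i j
      using insert.hyps
      by (cases i) (auto simp: H(2) F(2) G(2) Suc linear_betti_rec)
    ultimately show ?thesis by blast
  qed
qed


section \<open>Uniqueness of graded Betti numbers\<close>

abbreviation polys :: "'v set \<Rightarrow> ('v, 'k::field) mpoly set" where
  "polys V \<equiv> carrier (mpoly_ring V)"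

lemma polys_def: "polys V = {p. \<forall>m\<in>Poly_Mapping.keys p. Poly_Mapping.keys m \<subseteq> V}"
  by (simp add: mpoly_ring_def)

lemma polys_add: "p \<in> polys V \<Longrightarrow> q \<in> polys V \<Longrightarrow> p + q \<in> polys V"
  using Poly_Mapping.keys_add[of p q] by (auto simp: polys_def)

lemma polys_uminus: "p \<in> polys V \<Longrightarrow> - p \<in> polys V"
  by (auto simp: polys_def in_keys_iff)

lemma polys_diff: "p \<in> polys V \<Longrightarrow> q \<in> polys V \<Longrightarrow> p - q \<in> polys V"
  using polys_add[of p V "- q"] polys_uminus[of q V] by simp

lemma polys_0: "0 \<in> polys V" by (simp add: polys_def)

lemma polys_1: "1 \<in> polys V" by (simp add: polys_def)

lemma polys_mult:
  assumes "p \<in> polys V" "q \<in> polys V"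
  shows "p * q \<in> polys V"
proof -
  have "Poly_Mapping.keys m \<subseteq> V" if m: "m \<in> Poly_Mapping.keys (p * q)" for m
  proof -
    obtain a b where "a \<in> Poly_Mapping.keys p" "b \<in> Poly_Mapping.keys q" "m = a + b"
      using m Poly_Mapping.keys_mult[of p q] by blast
    then show ?thesis using assms Poly_Mapping.keys_add[of a b] unfolding polys_def by blast
  qed
  then show ?thesis by (simp add: polys_def)
qed

lemma polys_sum: "(\<And>x. x \<in> S \<Longrightarrow> f x \<in> polys V) \<Longrightarrow> sum f S \<in> polys V"
  by (induction S rule: infinite_finite_induct) (auto intro: polys_add polys_0)

lemma polys_single: "Poly_Mapping.keys m \<subseteq> V \<Longrightarrow> Poly_Mapping.single m c \<in> polys V"
  by (simp add: polys_def)

lemmas polys_intros = polys_0 polys_1 polys_add polys_diff polys_uminus polys_mult polys_sum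

lemma mono_deg_superset:
  assumes "finite S" "Poly_Mapping.keys m \<subseteq> S"
  shows "mono_deg m = (\<Sum>x\<in>S. int (Poly_Mapping.lookup m x))"
  unfolding mono_deg_def using assms by (intro sum.mono_neutral_left) (auto simp: in_keys_iff)

lemma mono_deg_add: "mono_deg (a + b) = mono_deg a + mono_deg b"
proof -
  let ?S = "Poly_Mapping.keys a \<union> Poly_Mapping.keys b"
  show ?thesis
    using mono_deg_superset[of ?S "a + b"] mono_deg_superset[of ?S a] mono_deg_superset[of ?S b]
      Poly_Mapping.keys_add[of a b]
    by (simp add: lookup_add sum.distrib)
qed

lemma mono_deg_0 [simp]: "mono_deg 0 = 0" by (simp add: mono_deg_def)

lemma homogeneous_0 [simp]: "homogeneous e 0" by (simp add: homogeneous_def)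

lemma homogeneous_mult: "homogeneous e p \<Longrightarrow> homogeneous f q \<Longrightarrow> homogeneous (e + f) (p * q)"
  using Poly_Mapping.keys_mult[of p q] by (fastforce simp: homogeneous_def mono_deg_add)

lemma homogeneous_add: "homogeneous e p \<Longrightarrow> homogeneous e q \<Longrightarrow> homogeneous e (p + q)"
  using Poly_Mapping.keys_add[of p q] by (auto simp: homogeneous_def)

lemma homogeneous_sum: "(\<And>x. x \<in> S \<Longrightarrow> homogeneous e (f x)) \<Longrightarrow> homogeneous e (sum f S)"
  by (induction S rule: infinite_finite_induct) (auto intro: homogeneous_add)

text \<open>The homogeneous component of degree \<open>e\<close>; with it arbitrary preimages are
  turned into homogeneous ones.\<close>

definition hcomp :: "int \<Rightarrow> ('v, 'k::field) mpoly \<Rightarrow> ('v, 'k) mpoly" where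
  "hcomp e p = Poly_Mapping.mapp (\<lambda>m c. c when mono_deg m = e) p"

lemma lookup_hcomp: "Poly_Mapping.lookup (hcomp e p) m = (Poly_Mapping.lookup p m when mono_deg m = e)"
  by (simp add: hcomp_def lookup_mapp when_def in_keys_iff)

lemma hcomp_add: "hcomp e (p + q) = hcomp e p + hcomp e q"
  by (rule poly_mapping_eqI) (simp add: lookup_hcomp lookup_add when_def)

lemma hcomp_0 [simp]: "hcomp e 0 = 0"
  by (rule poly_mapping_eqI) (simp add: lookup_hcomp)

lemma hcomp_diff: "hcomp e (p - q) = hcomp e p - hcomp e q"
  by (rule poly_mapping_eqI) (simp add: lookup_hcomp lookup_minus when_def)

lemma hcomp_sum: "hcomp e (sum f S) = (\<Sum>x\<in>S. hcomp e (f x))"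
  by (induction S rule: infinite_finite_induct) (auto simp: hcomp_add)

lemma hcomp_homogeneous: "homogeneous e p \<Longrightarrow> hcomp f p = (p when e = f)"
  by (rule poly_mapping_eqI) (auto simp: lookup_hcomp when_def homogeneous_def in_keys_iff)

lemma homogeneous_hcomp: "homogeneous e (hcomp e p)"
  by (auto simp: homogeneous_def in_keys_iff lookup_hcomp when_def split: if_splits)

lemma keys_hcomp: "Poly_Mapping.keys (hcomp e p) = {m \<in> Poly_Mapping.keys p. mono_deg m = e}"
  by (auto simp: in_keys_iff lookup_hcomp when_def split: if_splits)

lemma hcomp_polys: "p \<in> polys V \<Longrightarrow> hcomp e p \<in> polys V"
  by (auto simp: polys_def keys_hcomp)

text \<open>After multiplication by \<open>q\<close>, the monomials of \<open>p\<close> outside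
  degree \<open>e - f\<close> produce nothing in degree \<open>e\<close>.\<close>

lemma hcomp_mult:
  assumes "homogeneous f q"
  shows "hcomp e (p * q) = hcomp (e - f) p * q"
proof -
  let ?r = "p - hcomp (e - f) p"
  have "mono_deg m \<noteq> e" if m: "m \<in> Poly_Mapping.keys (?r * q)" for m
  proof -
    obtain a b where ab: "a \<in> Poly_Mapping.keys ?r" "b \<in> Poly_Mapping.keys q" "m = a + b"
      using m Poly_Mapping.keys_mult[of ?r q] by blast
    have "mono_deg a \<noteq> e - f"
      using ab(1) by (auto simp: in_keys_iff lookup_minus lookup_hcomp when_def)
    then show ?thesis using ab(2,3) assms by (auto simp: homogeneous_def mono_deg_add)
  qed
  then have "hcomp e (?r * q) = 0"
    by (intro poly_mapping_eqI) (auto simp: lookup_hcomp when_def in_keys_iff)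
  moreover have "hcomp e (hcomp (e - f) p * q) = hcomp (e - f) p * q"
    using hcomp_homogeneous[OF homogeneous_mult[OF homogeneous_hcomp assms], of e] by simp
  ultimately show ?thesis
    using hcomp_add[of e "?r * q" "hcomp (e - f) p * q"] by (simp add: algebra_simps)
qed

text \<open>Subtraction of exponents is truncated, so \<open>k - t\<close> is a quotient only if
  \<open>t\<close> divides \<open>k\<close>; the case distinction records this.\<close>

lemma lookup_mult_single:
  "Poly_Mapping.lookup (p * Poly_Mapping.single t c) k =
    (if \<exists>m. k = m + t then Poly_Mapping.lookup p (k - t) * c else 0)"
  for p :: "('v, 'k::field) mpoly"
proof -
  have inner: "(\<Sum>q. Poly_Mapping.lookup (Poly_Mapping.single t c) q when k = l + q) = (c when k = l + t)" for l
  proof -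
    have "(Poly_Mapping.lookup (Poly_Mapping.single t c) q when k = l + q) = ((c when k = l + t) when q = t)" for q
      by (auto simp: lookup_single when_def)
    then show ?thesis by simp
  qed
  have l: "k = l + t \<longleftrightarrow> l = k - t \<and> (\<exists>m. k = m + t)" for l by auto
  have "Poly_Mapping.lookup (p * Poly_Mapping.single t c) k =
    (\<Sum>l. Poly_Mapping.lookup p l * (c when k = l + t))"
    by (simp add: lookup_mult inner)
  also have "\<dots> = (\<Sum>l. (Poly_Mapping.lookup p (k - t) * c when (\<exists>m. k = m + t)) when l = k - t)"
    by (intro arg_cong[where f = Sum_any] ext) (auto simp: when_def)
  finally show ?thesis by (simp add: when_def)
qed

text \<open>Exponents are natural numbers, so a product of monomials is 1 only if both factors are.
  Constant terms are thus multiplicative, which is what makes them a test for minimality.\<close>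

lemma lookup_mult_zero:
  "Poly_Mapping.lookup (p * q) 0 = Poly_Mapping.lookup p 0 * Poly_Mapping.lookup q 0"
  for p q :: "('v, 'k::field) mpoly"
proof -
  have z: "0 = l + r \<longleftrightarrow> l = 0 \<and> r = 0" for l r :: "'v \<Rightarrow>\<^sub>0 nat"
    by (auto simp: poly_mapping_eq_iff lookup_add fun_eq_iff)
  have inner: "(\<Sum>r. Poly_Mapping.lookup q r when 0 = l + r) = (Poly_Mapping.lookup q 0 when l = 0)" for l
  proof -
    have "(Poly_Mapping.lookup q r when 0 = l + r) = ((Poly_Mapping.lookup q 0 when l = 0) when r = 0)" for r
      unfolding z by (auto simp: when_def)
    then show ?thesis by simp
  qed
  have "Poly_Mapping.lookup (p * q) 0 = (\<Sum>l. Poly_Mapping.lookup p l * (Poly_Mapping.lookup q 0 when l = 0))"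
    unfolding lookup_mult inner ..
  also have "\<dots> = (\<Sum>l::'v \<Rightarrow>\<^sub>0 nat. (Poly_Mapping.lookup p 0 * Poly_Mapping.lookup q 0) when l = 0)"
    by (intro arg_cong[where f = Sum_any] ext) (auto simp: when_def)
  finally show ?thesis by simp
qed

section \<open>Row vectors and matrices over the polynomial ring\<close>

definition fvec :: "'v set \<Rightarrow> int list \<Rightarrow> (nat \<Rightarrow> ('v, 'k::field) mpoly) set" where
  "fvec V s = {u. (\<forall>k<length s. u k \<in> polys V) \<and> (\<forall>k\<ge>length s. u k = 0)}"

definition hvec :: "int list \<Rightarrow> int \<Rightarrow> (nat \<Rightarrow> ('v, 'k::field) mpoly) \<Rightarrow> bool" where
  "hvec s e u \<longleftrightarrow> (\<forall>k<length s. homogeneous (e - s ! k) (u k))"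

text \<open>The polynomial analogue of \<open>bnd\<close>, with rows indexed by
  \<open>{..<n}\<close>. Its variant \<open>dotp\<close> has a single column and serves for the
  augmentation.\<close>

definition vmul :: "nat \<Rightarrow> (nat \<Rightarrow> 'a::comm_ring_1) \<Rightarrow> (nat \<Rightarrow> 'b \<Rightarrow> 'a) \<Rightarrow> 'b \<Rightarrow> 'a" where
  "vmul n u A = (\<lambda>l. \<Sum>k<n. u k * A k l)"

definition dotp :: "nat \<Rightarrow> (nat \<Rightarrow> 'a::comm_ring_1) \<Rightarrow> (nat \<Rightarrow> 'a) \<Rightarrow> 'a" where
  "dotp n u p = (\<Sum>k<n. u k * p k)"

definition basis_vec :: "nat \<Rightarrow> nat \<Rightarrow> 'a::comm_ring_1" where
  "basis_vec k = (\<lambda>l. if l = k then 1 else 0)"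

lemma vmul_diff: "vmul n (u - v) A = vmul n u A - vmul n v A"
  by (simp add: vmul_def fun_eq_iff algebra_simps sum_subtractf)

lemma vmul_diff_right: "vmul n u (\<lambda>k. A k - B k) = vmul n u A - vmul n u B"
  by (simp add: vmul_def fun_eq_iff algebra_simps sum_subtractf)

lemma vmul_0: "vmul n 0 A = 0"
  by (simp add: vmul_def fun_eq_iff)

lemma vmul_vmul: "vmul m (vmul n u A) B = vmul n u (\<lambda>k. vmul m (A k) B)"
  unfolding vmul_def fun_eq_iff
  by (auto simp: sum_distrib_left sum_distrib_right mult.assoc intro: sum.swap)

lemma dotp_vmul: "dotp m (vmul n u A) p = dotp n u (\<lambda>k. dotp m (A k) p)"
  unfolding vmul_def dotp_def
  by (auto simp: sum_distrib_left sum_distrib_right mult.assoc intro: sum.swap)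

lemma dotp_diff: "dotp n (u - v) p = dotp n u p - dotp n v p"
  by (simp add: dotp_def algebra_simps sum_subtractf)

lemma dotp_diff_right: "dotp n u (\<lambda>k. p k - q k) = dotp n u p - dotp n u q"
  by (simp add: dotp_def algebra_simps sum_subtractf)

lemma vmul_cong: "(\<And>k. k < n \<Longrightarrow> A k = B k) \<Longrightarrow> vmul n u A = vmul n u B"
  by (simp add: vmul_def)

lemma vmul_basis: "k < n \<Longrightarrow> vmul n (basis_vec k) A = A k"
  by (simp add: vmul_def basis_vec_def fun_eq_iff if_distrib[of "\<lambda>t. t * _"] cong: if_cong)

lemma dotp_basis: "k < n \<Longrightarrow> dotp n (basis_vec k) p = p k"
  by (simp add: dotp_def basis_vec_def if_distrib[of "\<lambda>t. t * _"] cong: if_cong)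

lemma vmul_basis_right:
  assumes "u \<in> fvec V s"
  shows "vmul (length s) u basis_vec = u"
proof
  fix l
  have "vmul (length s) u basis_vec l = (\<Sum>k<length s. if k = l then u k else 0)"
    unfolding vmul_def basis_vec_def by (intro sum.cong) auto
  then show "vmul (length s) u basis_vec l = u l" using assms by (simp add: fvec_def)
qed

lemma fvec_basis: "k < length s \<Longrightarrow> basis_vec k \<in> fvec V s"
  by (auto simp: fvec_def basis_vec_def polys_0 polys_1)

lemma fvec_diff: "u \<in> fvec V s \<Longrightarrow> v \<in> fvec V s \<Longrightarrow> u - v \<in> fvec V s"
  by (simp add: fvec_def polys_diff)

lemma fvec_vmul:
  assumes "\<And>k. k < n \<Longrightarrow> u k \<in> polys V" "\<And>k. k < n \<Longrightarrow> A k \<in> fvec V s"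
  shows "vmul n u A \<in> fvec V s"
  using assms by (auto simp: fvec_def vmul_def intro!: polys_intros sum.neutral)

lemma fvecD: "u \<in> fvec V s \<Longrightarrow> k < length s \<Longrightarrow> u k \<in> polys V"
  by (simp add: fvec_def)

section \<open>Homogeneous ideals and resolutions given by matrices\<close>

locale hom_ideal =
  fixes V :: "'v set" and I :: "('v, 'k::field) mpoly set"
  assumes I_polys: "I \<subseteq> polys V"
    and I_0: "0 \<in> I" and I_add: "x \<in> I \<Longrightarrow> y \<in> I \<Longrightarrow> x + y \<in> I"
    and I_mult: "x \<in> I \<Longrightarrow> q \<in> polys V \<Longrightarrow> q * x \<in> I"
    and I_hcomp: "x \<in> I \<Longrightarrow> hcomp e x \<in> I"
begin

lemma I_uminus: "x \<in> I \<Longrightarrow> - x \<in> I"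
  using I_mult[of x "- 1"] polys_uminus[OF polys_1] by auto

lemma I_diff: "x \<in> I \<Longrightarrow> y \<in> I \<Longrightarrow> x - y \<in> I"
  using I_add[of x "- y"] I_uminus by auto

lemma I_sum: "(\<And>x. x \<in> S \<Longrightarrow> f x \<in> I) \<Longrightarrow> sum f S \<in> I"
  by (induction S rule: infinite_finite_induct) (auto intro: I_add I_0)

lemma I_dotp: "(\<And>k. k < n \<Longrightarrow> u k \<in> polys V) \<Longrightarrow> (\<And>k. k < n \<Longrightarrow> x k \<in> I) \<Longrightarrow> dotp n u x \<in> I"
  unfolding dotp_def by (intro I_sum I_mult) auto

end

text \<open>A minimal graded free resolution of the quotient by \<open>I\<close> with its maps
  replaced by matrices: row \<open>k\<close> of \<open>D i\<close> is the image of the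
  \<open>k\<close>-th basis vector, and \<open>p k\<close> represents the image of the
  \<open>k\<close>-th basis vector in the quotient. The augmentation is therefore read modulo
  \<open>I\<close>. Minimality appears as vanishing constant terms of the entries.\<close>

locale matrix_res = hom_ideal V I
  for V :: "'v set" and I :: "('v, 'k::field) mpoly set" +
  fixes s :: "nat \<Rightarrow> int list" and D :: "nat \<Rightarrow> nat \<Rightarrow> nat \<Rightarrow> ('v, 'k) mpoly"
    and p :: "nat \<Rightarrow> ('v, 'k) mpoly"
  assumes p_polys: "k < length (s 0) \<Longrightarrow> p k \<in> polys V"
    and p_hom: "k < length (s 0) \<Longrightarrow> homogeneous (s 0 ! k) (p k)"
    and D_fvec: "k < length (s (Suc i)) \<Longrightarrow> D i k \<in> fvec V (s i)"
    and D_hom: "k < length (s (Suc i)) \<Longrightarrow> hvec (s i) (s (Suc i) ! k) (D i k)"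
    and D_min: "k < length (s (Suc i)) \<Longrightarrow> Poly_Mapping.lookup (D i k l) 0 = 0"
    and surj: "q \<in> polys V \<Longrightarrow> \<exists>u\<in>fvec V (s 0). dotp (length (s 0)) u p - q \<in> I"
    and exact_0: "u \<in> fvec V (s 0) \<Longrightarrow>
      dotp (length (s 0)) u p \<in> I \<longleftrightarrow> (\<exists>v\<in>fvec V (s (Suc 0)). vmul (length (s (Suc 0))) v (D 0) = u)"
    and exact_Suc: "u \<in> fvec V (s (Suc i)) \<Longrightarrow>
      vmul (length (s (Suc i))) u (D i) = 0 \<longleftrightarrow>
      (\<exists>v\<in>fvec V (s (Suc (Suc i))). vmul (length (s (Suc (Suc i)))) v (D (Suc i)) = u)"
begin

text \<open>Unites the kernel of the augmentation, a condition modulo \<open>I\<close>, with the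
  kernels of the later maps, so that liftings run through a single induction.\<close>

definition cyc :: "nat \<Rightarrow> (nat \<Rightarrow> ('v, 'k) mpoly) \<Rightarrow> bool" where
  "cyc i u \<longleftrightarrow> (case i of 0 \<Rightarrow> dotp (length (s 0)) u p \<in> I | Suc j \<Rightarrow> vmul (length (s i)) u (D j) = 0)"

lemma cyc_0: "cyc 0 u \<longleftrightarrow> dotp (length (s 0)) u p \<in> I"
  and cyc_Suc: "cyc (Suc i) u \<longleftrightarrow> vmul (length (s (Suc i))) u (D i) = 0"
  by (simp_all add: cyc_def)

lemma cyc_lift: "u \<in> fvec V (s i) \<Longrightarrow> cyc i u \<Longrightarrow> \<exists>v\<in>fvec V (s (Suc i)). vmul (length (s (Suc i))) v (D i) = u"
  using exact_0 exact_Suc by (cases i) (auto simp: cyc_def)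

lemma cyc_D: "k < length (s (Suc i)) \<Longrightarrow> cyc i (D i k)"
  using exact_0[OF D_fvec, of k] exact_Suc[OF D_fvec, of k] fvec_basis[of k "s (Suc i)" V] vmul_basis[of k "length (s (Suc i))" "D i"]
  by (cases i) (force simp: cyc_def)+

text \<open>The map has degree 0, so replacing each coordinate of a preimage by its component of the
  right degree gives another preimage of the homogeneous vector \<open>u\<close>.\<close>

lemma cyc_lift_hom:
  assumes "u \<in> fvec V (s i)" "cyc i u" "hvec (s i) e u"
  shows "\<exists>v\<in>fvec V (s (Suc i)). vmul (length (s (Suc i))) v (D i) = u \<and> hvec (s (Suc i)) e v"
proof -
  let ?n = "length (s (Suc i))"
  obtain v where v: "v \<in> fvec V (s (Suc i))" "vmul ?n v (D i) = u"
    using cyc_lift assms by blast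
  define w where "w k = hcomp (e - s (Suc i) ! k) (v k)" for k
  have w: "w \<in> fvec V (s (Suc i))" using v(1) by (auto simp: fvec_def w_def intro: hcomp_polys)
  have "vmul ?n w (D i) l = u l" for l
  proof (cases "l < length (s i)")
    case True
    have "u l = hcomp (e - s i ! l) (u l)"
      using assms(3) True hcomp_homogeneous[of "e - s i ! l" "u l" "e - s i ! l"] by (simp add: hvec_def)
    also have "\<dots> = (\<Sum>k<?n. hcomp (e - s i ! l) (v k * D i k l))"
      unfolding v(2)[symmetric] vmul_def hcomp_sum ..
    also have "\<dots> = (\<Sum>k<?n. w k * D i k l)"
    proof (rule sum.cong[OF refl])
      fix k assume "k \<in> {..<?n}"
      then have "homogeneous (s (Suc i) ! k - s i ! l) (D i k l)"
        using D_hom[of k i] True by (simp add: hvec_def)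
      from hcomp_mult[OF this, of "e - s i ! l" "v k"]
      show "hcomp (e - s i ! l) (v k * D i k l) = w k * D i k l" by (simp add: w_def)
    qed
    finally show ?thesis by (simp add: vmul_def)
  next
    case False
    then show ?thesis using assms(1) D_fvec by (auto simp: fvec_def vmul_def intro!: sum.neutral)
  qed
  then have "vmul ?n w (D i) = u" by blast
  moreover have "hvec (s (Suc i)) e w" by (simp add: hvec_def w_def homogeneous_hcomp)
  ultimately show ?thesis using w by blast
qed

text \<open>Components are taken as in \<open>cyc_lift_hom\<close>; the congruence modulo
  \<open>I\<close> survives because \<open>I\<close> is homogeneous.\<close>

lemma surj_hom:
  assumes "q \<in> polys V" "homogeneous e q"
  shows "\<exists>u\<in>fvec V (s 0). dotp (length (s 0)) u p - q \<in> I \<and> hvec (s 0) e u"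
proof -
  let ?n = "length (s 0)"
  obtain u where u: "u \<in> fvec V (s 0)" "dotp ?n u p - q \<in> I" using surj[OF assms(1)] by blast
  define w where "w k = hcomp (e - s 0 ! k) (u k)" for k
  have w: "w \<in> fvec V (s 0)" using u(1) by (auto simp: fvec_def w_def intro: hcomp_polys)
  have "hcomp e (dotp ?n u p) = dotp ?n w p"
    unfolding dotp_def hcomp_sum
    by (intro sum.cong) (auto simp: w_def intro!: hcomp_mult p_hom)
  then have "hcomp e (dotp ?n u p - q) = dotp ?n w p - q"
    using hcomp_homogeneous[OF assms(2), of e] by (simp add: hcomp_diff)
  then have "dotp ?n w p - q \<in> I" using I_hcomp[OF u(2), of e] by simp
  moreover have "hvec (s 0) e w" by (simp add: hvec_def w_def homogeneous_hcomp)
  ultimately show ?thesis using w by blast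
qed

end

section \<open>Comparison of resolutions and invariance of the shifts\<close>

lemma hvec_vmul:
  assumes "hvec s e u" "\<And>k. k < length s \<Longrightarrow> hvec t (s ! k) (A k)"
  shows "hvec t e (vmul (length s) u A)"
  unfolding hvec_def vmul_def
proof (intro allI impI homogeneous_sum)
  fix l k assume "l < length t" "k \<in> {..<length s}"
  then show "homogeneous (e - t ! l) (u k * A k l)"
    using homogeneous_mult[of "e - s ! k" "u k" "s ! k - t ! l" "A k l"] assms by (simp add: hvec_def)
qed

text \<open>Freeness of the source and exactness of the target lift the identity of the quotient.
  Choosing homogeneous preimages makes the lift a map of degree 0, which later confines its constant
  entries to equal shifts.\<close>

lemma matrix_chain_map:
  fixes D D' :: "nat \<Rightarrow> nat \<Rightarrow> nat \<Rightarrow> ('v, 'k::field) mpoly"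
  assumes "matrix_res V I s D p" "matrix_res V I s' D' p'"
  obtains \<Phi> where "\<And>i k. k < length (s i) \<Longrightarrow> \<Phi> i k \<in> fvec V (s' i)"
    "\<And>i k. k < length (s i) \<Longrightarrow> hvec (s' i) (s i ! k) (\<Phi> i k)"
    "\<And>k. k < length (s 0) \<Longrightarrow> dotp (length (s' 0)) (\<Phi> 0 k) p' - p k \<in> I"
    "\<And>i k. k < length (s (Suc i)) \<Longrightarrow>
      vmul (length (s' (Suc i))) (\<Phi> (Suc i) k) (D' i) = vmul (length (s i)) (D i k) (\<Phi> i)"
proof -
  interpret F: matrix_res V I s D p by fact
  interpret G: matrix_res V I s' D' p' by fact
  define P where "P i f \<longleftrightarrow> (\<forall>k<length (s i). f k \<in> fvec V (s' i) \<and> hvec (s' i) (s i ! k) (f k)) \<and>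
    (\<forall>k<length (s (Suc i)). G.cyc i (vmul (length (s i)) (D i k) f))" for i f
  define Q where "Q i f g \<longleftrightarrow> (\<forall>k<length (s (Suc i)). vmul (length (s' (Suc i))) (g k) (D' i) = vmul (length (s i)) (D i k) f)"
    for i f and g :: "nat \<Rightarrow> nat \<Rightarrow> ('v, 'k) mpoly"
  have "\<forall>k\<in>{..<length (s 0)}. \<exists>u. u \<in> fvec V (s' 0) \<and> dotp (length (s' 0)) u p' - p k \<in> I \<and> hvec (s' 0) (s 0 ! k) u"
  proof
    fix k assume "k \<in> {..<length (s 0)}"
    then show "\<exists>u. u \<in> fvec V (s' 0) \<and> dotp (length (s' 0)) u p' - p k \<in> I \<and> hvec (s' 0) (s 0 ! k) u"
      using G.surj_hom[OF F.p_polys[of k] F.p_hom[of k]] by auto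
  qed
  from bchoice[OF this] obtain f0 where f0: "\<And>k. k < length (s 0) \<Longrightarrow>
      f0 k \<in> fvec V (s' 0) \<and> dotp (length (s' 0)) (f0 k) p' - p k \<in> I \<and> hvec (s' 0) (s 0 ! k) (f0 k)"
    by auto
  have "G.cyc 0 (vmul (length (s 0)) (D 0 k) f0)" if k: "k < length (s (Suc 0))" for k
  proof -
    let ?d = "\<lambda>j. dotp (length (s' 0)) (f0 j) p'"
    have "dotp (length (s 0)) (D 0 k) (\<lambda>j. ?d j - p j) \<in> I"
      using f0 fvecD[OF F.D_fvec[OF k]] by (intro F.I_dotp) auto
    moreover have "dotp (length (s 0)) (D 0 k) p \<in> I"
      using F.cyc_D[OF k] by (simp add: F.cyc_0)
    \<comment> \<open>The chosen \<open>f0\<close> represents \<open>p\<close> only modulo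
      \<open>I\<close>; the error is a combination of elements of \<open>I\<close>.\<close>
    ultimately have "dotp (length (s 0)) (D 0 k) ?d \<in> I"
      using F.I_add by (fastforce simp: dotp_diff_right)
    then show ?thesis by (simp add: G.cyc_0 dotp_vmul)
  qed
  then have P0: "P 0 f0" using f0 by (simp add: P_def)
  have step: "\<exists>g. P (Suc i) g \<and> Q i f g" if Pf: "P i f" for i f
  proof -
    have "\<forall>k\<in>{..<length (s (Suc i))}. \<exists>v. v \<in> fvec V (s' (Suc i)) \<and>
        vmul (length (s' (Suc i))) v (D' i) = vmul (length (s i)) (D i k) f \<and> hvec (s' (Suc i)) (s (Suc i) ! k) v"
    proof
      fix k assume "k \<in> {..<length (s (Suc i))}"
      then have k: "k < length (s (Suc i))" by simp
      have "vmul (length (s i)) (D i k) f \<in> fvec V (s' i)"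
        using Pf fvecD[OF F.D_fvec[OF k]] by (intro fvec_vmul) (auto simp: P_def)
      moreover have "hvec (s' i) (s (Suc i) ! k) (vmul (length (s i)) (D i k) f)"
        using Pf F.D_hom[OF k] by (intro hvec_vmul) (auto simp: P_def)
      moreover have "G.cyc i (vmul (length (s i)) (D i k) f)" using Pf k by (simp add: P_def)
      ultimately show "\<exists>v. v \<in> fvec V (s' (Suc i)) \<and>
        vmul (length (s' (Suc i))) v (D' i) = vmul (length (s i)) (D i k) f \<and> hvec (s' (Suc i)) (s (Suc i) ! k) v"
        using G.cyc_lift_hom by blast
    qed
    from bchoice[OF this] obtain g where g: "\<And>k. k < length (s (Suc i)) \<Longrightarrow> g k \<in> fvec V (s' (Suc i)) \<and>
        vmul (length (s' (Suc i))) (g k) (D' i) = vmul (length (s i)) (D i k) f \<and> hvec (s' (Suc i)) (s (Suc i) ! k) (g k)"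
      by auto
    have "G.cyc (Suc i) (vmul (length (s (Suc i))) (D (Suc i) k) g)" if k: "k < length (s (Suc (Suc i)))" for k
    proof -
      have "vmul (length (s' (Suc i))) (vmul (length (s (Suc i))) (D (Suc i) k) g) (D' i)
          = vmul (length (s (Suc i))) (D (Suc i) k) (\<lambda>j. vmul (length (s i)) (D i j) f)"
        unfolding vmul_vmul using g by (intro vmul_cong) auto
      also have "\<dots> = vmul (length (s i)) (vmul (length (s (Suc i))) (D (Suc i) k) (D i)) f"
        by (simp only: vmul_vmul)
      also have "\<dots> = 0" using F.cyc_D[OF k] by (simp add: F.cyc_Suc vmul_0)
      finally show ?thesis by (simp add: G.cyc_Suc)
    qed
    then have "P (Suc i) g" using g by (simp add: P_def)
    moreover have "Q i f g" using g by (simp add: Q_def)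
    ultimately show ?thesis by blast
  qed
  obtain \<Phi> where \<Phi>: "\<And>i. P i (\<Phi> i)" "\<Phi> 0 = f0" "\<And>i. Q i (\<Phi> i) (\<Phi> (Suc i))"
    using dependent_nat_choice[of "\<lambda>i t. P i t \<and> (i = 0 \<longrightarrow> t = f0)" Q] P0 step
    by (metis nat.distinct(1))
  show ?thesis
    by (rule that[of \<Phi>]) (use \<Phi>(1,3) f0 in \<open>auto simp: P_def Q_def \<Phi>(2)\<close>)
qed

text \<open>A homotopy to the identity takes values in the multiples of the variables, by minimality.\<close>

lemma chain_endo_const:
  fixes D :: "nat \<Rightarrow> nat \<Rightarrow> nat \<Rightarrow> ('v, 'k::field) mpoly"
  assumes "matrix_res V I s D p"
    and \<Theta>: "\<And>i k. k < length (s i) \<Longrightarrow> \<Theta> i k \<in> fvec V (s i)"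
    and \<Theta>_0: "\<And>k. k < length (s 0) \<Longrightarrow> dotp (length (s 0)) (\<Theta> 0 k) p - p k \<in> I"
    and \<Theta>_comm: "\<And>i k. k < length (s (Suc i)) \<Longrightarrow>
      vmul (length (s (Suc i))) (\<Theta> (Suc i) k) (D i) = vmul (length (s i)) (D i k) (\<Theta> i)"
    and k: "k < length (s i)"
  shows "Poly_Mapping.lookup (\<Theta> i k l) 0 = (if l = k then 1 else 0)"
proof -
  interpret F: matrix_res V I s D p by fact
  \<comment> \<open>Here \<open>h\<close> is a homotopy built degree by degree: \<open>Q\<close>
    expresses in rows that \<open>\<Theta>\<close> minus the identity is the sum of the two
    composites of \<open>h\<close> with \<open>D\<close>, and \<open>P\<close> says that what
    remains to be filled is a cycle.\<close>
  define P where "P i h \<longleftrightarrow> (\<forall>k<length (s i). h k \<in> fvec V (s (Suc i))) \<and>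
    (\<forall>k<length (s (Suc i)). F.cyc (Suc i) (\<Theta> (Suc i) k - basis_vec k - vmul (length (s i)) (D i k) h))" for i h
  define Q where "Q i h g \<longleftrightarrow> (\<forall>k<length (s (Suc i)). vmul (length (s (Suc (Suc i)))) (g k) (D (Suc i)) =
      \<Theta> (Suc i) k - basis_vec k - vmul (length (s i)) (D i k) h)"
    for i h and g :: "nat \<Rightarrow> nat \<Rightarrow> ('v, 'k) mpoly"
  have "\<forall>k\<in>{..<length (s 0)}. \<exists>v. v \<in> fvec V (s (Suc 0)) \<and> vmul (length (s (Suc 0))) v (D 0) = \<Theta> 0 k - basis_vec k"
  proof
    fix k assume "k \<in> {..<length (s 0)}"
    then have k: "k < length (s 0)" by simp
    have "F.cyc 0 (\<Theta> 0 k - basis_vec k)" using \<Theta>_0[OF k] k by (simp add: F.cyc_0 dotp_diff dotp_basis)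
    then show "\<exists>v. v \<in> fvec V (s (Suc 0)) \<and> vmul (length (s (Suc 0))) v (D 0) = \<Theta> 0 k - basis_vec k"
      using F.cyc_lift[OF fvec_diff[OF \<Theta>[OF k] fvec_basis[OF k]]] by blast
  qed
  from bchoice[OF this] obtain h0 where h0: "\<And>k. k < length (s 0) \<Longrightarrow>
      h0 k \<in> fvec V (s (Suc 0)) \<and> vmul (length (s (Suc 0))) (h0 k) (D 0) = \<Theta> 0 k - basis_vec k" by auto
  have "F.cyc (Suc 0) (\<Theta> (Suc 0) k - basis_vec k - vmul (length (s 0)) (D 0 k) h0)" if k: "k < length (s (Suc 0))" for k
  proof -
    have "vmul (length (s (Suc 0))) (vmul (length (s 0)) (D 0 k) h0) (D 0) =
        vmul (length (s 0)) (D 0 k) (\<lambda>j. \<Theta> 0 j - basis_vec j)"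
      unfolding vmul_vmul using h0 by (intro vmul_cong) auto
    then show ?thesis
      unfolding F.cyc_Suc vmul_diff vmul_diff_right \<Theta>_comm[OF k] vmul_basis[OF k] vmul_basis_right[OF F.D_fvec[OF k]]
      by simp
  qed
  then have P0: "P 0 h0" using h0 by (simp add: P_def)
  have step: "\<exists>g. P (Suc i) g \<and> Q i h g" if Ph: "P i h" for i h
  proof -
    have "\<forall>k\<in>{..<length (s (Suc i))}. \<exists>v. v \<in> fvec V (s (Suc (Suc i))) \<and>
      vmul (length (s (Suc (Suc i)))) v (D (Suc i)) = \<Theta> (Suc i) k - basis_vec k - vmul (length (s i)) (D i k) h"
    proof
      fix k assume "k \<in> {..<length (s (Suc i))}"
      then have k: "k < length (s (Suc i))" by simp
      have "vmul (length (s i)) (D i k) h \<in> fvec V (s (Suc i))"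
        using Ph fvecD[OF F.D_fvec[OF k]] by (intro fvec_vmul) (auto simp: P_def)
      then have "\<Theta> (Suc i) k - basis_vec k - vmul (length (s i)) (D i k) h \<in> fvec V (s (Suc i))"
        by (intro fvec_diff \<Theta>[OF k] fvec_basis[OF k])
      then show "\<exists>v. v \<in> fvec V (s (Suc (Suc i))) \<and>
        vmul (length (s (Suc (Suc i)))) v (D (Suc i)) = \<Theta> (Suc i) k - basis_vec k - vmul (length (s i)) (D i k) h"
        using F.cyc_lift[of _ "Suc i"] Ph k unfolding P_def by blast
    qed
    from bchoice[OF this] obtain g where g: "\<And>k. k < length (s (Suc i)) \<Longrightarrow> g k \<in> fvec V (s (Suc (Suc i))) \<and>
      vmul (length (s (Suc (Suc i)))) (g k) (D (Suc i)) = \<Theta> (Suc i) k - basis_vec k - vmul (length (s i)) (D i k) h" by auto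
    have "F.cyc (Suc (Suc i)) (\<Theta> (Suc (Suc i)) k - basis_vec k - vmul (length (s (Suc i))) (D (Suc i) k) g)"
      if k: "k < length (s (Suc (Suc i)))" for k
    proof -
      have "vmul (length (s (Suc (Suc i)))) (vmul (length (s (Suc i))) (D (Suc i) k) g) (D (Suc i)) =
          vmul (length (s (Suc i))) (D (Suc i) k) (\<lambda>j. \<Theta> (Suc i) j - basis_vec j - vmul (length (s i)) (D i j) h)"
        unfolding vmul_vmul using g by (intro vmul_cong) auto
      moreover have "vmul (length (s (Suc i))) (D (Suc i) k) (\<lambda>j. vmul (length (s i)) (D i j) h) = 0"
        unfolding vmul_vmul[symmetric] using F.cyc_D[OF k] by (simp add: F.cyc_Suc vmul_0)
      ultimately show ?thesis
        unfolding F.cyc_Suc vmul_diff vmul_diff_right \<Theta>_comm[OF k] vmul_basis[OF k] vmul_basis_right[OF F.D_fvec[OF k]]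
        by simp
    qed
    then have "P (Suc i) g" using g by (simp add: P_def)
    moreover have "Q i h g" using g by (simp add: Q_def)
    ultimately show ?thesis by blast
  qed
  obtain h where h: "\<And>i. P i (h i)" "h 0 = h0" "\<And>i. Q i (h i) (h (Suc i))"
    using dependent_nat_choice[of "\<lambda>i t. P i t \<and> (i = 0 \<longrightarrow> t = h0)" Q] P0 step
    by (metis nat.distinct(1))
  \<comment> \<open>Each composite in the homotopy formula contains a factor \<open>D\<close>, whose
    entries have no constant terms.\<close>
  have const_D: "Poly_Mapping.lookup (vmul (length (s (Suc j))) u (D j) l) 0 = 0" for j u
    by (simp add: vmul_def lookup_sum lookup_mult_zero F.D_min)
  have "Poly_Mapping.lookup ((\<Theta> i k - basis_vec k) l) 0 = 0"
  proof (cases i)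
    case 0
    have "\<Theta> i k - basis_vec k = vmul (length (s (Suc 0))) (h0 k) (D 0)" using h0 k 0 by simp
    then show ?thesis by (simp only: const_D)
  next
    case (Suc j)
    have "vmul (length (s (Suc i))) (h i k) (D i) = \<Theta> i k - basis_vec k - vmul (length (s j)) (D j k) (h j)"
      using h(3)[of j] k Suc by (simp add: Q_def)
    then have "\<Theta> i k - basis_vec k = vmul (length (s (Suc i))) (h i k) (D i) + vmul (length (s j)) (D j k) (h j)"
      by (simp add: algebra_simps)
    moreover have "Poly_Mapping.lookup (vmul (length (s j)) (D j k) (h j) l) 0 = 0"
      using F.D_min[of k j] k Suc by (simp add: vmul_def lookup_sum lookup_mult_zero)
    ultimately show ?thesis by (simp only: plus_fun_apply lookup_add const_D add_0)
  qed
  then show ?thesis by (simp add: basis_vec_def lookup_minus split: if_splits)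
qed

text \<open>Read as matrices, \<open>A B = 1\<close>. The rows of \<open>A\<close>, cut down to
  \<open>T\<close>, are independent in the space of functions on \<open>T\<close>, since multiplying
  a relation by \<open>B\<close> returns its coefficients.\<close>

lemma card_le_of_left_inverse:
  fixes A :: "'a \<Rightarrow> 'b \<Rightarrow> 'k::field"
  assumes "finite S" "finite T"
    and AB: "\<And>k k'. k \<in> S \<Longrightarrow> k' \<in> S \<Longrightarrow> (\<Sum>l\<in>T. A k l * B l k') = (if k' = k then 1 else 0)"
  shows "card S \<le> card T"
proof -
  define row where "row k l = (if l \<in> T then A k l else 0)" for k l
  have rB: "(\<Sum>l\<in>T. row k l * B l k') = (if k' = k then 1 else 0)" if "k \<in> S" "k' \<in> S" for k k'
    using AB[OF that] by (simp add: row_def)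
  have inj: "inj_on row S"
    by (intro inj_onI) (metis rB zero_neq_one)
  have "fv.independent (row ` S)"
    unfolding fv.dependent_finite[OF finite_imageI[OF assms(1)]]
  proof clarsimp
    fix c k assume k: "k \<in> S" "c (row k) \<noteq> 0" and 0: "(\<Sum>v\<in>row ` S. fscale (c v) v) = 0"
    have "(\<Sum>k'\<in>S. c (row k') * row k' l) = 0" for l
      using fun_cong[OF 0, of l] by (simp add: sum.reindex[OF inj] sum_fun_apply fscale_def)
    then have "0 = (\<Sum>l\<in>T. (\<Sum>k'\<in>S. c (row k') * row k' l) * B l k)" by simp
    also have "\<dots> = (\<Sum>k'\<in>S. c (row k') * (\<Sum>l\<in>T. row k' l * B l k))"
      by (simp add: sum_distrib_right sum_distrib_left mult.assoc sum.swap[of _ T S])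
    also have "\<dots> = (\<Sum>k'\<in>S. if k' = k then c (row k') else 0)"
      using rB k(1) by (intro sum.cong) auto
    also have "\<dots> = c (row k)" using k(1) assms(1) by simp
    finally show False using k(2) by simp
  qed
  moreover have "row ` S \<subseteq> fv.span (unit_vec ` T)"
  proof
    fix v assume "v \<in> row ` S"
    \<comment> \<open>With all degrees empty, \<open>chains_in\<close> is just the space of
      functions supported on \<open>T\<close>.\<close>
    then have "v \<in> chains_in T (\<lambda>_. {}) ({} :: nat set)" by (auto simp: chains_in_def row_def split: if_splits)
    then show "v \<in> fv.span (unit_vec ` T)" by (rule chains_span[OF assms(2)])
  qed
  ultimately have "card (row ` S) \<le> card (unit_vec ` T :: ('b \<Rightarrow> 'k) set)"
    using fv.independent_span_bound[of "unit_vec ` T" "row ` S"] assms(2) by simp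
  then show ?thesis using card_image[OF inj] card_image_le[OF assms(2), of "unit_vec :: 'b \<Rightarrow> 'b \<Rightarrow> 'k"] by linarith
qed

lemma count_list_card: "count_list xs y = card {k. k < length xs \<and> xs ! k = y}"
  by (simp add: count_list_eq_length_filter length_filter_conv_card eq_commute)

text \<open>By \<open>chain_endo_const\<close> the constant terms of comparison maps in the two
  directions multiply to the identity. A map of degree 0 has no constant entries between different
  shifts, so the identity on the generators of shift \<open>j\<close> factors through the generators
  of shift \<open>j\<close> of the other resolution, and the rank bound applies.\<close>

lemma matrix_res_count_le:
  fixes D D' :: "nat \<Rightarrow> nat \<Rightarrow> nat \<Rightarrow> ('v, 'k::field) mpoly"
  assumes F: "matrix_res V I s D p" and G: "matrix_res V I s' D' p'"
  shows "count_list (s i) j \<le> count_list (s' i) j"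
proof -
  interpret F: matrix_res V I s D p by fact
  interpret G: matrix_res V I s' D' p' by fact
  obtain \<Phi> where \<Phi>: "\<And>i k. k < length (s i) \<Longrightarrow> \<Phi> i k \<in> fvec V (s' i)"
    "\<And>i k. k < length (s i) \<Longrightarrow> hvec (s' i) (s i ! k) (\<Phi> i k)"
    "\<And>k. k < length (s 0) \<Longrightarrow> dotp (length (s' 0)) (\<Phi> 0 k) p' - p k \<in> I"
    "\<And>i k. k < length (s (Suc i)) \<Longrightarrow>
      vmul (length (s' (Suc i))) (\<Phi> (Suc i) k) (D' i) = vmul (length (s i)) (D i k) (\<Phi> i)"
    by (rule matrix_chain_map[OF F G]) blast
  obtain \<Psi> where \<Psi>: "\<And>i k. k < length (s' i) \<Longrightarrow> \<Psi> i k \<in> fvec V (s i)"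
    "\<And>i k. k < length (s' i) \<Longrightarrow> hvec (s i) (s' i ! k) (\<Psi> i k)"
    "\<And>k. k < length (s' 0) \<Longrightarrow> dotp (length (s 0)) (\<Psi> 0 k) p - p' k \<in> I"
    "\<And>i k. k < length (s' (Suc i)) \<Longrightarrow>
      vmul (length (s (Suc i))) (\<Psi> (Suc i) k) (D i) = vmul (length (s' i)) (D' i k) (\<Psi> i)"
    by (rule matrix_chain_map[OF G F]) blast
  define \<Theta> where "\<Theta> i k = vmul (length (s' i)) (\<Phi> i k) (\<Psi> i)" for i k
  have \<Theta>: "Poly_Mapping.lookup (\<Theta> i k l) 0 = (if l = k then 1 else 0)" if k: "k < length (s i)" for k l
  proof (rule chain_endo_const[OF F _ _ _ k])
    show "\<Theta> i k \<in> fvec V (s i)" if "k < length (s i)" for i k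
      unfolding \<Theta>_def using fvecD[OF \<Phi>(1)[OF that]] \<Psi>(1) by (intro fvec_vmul) auto
    show "dotp (length (s 0)) (\<Theta> 0 k) p - p k \<in> I" if k: "k < length (s 0)" for k
    proof -
      have "dotp (length (s' 0)) (\<Phi> 0 k) (\<lambda>j. dotp (length (s 0)) (\<Psi> 0 j) p - p' j) \<in> I"
        using fvecD[OF \<Phi>(1)[OF k]] \<Psi>(3) by (intro F.I_dotp) auto
      from F.I_add[OF this \<Phi>(3)[OF k]] show ?thesis
        by (simp add: \<Theta>_def dotp_vmul dotp_diff_right)
    qed
    show "vmul (length (s (Suc i))) (\<Theta> (Suc i) k) (D i) = vmul (length (s i)) (D i k) (\<Theta> i)"
      if k: "k < length (s (Suc i))" for i k
    proof -
      have "vmul (length (s (Suc i))) (\<Theta> (Suc i) k) (D i) =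
          vmul (length (s' (Suc i))) (\<Phi> (Suc i) k) (\<lambda>j. vmul (length (s' i)) (D' i j) (\<Psi> i))"
        unfolding \<Theta>_def vmul_vmul using \<Psi>(4) by (intro vmul_cong) auto
      also have "\<dots> = vmul (length (s' i)) (vmul (length (s i)) (D i k) (\<Phi> i)) (\<Psi> i)"
        unfolding vmul_vmul[symmetric] \<Phi>(4)[OF k] ..
      finally show ?thesis unfolding vmul_vmul \<Theta>_def .
    qed
  qed
  define S where "S = {k. k < length (s i) \<and> s i ! k = j}"
  define T where "T = {k. k < length (s' i) \<and> s' i ! k = j}"
  have "card S \<le> card T"
  proof (rule card_le_of_left_inverse)
    show "finite S" "finite T" by (auto simp: S_def T_def)
    fix k k' assume k: "k \<in> S" "k' \<in> S"
    have off: "Poly_Mapping.lookup (\<Phi> i k l) 0 = 0" if "l < length (s' i)" "l \<notin> T" for l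
      using \<Phi>(2)[of k i] k that by (force simp: S_def T_def hvec_def homogeneous_def in_keys_iff)
    have "(\<Sum>l\<in>T. Poly_Mapping.lookup (\<Phi> i k l) 0 * Poly_Mapping.lookup (\<Psi> i l k') 0) =
        (\<Sum>l<length (s' i). Poly_Mapping.lookup (\<Phi> i k l) 0 * Poly_Mapping.lookup (\<Psi> i l k') 0)"
      using off by (intro sum.mono_neutral_left) (auto simp: T_def)
    also have "\<dots> = Poly_Mapping.lookup (\<Theta> i k k') 0"
      by (simp add: \<Theta>_def vmul_def lookup_sum lookup_mult_zero)
    finally show "(\<Sum>l\<in>T. Poly_Mapping.lookup (\<Phi> i k l) 0 * Poly_Mapping.lookup (\<Psi> i l k') 0) = (if k' = k then 1 else 0)"
      using \<Theta>[of k k'] k by (simp add: S_def)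
  qed
  then show ?thesis by (simp add: count_list_card S_def T_def)
qed


section \<open>From square-free resolutions to matrices over the polynomial ring\<close>

text \<open>The exponent vector of the square-free monomial with support \<open>A\<close>.\<close>

definition chi :: "'v set \<Rightarrow> 'v \<Rightarrow>\<^sub>0 nat" where
  "chi A = (\<Sum>x\<in>A. Poly_Mapping.single x 1)"

lemma lookup_chi: "finite A \<Longrightarrow> Poly_Mapping.lookup (chi A) x = of_bool (x \<in> A)"
  by (simp add: chi_def lookup_sum lookup_single when_def)

lemma keys_chi: "finite A \<Longrightarrow> Poly_Mapping.keys (chi A) = A"
  by (auto simp: in_keys_iff lookup_chi)

lemma keys_add_nat: "Poly_Mapping.keys (a + b) = Poly_Mapping.keys a \<union> Poly_Mapping.keys b"
  for a b :: "'v \<Rightarrow>\<^sub>0 nat"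
  by (auto simp: in_keys_iff lookup_add)

lemma chi_add_minus: "finite A \<Longrightarrow> A \<subseteq> Poly_Mapping.keys m \<Longrightarrow> m - chi A + chi A = m"
  by (rule poly_mapping_eqI) (auto simp: lookup_add lookup_minus lookup_chi in_keys_iff subset_iff)

lemma chi_dvd_iff: "finite A \<Longrightarrow> (\<exists>m'. m = m' + chi A) \<longleftrightarrow> A \<subseteq> Poly_Mapping.keys m"
  by (metis chi_add_minus keys_add_nat keys_chi sup.cobounded2)

lemma chi_split: "finite B \<Longrightarrow> A \<subseteq> B \<Longrightarrow> chi B = chi A + chi (B - A)"
  unfolding chi_def by (metis add.commute sum.subset_diff)

lemma mono_deg_chi: "finite A \<Longrightarrow> mono_deg (chi A) = int (card A)"
  by (simp add: mono_deg_def keys_chi lookup_chi)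

lemma prod_mpoly_var: "(\<Prod>x\<in>A. mpoly_var x) = Poly_Mapping.single (chi A) 1"
  by (induction A rule: infinite_finite_induct) (auto simp: chi_def mpoly_var_def mult_single)

lemma poly_sum_single: "p = (\<Sum>m\<in>Poly_Mapping.keys p. Poly_Mapping.single m (Poly_Mapping.lookup p m))"
  by (rule poly_mapping_eqI) (auto simp: lookup_sum lookup_single when_def in_keys_iff)

text \<open>A square-free monomial ideal contains a monomial exactly when it contains the product of
  the variables in its support, so the family \<open>U\<close> of supports determines it.\<close>

definition mono_ideal :: "'v set \<Rightarrow> 'v set set \<Rightarrow> ('v, 'k::field) mpoly set" where
  "mono_ideal V U = {p \<in> polys V. \<forall>m\<in>Poly_Mapping.keys p. Poly_Mapping.keys m \<in> U}"

lemma hom_ideal_mono_ideal: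
  assumes up: "\<And>W W'. W \<in> U \<Longrightarrow> W \<subseteq> W' \<Longrightarrow> W' \<subseteq> V \<Longrightarrow> W' \<in> U"
  shows "hom_ideal V (mono_ideal V U :: ('v, 'k::field) mpoly set)"
proof
  fix x y q :: "('v, 'k) mpoly" and e
  show "mono_ideal V U \<subseteq> polys V" by (auto simp: mono_ideal_def)
  show "0 \<in> mono_ideal V U" by (simp add: mono_ideal_def polys_0)
  show "x + y \<in> mono_ideal V U" if "x \<in> mono_ideal V U" "y \<in> mono_ideal V U"
    using that Poly_Mapping.keys_add[of x y] by (auto simp: mono_ideal_def intro: polys_add)
  show "q * x \<in> mono_ideal V U" if x: "x \<in> mono_ideal V U" and q: "q \<in> polys V"
  proof -
    have qx: "q * x \<in> polys V" using x q by (auto simp: mono_ideal_def intro: polys_mult)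
    have "Poly_Mapping.keys m \<in> U" if m: "m \<in> Poly_Mapping.keys (q * x)" for m
    proof -
      obtain a b where ab: "b \<in> Poly_Mapping.keys x" "m = a + b"
        using m Poly_Mapping.keys_mult[of q x] by blast
      have "Poly_Mapping.keys m \<subseteq> V" using qx m by (auto simp: polys_def)
      moreover have "Poly_Mapping.keys b \<in> U" using x ab by (auto simp: mono_ideal_def)
      ultimately show ?thesis using up ab(2) by (simp add: keys_add_nat)
    qed
    then show ?thesis using qx by (simp add: mono_ideal_def)
  qed
  show "hcomp e x \<in> mono_ideal V U" if "x \<in> mono_ideal V U"
    using that by (auto simp: mono_ideal_def keys_hcomp intro: hcomp_polys)
qed

lemma mpoly_ring_simps:
  "x \<oplus>\<^bsub>mpoly_ring V\<^esub> y = x + y" "x \<otimes>\<^bsub>mpoly_ring V\<^esub> y = x * y" "\<zero>\<^bsub>mpoly_ring V\<^esub> = 0" "\<one>\<^bsub>mpoly_ring V\<^esub> = 1"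
  by (simp_all add: mpoly_ring_def)

lemma cring_mpoly_ring: "cring (mpoly_ring V)"
proof (intro cringI abelian_groupI comm_monoidI)
  fix x :: "('a, 'b) mpoly" assume "x \<in> polys V"
  then show "\<exists>y\<in>polys V. y \<oplus>\<^bsub>mpoly_ring V\<^esub> x = \<zero>\<^bsub>mpoly_ring V\<^esub>"
    by (intro bexI[of _ "- x"]) (simp_all add: mpoly_ring_simps polys_uminus)
qed (auto simp: mpoly_ring_simps algebra_simps intro: polys_intros)

lemma ideal_mpoly_ring:
  fixes I :: "('v, 'k::field) mpoly set"
  assumes "hom_ideal V I"
  shows "ideal I (mpoly_ring V)"
proof -
  interpret cring "mpoly_ring V :: ('v, 'k) mpoly ring" by (rule cring_mpoly_ring)
  interpret hom_ideal V I by fact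
  have neg: "\<ominus>\<^bsub>mpoly_ring V\<^esub> x = - x" if "x \<in> polys V" for x :: "('v, 'k) mpoly"
    by (rule minus_equality) (use that in \<open>auto simp: mpoly_ring_simps polys_uminus\<close>)
  show ?thesis
  proof (rule idealI)
    show "subgroup I (add_monoid (mpoly_ring V))"
    proof (rule add.subgroupI)
      show "\<ominus>\<^bsub>mpoly_ring V\<^esub> x \<in> I" if "x \<in> I" for x
        using that I_polys neg[of x] I_uminus[of x] by auto
    qed (use I_polys I_0 I_add in \<open>auto simp: mpoly_ring_simps\<close>)
  qed (use I_mult ring_axioms in \<open>auto simp: mpoly_ring_simps mult.commute\<close>)
qed

text \<open>A monomial whose support contains \<open>A\<close> is a multiple of the product over
  \<open>A\<close>, so each term of a polynomial on the right lies in the generated ideal.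
  Conversely the right-hand side is an ideal containing the generators.\<close>

lemma genideal_monomials:
  assumes "\<And>A. A \<in> \<G> \<Longrightarrow> A \<subseteq> V \<and> finite A"
  shows "Idl\<^bsub>mpoly_ring V\<^esub> ((\<lambda>A. \<Prod>x\<in>A. mpoly_var x) ` \<G>) = (mono_ideal V {W. \<exists>A\<in>\<G>. A \<subseteq> W} :: ('v, 'k::field) mpoly set)"
    (is "Idl\<^bsub>_\<^esub> ?S = ?M")
proof
  interpret cring "mpoly_ring V :: ('v, 'k) mpoly ring" by (rule cring_mpoly_ring)
  have S: "?S \<subseteq> polys V"
    by (auto simp: prod_mpoly_var keys_chi intro!: polys_single dest!: assms)
  have "ideal ?M (mpoly_ring V)"
    by (rule ideal_mpoly_ring, rule hom_ideal_mono_ideal) blast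
  moreover have "?S \<subseteq> ?M"
    using S assms by (auto simp: mono_ideal_def prod_mpoly_var keys_chi)
  ultimately show "Idl\<^bsub>mpoly_ring V\<^esub> ?S \<subseteq> ?M" by (rule genideal_minimal)
  interpret I: ideal "Idl\<^bsub>mpoly_ring V\<^esub> ?S" "mpoly_ring V" by (rule genideal_ideal[OF S])
  have closed: "sum f T \<in> Idl\<^bsub>mpoly_ring V\<^esub> ?S" if "\<And>x. x \<in> T \<Longrightarrow> f x \<in> Idl\<^bsub>mpoly_ring V\<^esub> ?S"
    for f :: "('v \<Rightarrow>\<^sub>0 nat) \<Rightarrow> ('v, 'k) mpoly" and T
    using that
  proof (induction T rule: infinite_finite_induct)
    case (insert x T)
    then show ?case using I.a_closed[of "f x" "sum f T"] by (simp add: mpoly_ring_simps)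
  qed (use I.zero_closed in \<open>simp_all add: mpoly_ring_simps\<close>)
  show "?M \<subseteq> Idl\<^bsub>mpoly_ring V\<^esub> ?S"
  proof
    fix p :: "('v, 'k) mpoly" assume p: "p \<in> ?M"
    have "Poly_Mapping.single m (Poly_Mapping.lookup p m) \<in> Idl\<^bsub>mpoly_ring V\<^esub> ?S" if m: "m \<in> Poly_Mapping.keys p" for m
    proof -
      obtain A where A: "A \<in> \<G>" "A \<subseteq> Poly_Mapping.keys m" using p m by (auto simp: mono_ideal_def)
      have mV: "Poly_Mapping.keys m \<subseteq> V" using p m by (auto simp: mono_ideal_def polys_def)
      have eq: "m - chi A + chi A = m" using A assms by (simp add: chi_add_minus)
      then have "Poly_Mapping.keys (m - chi A) \<subseteq> V"
        using mV keys_add_nat[of "m - chi A" "chi A"] by auto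
      then have "Poly_Mapping.single (m - chi A) (Poly_Mapping.lookup p m) \<otimes>\<^bsub>mpoly_ring V\<^esub> (\<Prod>x\<in>A. mpoly_var x)
          \<in> Idl\<^bsub>mpoly_ring V\<^esub> ?S"
        using A(1) genideal_self[OF S] by (intro I.I_l_closed polys_single) auto
      then show ?thesis by (simp add: mpoly_ring_simps prod_mpoly_var mult_single eq)
    qed
    then have "(\<Sum>m\<in>Poly_Mapping.keys p. Poly_Mapping.single m (Poly_Mapping.lookup p m)) \<in> Idl\<^bsub>mpoly_ring V\<^esub> ?S"
      by (rule closed)
    then show "p \<in> Idl\<^bsub>mpoly_ring V\<^esub> ?S" using poly_sum_single[of p] by simp
  qed
qed

text \<open>Multiplication by the monomial of \<open>B - A\<close> carries the coordinate
  \<open>m - chi B\<close> at a generator of degree \<open>B\<close> to the coordinate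
  \<open>m - chi A\<close> at one of degree \<open>A\<close>. In multidegree \<open>m\<close> such a
  matrix entry is therefore just the scalar \<open>r\<close>.\<close>

lemma lookup_mult_chi:
  fixes p :: "('v, 'k::field) mpoly"
  assumes "finite B" "A \<subseteq> B" "A \<subseteq> Poly_Mapping.keys m"
  shows "Poly_Mapping.lookup (p * Poly_Mapping.single (chi (B - A)) r) (m - chi A) =
    (if B \<subseteq> Poly_Mapping.keys m then Poly_Mapping.lookup p (m - chi B) * r else 0)"
proof -
  have A: "finite A" using assms finite_subset by blast
  have B: "chi B = chi A + chi (B - A)" by (rule chi_split[OF assms(1,2)])
  have "(\<exists>m'. m - chi A = m' + chi (B - A)) \<longleftrightarrow> (\<exists>m'. m = m' + chi B)"
  proof
    assume "\<exists>m'. m - chi A = m' + chi (B - A)"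
    then obtain m' where "m - chi A = m' + chi (B - A)" by blast
    then have "m = m' + chi (B - A) + chi A" using chi_add_minus[OF A assms(3)] by simp
    then show "\<exists>m'. m = m' + chi B" unfolding B by (auto simp: ac_simps)
  next
    assume "\<exists>m'. m = m' + chi B"
    then obtain m' where "m = m' + chi (B - A) + chi A" unfolding B by (auto simp: ac_simps)
    then show "\<exists>m'. m - chi A = m' + chi (B - A)" by auto
  qed
  also have "\<dots> \<longleftrightarrow> B \<subseteq> Poly_Mapping.keys m" by (rule chi_dvd_iff[OF assms(1)])
  finally show ?thesis
    unfolding lookup_mult_single B diff_diff_add by simp
qed

text \<open>In multidegree \<open>m\<close> the free modules become \<open>chains_in\<close> of the
  support of \<open>m\<close>, so exactness over the ring splits into the exactness that
  \<open>sqfree_res\<close> provides for each support. A vector involves only finitely many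
  multidegrees, so preimages found separately can be assembled. Properness of the ideal excludes
  units from the first matrix.\<close>

lemma sqfree_res_matrix_res:
  fixes c :: "nat \<Rightarrow> nat \<Rightarrow> nat \<Rightarrow> 'k::field"
  assumes res: "sqfree_res V U X a c 0" and X: "\<And>i. X i = {..<n i}"
    and up: "\<And>W W'. W \<in> U \<Longrightarrow> W \<subseteq> W' \<Longrightarrow> W' \<subseteq> V \<Longrightarrow> W' \<in> U" and proper: "{} \<notin> U"
  shows "matrix_res V (mono_ideal V U) (\<lambda>i. map (\<lambda>k. int (card (a i k))) [0..<n i])
    (\<lambda>i k l. Poly_Mapping.single (chi (a (Suc i) k - a i l)) (c i k l)) (\<lambda>_. 1)"
proof -
  interpret F: sqfree_res V U X a c 0 by fact
  interpret hom_ideal V "mono_ideal V U :: ('a, 'k) mpoly set" by (rule hom_ideal_mono_ideal[OF up])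
  define s where "s i = map (\<lambda>k. int (card (a i k))) [0..<n i]" for i
  define D where "D i k l = (Poly_Mapping.single (chi (a (Suc i) k - a i l)) (c i k l) :: ('a, 'k) mpoly)" for i k l
  have len: "length (s i) = n i" for i by (simp add: s_def)
  have s_nth: "s i ! k = int (card (a i k))" if "k < n i" for i k using that by (simp add: s_def)
  have n0: "n 0 = 1" using F.X_0 X[of 0] by (metis card.empty card_insert_if card_lessThan empty_iff finite.emptyI One_nat_def)
  have fin: "finite (a i k)" if "k < n i" for i k
    using F.a_sub[of k i] F.fin_V finite_subset that X by blast
  have c_supp: "k < n (Suc i)" "l < n i" "a i l \<subseteq> a (Suc i) k" if "c i k l \<noteq> 0" for i k l
    using F.c_supp[OF that] X by auto
  \<comment> \<open>To the first map \<open>c_min\<close> does not apply; there the generators have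
    nonempty degree because \<open>{} \<notin> U\<close>.\<close>
  have c_ne: "a i l \<noteq> a (Suc i) k" if nz: "c i k l \<noteq> 0" for i k l
  proof (cases i)
    case 0
    have "1 \<le> card W" if "W \<subseteq> V" "W \<in> U" for W
      using that proper F.fin_V finite_subset[of W V] by (cases "W = {}") (auto simp: Suc_le_eq card_gt_0_iff)
    then have "card (a (Suc 0) k) \<ge> 1"
      using F.card_a_ge[of 1 k 0] F.c_supp[OF nz] 0 by simp
    moreover have "a i l = {}" using c_supp(2)[OF nz] n0 F.a_0 0 by simp
    ultimately show ?thesis using 0 by auto
  next
    case (Suc j)
    then show ?thesis using F.c_min nz by blast
  qed
  \<comment> \<open>The multidegree \<open>m\<close> component of \<open>u\<close>; on it, the matrix \<open>D i\<close> acts as the scalar matrix \<open>c i\<close>.\<close>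
  define comp where "comp i u m l = (if l < n i \<and> a i l \<subseteq> Poly_Mapping.keys m
      then Poly_Mapping.lookup (u l) (m - chi (a i l)) else 0)" for i and u :: "nat \<Rightarrow> ('a, 'k) mpoly" and m l
  have comp_chain: "comp i u m \<in> chains_in (X i) (a i) (Poly_Mapping.keys m)" for i u m
    by (auto simp: chains_in_def comp_def X)
  have comp_vmul: "comp i (vmul (n (Suc i)) v (D i)) m = bnd (X (Suc i)) (c i) (comp (Suc i) v m)" for i v m
  proof
    fix l
    show "comp i (vmul (n (Suc i)) v (D i)) m l = bnd (X (Suc i)) (c i) (comp (Suc i) v m) l"
    proof (cases "l < n i \<and> a i l \<subseteq> Poly_Mapping.keys m")
      case True
      have "Poly_Mapping.lookup (v k * D i k l) (m - chi (a i l)) = comp (Suc i) v m k * c i k l" if "k < n (Suc i)" for k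
      proof (cases "c i k l = 0")
        case False
        show ?thesis
          using lookup_mult_chi[OF fin[OF that] c_supp(3)[OF False], of m "v k" "c i k l"] True that
          by (simp add: D_def comp_def)
      qed (simp add: D_def)
      then show ?thesis using True by (simp add: comp_def vmul_def lookup_sum bnd_def X)
    next
      case False
      have "comp (Suc i) v m k * c i k l = 0" for k
        using False c_supp[of i k l] by (auto simp: comp_def)
      then have "bnd (X (Suc i)) (c i) (comp (Suc i) v m) l = 0" unfolding bnd_def by (intro sum.neutral) blast
      moreover have "comp i (vmul (n (Suc i)) v (D i)) m l = 0" unfolding comp_def using False by (rule if_not_P)
      ultimately show ?thesis by simp
    qed
  qed
  have comp_inj: "u = w" if u: "u \<in> fvec V (s i)" and w: "w \<in> fvec V (s i)"
    and eq: "\<And>m. Poly_Mapping.keys m \<subseteq> V \<Longrightarrow> comp i u m = comp i w m" for i u w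
  proof
    fix l
    show "u l = w l"
    proof (cases "l < n i")
      case True
      show ?thesis
      proof (rule poly_mapping_eqI)
        fix m
        show "Poly_Mapping.lookup (u l) m = Poly_Mapping.lookup (w l) m"
        proof (cases "Poly_Mapping.keys m \<subseteq> V")
          case mV: True
          \<comment> \<open>The multidegree in which the coefficient of \<open>u l\<close> at
            \<open>m\<close> becomes visible.\<close>
          let ?m = "m + chi (a i l)"
          have keys: "Poly_Mapping.keys ?m = Poly_Mapping.keys m \<union> a i l"
            by (simp add: keys_add_nat keys_chi fin[OF True])
          then have "comp i u ?m l = comp i w ?m l"
            using eq[of ?m] mV F.a_sub[of l i] True X by auto
          then show ?thesis using keys True by (simp add: comp_def)
        next
          case False
          then have "m \<notin> Poly_Mapping.keys (u l)" "m \<notin> Poly_Mapping.keys (w l)"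
            using fvecD[OF u, of l] fvecD[OF w, of l] True len by (auto simp: polys_def)
          then show ?thesis by (simp add: in_keys_iff)
        qed
      qed
    next
      case False
      then show ?thesis using u w len by (simp add: fvec_def)
    qed
  qed
  have comp_surj: "\<exists>v\<in>fvec V (s i). \<forall>m. comp i v m = (if m \<in> M then w m else 0)"
    if M: "finite M" "\<And>m. m \<in> M \<Longrightarrow> Poly_Mapping.keys m \<subseteq> V"
      and w: "\<And>m. m \<in> M \<Longrightarrow> w m \<in> chains_in (X i) (a i) (Poly_Mapping.keys m)" for M w i
  proof -
    \<comment> \<open>Coordinate \<open>k\<close> collects, for each admissible \<open>m\<close>,
      the monomial that raises the degree of generator \<open>k\<close> to \<open>m\<close>.\<close>
    define v where "v k = (if k < n i then \<Sum>m\<in>{m\<in>M. a i k \<subseteq> Poly_Mapping.keys m}.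
        Poly_Mapping.single (m - chi (a i k)) (w m k) else 0)" for k
    have "v k \<in> polys V" if k: "k < n i" for k
    proof -
      have "Poly_Mapping.keys (m - chi (a i k)) \<subseteq> V" if "m \<in> M" "a i k \<subseteq> Poly_Mapping.keys m" for m
        using M(2)[OF that(1)] keys_add_nat[of "m - chi (a i k)" "chi (a i k)"] chi_add_minus[OF fin[OF k] that(2)] by auto
      then show ?thesis using k unfolding v_def by (auto intro!: polys_sum polys_single)
    qed
    then have v: "v \<in> fvec V (s i)" by (simp add: fvec_def len) (simp add: v_def)
    have "comp i v m l = (if m \<in> M then w m else 0) l" for m l
    proof (cases "l < n i \<and> a i l \<subseteq> Poly_Mapping.keys m")
      case True
      have inj: "m' - chi (a i l) = m - chi (a i l) \<longleftrightarrow> m' = m" if "a i l \<subseteq> Poly_Mapping.keys m'" for m'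
        using chi_add_minus[of "a i l"] fin[of l i] True that by metis
      have "comp i v m l = (\<Sum>m'\<in>{m'\<in>M. a i l \<subseteq> Poly_Mapping.keys m'}. (w m' l when m' = m))"
        using True by (auto simp: comp_def v_def lookup_sum lookup_single inj intro!: sum.cong)
      also have "\<dots> = (if m \<in> M then w m l else 0)"
        using M(1) True by (auto simp: when_def)
      finally show ?thesis by simp
    next
      case False
      have "w m l = 0" if "m \<in> M" using chains_inD[OF w[OF that], of l] False X by auto
      then show ?thesis using False by (auto simp: comp_def)
    qed
    then have "comp i v m = (if m \<in> M then w m else 0)" for m by (rule ext)
    then show ?thesis using v by blast
  qed
  have comp_fin: "finite {m. comp i u m \<noteq> 0}" for i u
  proof (rule finite_subset)
    show "{m. comp i u m \<noteq> 0} \<subseteq> (\<Union>l\<in>{..<n i}. (\<lambda>m. m + chi (a i l)) ` Poly_Mapping.keys (u l))"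
    proof
      fix m assume "m \<in> {m. comp i u m \<noteq> 0}"
      then obtain l where l: "l < n i" "a i l \<subseteq> Poly_Mapping.keys m" "Poly_Mapping.lookup (u l) (m - chi (a i l)) \<noteq> 0"
        by (auto simp: fun_eq_iff comp_def split: if_splits)
      then show "m \<in> (\<Union>l\<in>{..<n i}. (\<lambda>m. m + chi (a i l)) ` Poly_Mapping.keys (u l))"
        using chi_add_minus[OF fin[OF l(1)] l(2)] by (intro UN_I[of l] image_eqI[of _ _ "m - chi (a i l)"]) (auto simp: in_keys_iff)
    qed
  qed auto
  have comp_V: "Poly_Mapping.keys m \<subseteq> V" if nzc: "comp i u m \<noteq> 0" and uf: "u \<in> fvec V (s i)" for i u m
  proof -
    obtain l where l: "l < n i" "a i l \<subseteq> Poly_Mapping.keys m" "Poly_Mapping.lookup (u l) (m - chi (a i l)) \<noteq> 0"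
      using nzc by (auto simp: fun_eq_iff comp_def split: if_splits)
    have "Poly_Mapping.keys (m - chi (a i l)) \<subseteq> V"
      using fvecD[OF uf, of l] l len by (auto simp: polys_def in_keys_iff)
    then show ?thesis
      using keys_add_nat[of "m - chi (a i l)" "chi (a i l)"] chi_add_minus[OF fin[OF l(1)] l(2)]
        F.a_sub[of l i] l(1) X keys_chi[OF fin[OF l(1)]] by auto
  qed
  have D_fvec: "D i k \<in> fvec V (s i)" if "k < n (Suc i)" for i k
  proof -
    have "D i k l \<in> polys V" for l
      using F.a_sub[of k "Suc i"] that X fin[OF that] unfolding D_def by (intro polys_single) (auto simp: keys_chi)
    moreover have "D i k l = 0" if "n i \<le> l" for l
      using c_supp(2)[of i k l] that by (cases "c i k l = 0") (auto simp: D_def)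
    ultimately show ?thesis by (simp add: fvec_def len)
  qed
  have lift: "\<exists>v\<in>fvec V (s (Suc i)). vmul (n (Suc i)) v (D i) = u"
    if u: "u \<in> fvec V (s i)" and ex: "\<And>m. comp i u m \<noteq> 0 \<Longrightarrow>
      \<exists>v\<in>chains_in (X (Suc i)) (a (Suc i)) (Poly_Mapping.keys m). bnd (X (Suc i)) (c i) v = comp i u m" for i u
  proof -
    let ?M = "{m. comp i u m \<noteq> 0}"
    have "\<forall>m\<in>?M. \<exists>v. v \<in> chains_in (X (Suc i)) (a (Suc i)) (Poly_Mapping.keys m) \<and> bnd (X (Suc i)) (c i) v = comp i u m"
      using ex by blast
    from bchoice[OF this] obtain w where w: "\<And>m. m \<in> ?M \<Longrightarrow>
        w m \<in> chains_in (X (Suc i)) (a (Suc i)) (Poly_Mapping.keys m) \<and> bnd (X (Suc i)) (c i) (w m) = comp i u m"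
      by blast
    obtain v where v: "v \<in> fvec V (s (Suc i))" "\<And>m. comp (Suc i) v m = (if m \<in> ?M then w m else 0)"
      using comp_surj[of ?M w "Suc i"] comp_fin comp_V[OF _ u] w by blast
    have "vmul (n (Suc i)) v (D i) = u"
    proof (rule comp_inj[OF _ u])
      show "vmul (n (Suc i)) v (D i) \<in> fvec V (s i)"
        using fvecD[OF v(1)] D_fvec len by (intro fvec_vmul) auto
      show "comp i (vmul (n (Suc i)) v (D i)) m = comp i u m" for m
        unfolding comp_vmul v(2) using w[of m] by auto
    qed
    then show ?thesis using v(1) by blast
  qed
  have "matrix_res V (mono_ideal V U) s D (\<lambda>_. 1)"
  proof
    fix k i l assume "k < length (s (Suc i))"
    then have k: "k < n (Suc i)" by (simp add: len)
    show "D i k \<in> fvec V (s i)" by (rule D_fvec[OF k])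
    show "hvec (s i) (s (Suc i) ! k) (D i k)"
      unfolding hvec_def len
    proof (intro allI impI)
      fix l assume l: "l < n i"
      show "homogeneous (s (Suc i) ! k - s i ! l) (D i k l)"
      proof (cases "c i k l = 0")
        case False
        have "mono_deg (chi (a (Suc i) k - a i l)) = int (card (a (Suc i) k)) - int (card (a i l))"
          using c_supp(3)[OF False] fin[OF k] fin[OF l]
          by (simp add: mono_deg_chi card_Diff_subset of_nat_diff card_mono)
        then show ?thesis by (simp add: homogeneous_def D_def s_nth[OF k] s_nth[OF l])
      qed (simp add: D_def)
    qed
    show "Poly_Mapping.lookup (D i k l) 0 = 0"
    proof (cases "c i k l = 0")
      case False
      then have "Poly_Mapping.keys (chi (a (Suc i) k - a i l)) \<noteq> {}"
        using c_supp(3)[OF False] c_ne[OF False] fin[OF k] by (simp add: keys_chi)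
      then show ?thesis by (auto simp: D_def lookup_single when_def)
    qed (simp add: D_def)
  next
    fix k assume k: "k < length (s 0)"
    show "1 \<in> polys V" by (rule polys_1)
    show "homogeneous (s 0 ! k) 1"
      using k n0 len F.a_0 s_nth[of 0 0] by (simp add: homogeneous_def)
  next
    fix q :: "('a, 'k) mpoly" assume "q \<in> polys V"
    then show "\<exists>u\<in>fvec V (s 0). dotp (length (s 0)) u (\<lambda>_. 1) - q \<in> mono_ideal V U"
      by (intro bexI[of _ "\<lambda>k. if k = 0 then q else 0"]) (auto simp: fvec_def len n0 dotp_def I_0)
  next
    fix u :: "nat \<Rightarrow> ('a, 'k) mpoly" assume u: "u \<in> fvec V (s 0)"
    have comp0: "comp 0 u m = fscale (Poly_Mapping.lookup (u 0) m) (unit_vec 0)" for m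
      by (auto simp: comp_def fun_eq_iff n0 F.a_0 fscale_def unit_vec_def chi_def)
    have u0: "u 0 \<in> polys V" using fvecD[OF u, of 0] by (simp add: len n0)
    have dot: "dotp (length (s 0)) u (\<lambda>_. 1) = u 0" by (simp add: dotp_def len n0)
    have nz: "comp 0 u m \<noteq> 0 \<longleftrightarrow> m \<in> Poly_Mapping.keys (u 0)" for m
      by (auto simp: comp0 in_keys_iff fscale_def unit_vec_def fun_eq_iff)
    show "dotp (length (s 0)) u (\<lambda>_. 1) \<in> mono_ideal V U \<longleftrightarrow>
      (\<exists>v\<in>fvec V (s (Suc 0)). vmul (length (s (Suc 0))) v (D 0) = u)"
      unfolding len dot[unfolded len]
    proof
      assume uI: "u 0 \<in> mono_ideal V U"
      have "\<exists>v\<in>chains_in (X (Suc 0)) (a (Suc 0)) (Poly_Mapping.keys m). bnd (X (Suc 0)) (c 0) v = comp 0 u m"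
        if "comp 0 u m \<noteq> 0" for m
      proof -
        from that have m: "m \<in> Poly_Mapping.keys (u 0)" by (simp only: nz not_False_eq_True)
        then have "Poly_Mapping.keys m \<in> U" "Poly_Mapping.keys m \<subseteq> V"
          using uI by (auto simp: mono_ideal_def polys_def)
        then obtain v where v: "v \<in> chains_in (X (Suc 0)) (a (Suc 0)) (Poly_Mapping.keys m)" "bnd (X (Suc 0)) (c 0) v \<noteq> 0"
          using F.aug by blast
        \<comment> \<open>Chains in homological degree 0 are multiples of \<open>unit_vec 0\<close>,
          so a nonzero boundary can be rescaled to the prescribed coefficient.\<close>
        define t where "t = bnd (X (Suc 0)) (c 0) v 0"
        have bt: "bnd (X (Suc 0)) (c 0) v = fscale t (unit_vec 0)"
          using chains_inD[OF F.bnd_c_chains[OF v(1)]] F.X_0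
          by (fastforce simp: fun_eq_iff fscale_def unit_vec_def t_def)
        then have "t \<noteq> 0" using v(2) by (auto simp: fscale_def fun_eq_iff)
        then have "bnd (X (Suc 0)) (c 0) (fscale (Poly_Mapping.lookup (u 0) m / t) v) = comp 0 u m"
          unfolding bnd_fscale bt comp0 by (simp add: fscale_def)
        then show ?thesis
          using fv.subspace_scale[OF subspace_chains v(1)] by blast
      qed
      then show "\<exists>v\<in>fvec V (s (Suc 0)). vmul (n (Suc 0)) v (D 0) = u"
        by (rule lift[OF u])
    next
      assume "\<exists>v\<in>fvec V (s (Suc 0)). vmul (n (Suc 0)) v (D 0) = u"
      then obtain v where v: "vmul (n (Suc 0)) v (D 0) = u" by blast
      have "Poly_Mapping.keys m \<in> U" if m: "m \<in> Poly_Mapping.keys (u 0)" for m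
      proof -
        have "bnd (X (Suc 0)) (c 0) (comp (Suc 0) v m) \<noteq> 0"
          using m nz[of m] unfolding v[symmetric] comp_vmul by blast
        moreover have "Poly_Mapping.keys m \<subseteq> V" using u0 m by (auto simp: polys_def)
        ultimately show ?thesis using F.aug comp_chain by blast
      qed
      then show "u 0 \<in> mono_ideal V U" using u0 by (simp add: mono_ideal_def)
    qed
  next
    fix u :: "nat \<Rightarrow> ('a, 'k) mpoly" and i assume u: "u \<in> fvec V (s (Suc i))"
    have c0: "comp i 0 m = 0" for i m by (simp add: comp_def fun_eq_iff)
    show "vmul (length (s (Suc i))) u (D i) = 0 \<longleftrightarrow>
      (\<exists>v\<in>fvec V (s (Suc (Suc i))). vmul (length (s (Suc (Suc i)))) v (D (Suc i)) = u)"
      unfolding len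
    proof
      assume 0: "vmul (n (Suc i)) u (D i) = 0"
      show "\<exists>v\<in>fvec V (s (Suc (Suc i))). vmul (n (Suc (Suc i))) v (D (Suc i)) = u"
      proof (rule lift[OF u])
        fix m assume m: "comp (Suc i) u m \<noteq> 0"
        have "bnd (X (Suc i)) (c i) (comp (Suc i) u m) = 0" using comp_vmul[of i u m] by (simp only: 0 c0)
        then show "\<exists>v\<in>chains_in (X (Suc (Suc i))) (a (Suc (Suc i))) (Poly_Mapping.keys m).
            bnd (X (Suc (Suc i))) (c (Suc i)) v = comp (Suc i) u m"
          by (rule F.exact[OF comp_V[OF m u] comp_chain])
      qed
    next
      assume "\<exists>v\<in>fvec V (s (Suc (Suc i))). vmul (n (Suc (Suc i))) v (D (Suc i)) = u"
      then obtain v where v: "v \<in> fvec V (s (Suc (Suc i)))" "vmul (n (Suc (Suc i))) v (D (Suc i)) = u" by blast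
      show "vmul (n (Suc i)) u (D i) = 0"
      proof (rule comp_inj)
        show "vmul (n (Suc i)) u (D i) \<in> fvec V (s i)"
          using fvecD[OF u] D_fvec len by (intro fvec_vmul) auto
        show "0 \<in> fvec V (s i)" by (simp add: fvec_def polys_0)
        show "comp i (vmul (n (Suc i)) u (D i)) m = comp i 0 m" for m
          unfolding comp_vmul v(2)[symmetric] c0 bnd_bnd F.dd by (simp add: bnd_def fun_eq_iff)
      qed
    qed
  qed
  then show ?thesis unfolding s_def[abs_def] D_def[abs_def] .
qed


section \<open>Resolutions as matrices\<close>

definition smul :: "'a::comm_ring_1 \<Rightarrow> (nat \<Rightarrow> 'a) \<Rightarrow> nat \<Rightarrow> 'a" where
  "smul a u = (\<lambda>k. a * u k)"

lemma graded_free_simps: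
  "carrier (graded_free V s) = fvec V s" "\<zero>\<^bsub>graded_free V s\<^esub> = 0"
  "u \<oplus>\<^bsub>graded_free V s\<^esub> v = u + v" "a \<odot>\<^bsub>graded_free V s\<^esub> u = smul a u"
  "component (graded_free V s) e = {u \<in> fvec V s. hvec s e u}"
  by (auto simp: graded_free_def fvec_def hvec_def smul_def fun_eq_iff)

text \<open>Partial sums of the expansion in basis vectors, on which linear maps are evaluated by
  induction.\<close>

definition trunc :: "nat \<Rightarrow> (nat \<Rightarrow> 'a::comm_ring_1) \<Rightarrow> nat \<Rightarrow> 'a" where
  "trunc j u = (\<lambda>k. if k < j then u k else 0)"

lemma trunc_0: "trunc 0 u = 0"
  and trunc_Suc: "trunc (Suc j) u = trunc j u + smul (u j) (basis_vec j)"
  by (auto simp: trunc_def fun_eq_iff smul_def basis_vec_def less_Suc_eq)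

lemma trunc_fvec: "u \<in> fvec V s \<Longrightarrow> trunc j u \<in> fvec V s"
  by (auto simp: fvec_def trunc_def polys_0)

lemma trunc_length: "u \<in> fvec V s \<Longrightarrow> trunc (length s) u = u"
  by (auto simp: fvec_def trunc_def fun_eq_iff)

lemma fvec_0: "0 \<in> fvec V s"
  by (simp add: fvec_def polys_0)

lemma fvec_add: "u \<in> fvec V s \<Longrightarrow> v \<in> fvec V s \<Longrightarrow> u + v \<in> fvec V s"
  by (simp add: fvec_def polys_add)

lemma fvec_smul: "a \<in> polys V \<Longrightarrow> u \<in> fvec V s \<Longrightarrow> smul a u \<in> fvec V s"
  by (simp add: fvec_def smul_def polys_mult)

lemma fvec_uminus: "u \<in> fvec V s \<Longrightarrow> - u \<in> fvec V s"
  by (simp add: fvec_def polys_uminus)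

lemma hvec_basis: "k < length s \<Longrightarrow> hvec s (s ! k) (basis_vec k :: nat \<Rightarrow> ('v, 'k::field) mpoly)"
  by (auto simp: hvec_def basis_vec_def homogeneous_def)

lemma graded_hom_free_iff:
  "f \<in> graded_hom (mpoly_ring V) (graded_free V s) (graded_free V t) \<longleftrightarrow>
    (\<forall>u\<in>fvec V s. f u \<in> fvec V t) \<and> (\<forall>u\<in>fvec V s. \<forall>v\<in>fvec V s. f (u + v) = f u + f v) \<and>
    (\<forall>a\<in>polys V. \<forall>u\<in>fvec V s. f (smul a u) = smul a (f u)) \<and>
    (\<forall>e. \<forall>u\<in>fvec V s. hvec s e u \<longrightarrow> hvec t e (f u))"
  by (auto simp: graded_hom_def hom_def graded_free_simps Pi_iff image_subset_iff)

lemma vmul_expansion: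
  assumes f: "f \<in> graded_hom (mpoly_ring V) (graded_free V s) (graded_free V t)" and u: "u \<in> fvec V s"
  shows "f u = vmul (length s) u (\<lambda>k. f (basis_vec k))"
proof -
  note f' = f[unfolded graded_hom_free_iff]
  have f0: "f 0 = 0"
  proof -
    have "f (0 + 0) = f 0 + f 0" using f' fvec_0 by blast
    then show ?thesis by simp
  qed
  have "f (trunc j u) = vmul j u (\<lambda>k. f (basis_vec k))" if "j \<le> length s" for j
    using that
  proof (induction j)
    case 0
    show ?case unfolding trunc_0 f0 by (simp add: vmul_def fun_eq_iff)
  next
    case (Suc j)
    have uj: "u j \<in> polys V" using fvecD[OF u] Suc.prems by simp
    have b: "basis_vec j \<in> fvec V s" using Suc.prems by (simp add: fvec_basis)
    have "f (trunc (Suc j) u) = f (trunc j u) + smul (u j) (f (basis_vec j))"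
      unfolding trunc_Suc using f' trunc_fvec[OF u] fvec_smul[OF uj b] uj b by metis
    then show ?case using Suc by (simp add: vmul_def fun_eq_iff smul_def)
  qed
  from this[of "length s"] show ?thesis using trunc_length[OF u] by simp
qed

lemma graded_hom_vmul:
  fixes A :: "nat \<Rightarrow> nat \<Rightarrow> ('v, 'k::field) mpoly"
  assumes "\<And>k. k < length s \<Longrightarrow> A k \<in> fvec V t" "\<And>k. k < length s \<Longrightarrow> hvec t (s ! k) (A k)"
  shows "(\<lambda>u. vmul (length s) u A) \<in> graded_hom (mpoly_ring V) (graded_free V s) (graded_free V t)"
  unfolding graded_hom_free_iff
proof (intro conjI ballI allI impI)
  fix u v :: "nat \<Rightarrow> ('v, 'k) mpoly" and a e assume u: "u \<in> fvec V s"
  show "vmul (length s) u A \<in> fvec V t" using fvecD[OF u] assms(1) by (rule fvec_vmul)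
  show "vmul (length s) (u + v) A = vmul (length s) u A + vmul (length s) v A"
    by (simp add: vmul_def fun_eq_iff algebra_simps sum.distrib)
  show "vmul (length s) (smul a u) A = smul a (vmul (length s) u A)"
    by (simp add: vmul_def smul_def fun_eq_iff sum_distrib_left mult.assoc)
  show "hvec t e (vmul (length s) u A)" if "hvec s e u" using that assms(2) by (rule hvec_vmul)
qed

text \<open>The singletons generate the monomial ideal of all nonempty supports, and the only
  monomial with empty support is the constant one.\<close>

lemma irrelevant_ideal_eq:
  "irrelevant_ideal V = ({p \<in> polys V. Poly_Mapping.lookup p 0 = 0} :: ('v, 'k::field) mpoly set)"
proof -
  have "irrelevant_ideal V = Idl\<^bsub>mpoly_ring V\<^esub> ((\<lambda>A. \<Prod>x\<in>A. mpoly_var x :: ('v, 'k) mpoly) ` (\<lambda>v. {v}) ` V)"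
    by (simp add: irrelevant_ideal_def image_image)
  also have "\<dots> = mono_ideal V {W. \<exists>A\<in>(\<lambda>v. {v}) ` V. A \<subseteq> W}"
    by (rule genideal_monomials) auto
  also have "\<dots> = {p \<in> polys V. Poly_Mapping.lookup p 0 = 0}"
  proof (intro equalityI subsetI)
    fix p :: "('v, 'k) mpoly"
    assume "p \<in> mono_ideal V {W. \<exists>A\<in>(\<lambda>v. {v}) ` V. A \<subseteq> W}"
    then have "p \<in> polys V" "0 \<notin> Poly_Mapping.keys p" by (auto simp: mono_ideal_def)
    then show "p \<in> {p \<in> polys V. Poly_Mapping.lookup p 0 = 0}" by (simp add: in_keys_iff)
  next
    fix p :: "('v, 'k) mpoly"
    assume p: "p \<in> {p \<in> polys V. Poly_Mapping.lookup p 0 = 0}"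
    have "\<exists>A\<in>(\<lambda>v. {v}) ` V. A \<subseteq> Poly_Mapping.keys m" if m: "m \<in> Poly_Mapping.keys p" for m
    proof -
      have "m \<noteq> 0" using m p by (auto simp: in_keys_iff)
      then obtain x where "x \<in> Poly_Mapping.keys m" by fastforce
      then show ?thesis using p m by (auto simp: polys_def)
    qed
    then show "p \<in> mono_ideal V {W. \<exists>A\<in>(\<lambda>v. {v}) ` V. A \<subseteq> W}" using p by (simp add: mono_ideal_def)
  qed
  finally show ?thesis .
qed

text \<open>Turns minimality into a condition on constant terms. The right-hand side is a submodule
  containing all products; conversely a vector is the sum of its coordinates times the basis
  vectors.\<close>

lemma ideal_smult_irrelevant:
  "ideal_smult (mpoly_ring V) (irrelevant_ideal V) (graded_free V s) =
    ({u \<in> fvec V s. \<forall>k. Poly_Mapping.lookup (u k) 0 = 0} :: (nat \<Rightarrow> ('v, 'k::field) mpoly) set)" (is "?L = ?N")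
proof
  have inv: "inv\<^bsub>add_monoid (graded_free V s)\<^esub> u = - u" if "u \<in> fvec V s" for u :: "nat \<Rightarrow> ('v, 'k) mpoly"
    unfolding m_inv_def
  proof (rule the_equality)
    fix y assume "y \<in> carrier (add_monoid (graded_free V s)) \<and>
      u \<otimes>\<^bsub>add_monoid (graded_free V s)\<^esub> y = \<one>\<^bsub>add_monoid (graded_free V s)\<^esub> \<and>
      y \<otimes>\<^bsub>add_monoid (graded_free V s)\<^esub> u = \<one>\<^bsub>add_monoid (graded_free V s)\<^esub>"
    then show "y = - u" by (simp add: graded_free_simps eq_neg_iff_add_eq_0)
  qed (simp add: graded_free_simps fvec_uminus that)
  have "submodule ?N (mpoly_ring V) (graded_free V s)"
  proof (intro submodule.intro subgroup.intro submodule_axioms.intro)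
    show "inv\<^bsub>add_monoid (graded_free V s)\<^esub> u \<in> ?N" if "u \<in> ?N" for u
      using that inv[of u] by (simp add: fvec_uminus)
    show "a \<odot>\<^bsub>graded_free V s\<^esub> x \<in> ?N" if "a \<in> polys V" "x \<in> ?N" for a x
      using that fvec_smul[of a V x s] by (simp add: graded_free_simps) (simp add: smul_def lookup_mult_zero)
  qed (auto simp: graded_free_simps fvec_add fvec_0 lookup_add)
  moreover have "a \<odot>\<^bsub>graded_free V s\<^esub> x \<in> ?N" if "a \<in> irrelevant_ideal V" "x \<in> carrier (graded_free V s)"
    for a and x :: "nat \<Rightarrow> ('v, 'k) mpoly"
    using that by (simp add: irrelevant_ideal_eq graded_free_simps fvec_smul) (simp add: smul_def lookup_mult_zero)
  ultimately show "?L \<subseteq> ?N" unfolding ideal_smult_def by (intro Inter_lower) blast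
next
  show "?N \<subseteq> ?L"
    unfolding ideal_smult_def
  proof (intro subsetI InterI)
    fix u :: "nat \<Rightarrow> ('v, 'k) mpoly" and N :: "(nat \<Rightarrow> ('v, 'k) mpoly) set" assume u: "u \<in> ?N"
      and "N \<in> {N. submodule N (mpoly_ring V) (graded_free V s) \<and>
        (\<forall>a\<in>irrelevant_ideal V. \<forall>x\<in>carrier (graded_free V s). a \<odot>\<^bsub>graded_free V s\<^esub> x \<in> N)}"
    then have N: "submodule N (mpoly_ring V) (graded_free V s)"
      and aN: "\<And>a x. a \<in> irrelevant_ideal V \<Longrightarrow> x \<in> fvec V s \<Longrightarrow> smul a x \<in> N"
      by (auto simp: graded_free_simps)
    interpret N: submodule N "mpoly_ring V" "graded_free V s" by (rule N)
    have uf: "u \<in> fvec V s" using u by simp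
    have "trunc j u \<in> N" if "j \<le> length s" for j
      using that
    proof (induction j)
      case 0
      show ?case unfolding trunc_0 using N.one_closed by (simp add: graded_free_simps del: zero_fun_apply)
    next
      case (Suc j)
      have "u j \<in> irrelevant_ideal V"
        using u fvecD[OF uf, of j] Suc.prems by (simp add: irrelevant_ideal_eq)
      then have "smul (u j) (basis_vec j) \<in> N" using Suc.prems by (intro aN fvec_basis) auto
      then show ?case using Suc N.m_closed by (simp add: trunc_Suc graded_free_simps del: plus_fun_apply)
    qed
    from this[of "length s"] show "u \<in> N" using trunc_length[OF uf] by simp
  qed
qed

section \<open>The quotient module in terms of cosets\<close>

context hom_ideal
begin

definition coset :: "('v, 'k) mpoly \<Rightarrow> ('v, 'k) mpoly set" where
  "coset x = (\<lambda>h. h + x) ` I"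

abbreviation "M \<equiv> quotient_module V I"

lemma coset_self: "x \<in> coset x"
  using I_0 by (auto simp: coset_def image_iff)

lemma coset_iff: "y \<in> coset x \<longleftrightarrow> y - x \<in> I"
  by (auto simp: coset_def image_iff algebra_simps) (metis add_diff_cancel_left' diff_add_cancel)

lemma coset_eq_iff: "coset x = coset y \<longleftrightarrow> x - y \<in> I"
proof
  assume "coset x = coset y"
  then show "x - y \<in> I" using coset_self[of x] coset_iff by blast
next
  assume xy: "x - y \<in> I"
  have "w - x \<in> I \<longleftrightarrow> w - y \<in> I" for w
    using I_add[OF _ xy, of "w - x"] I_diff[OF _ xy, of "w - y"] by auto
  then show "coset x = coset y" by (auto simp: coset_iff)
qed

lemma coset_0: "coset 0 = I"
  by (simp add: coset_def)

lemma coset_eq_I: "coset x = I \<longleftrightarrow> x \<in> I"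
  using coset_eq_iff[of x 0] coset_0 by simp

lemma a_r_coset_eq: "I +>\<^bsub>mpoly_ring V\<^esub> x = coset x"
  by (auto simp: a_r_coset_def' mpoly_ring_simps coset_def)

lemma M_simps:
  "carrier M = coset ` polys V" "\<zero>\<^bsub>M\<^esub> = I"
  "component M e = coset ` {p \<in> polys V. homogeneous e p}"
  by (auto simp: quotient_module_def Let_def FactRing_def A_RCOSETS_def' a_r_coset_eq)

lemma M_add: "coset x \<oplus>\<^bsub>M\<^esub> coset y = coset (x + y)"
proof -
  have "(\<exists>h\<in>coset x. \<exists>k\<in>coset y. w = h + k) \<longleftrightarrow> w \<in> coset (x + y)" for w
  proof
    assume "\<exists>h\<in>coset x. \<exists>k\<in>coset y. w = h + k"
    then obtain h k where "h - x \<in> I" "k - y \<in> I" "w = h + k" by (auto simp: coset_iff)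
    then show "w \<in> coset (x + y)" using I_add[of "h - x" "k - y"] by (simp add: coset_iff algebra_simps)
  next
    assume "w \<in> coset (x + y)"
    then have "w - y \<in> coset x" "w = (w - y) + y" by (simp_all add: coset_iff algebra_simps)
    then show "\<exists>h\<in>coset x. \<exists>k\<in>coset y. w = h + k" using coset_self by blast
  qed
  then show ?thesis
    by (auto simp: quotient_module_def Let_def FactRing_def set_add_def' mpoly_ring_simps)
qed

text \<open>The product in the factor ring is a union of cosets over all choices of representatives;
  these cosets coincide because \<open>I\<close> is an ideal.\<close>

lemma M_smult:
  assumes "a \<in> polys V" "x \<in> polys V"
  shows "a \<odot>\<^bsub>M\<^esub> coset x = coset (a * x)"
proof -
  have "coset (b * y) = coset (a * x)" if "b \<in> coset a" "y \<in> coset x" for b y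
  proof -
    have ba: "b - a \<in> I" and yx: "y - x \<in> I" using that by (simp_all add: coset_iff)
    then have y: "y \<in> polys V" using polys_add[of "y - x" V x] I_polys assms(2) by auto
    have "y * (b - a) + a * (y - x) \<in> I"
      using I_mult[OF ba y] I_mult[OF yx assms(1)] by (rule I_add)
    then show ?thesis by (simp add: coset_eq_iff algebra_simps)
  qed
  then have "(\<Union>b\<in>coset a. \<Union>y\<in>coset x. coset (b * y)) = coset (a * x)"
    using coset_self[of a] coset_self[of x] by blast
  then show ?thesis
    by (simp add: quotient_module_def Let_def FactRing_def rcoset_mult_def mpoly_ring_simps a_r_coset_eq)
qed

lemma coset_expansion:
  assumes \<epsilon>: "\<epsilon> \<in> graded_hom (mpoly_ring V) (graded_free V s) M" and u: "u \<in> fvec V s"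
    and p: "\<And>k. k < length s \<Longrightarrow> p k \<in> polys V \<and> \<epsilon> (basis_vec k) = coset (p k)"
  shows "\<epsilon> u = coset (dotp (length s) u p)"
proof -
  have add: "\<epsilon> (x + y) = \<epsilon> x \<oplus>\<^bsub>M\<^esub> \<epsilon> y" if "x \<in> fvec V s" "y \<in> fvec V s" for x y
    using \<epsilon> that by (simp add: graded_hom_def hom_def graded_free_simps)
  have smult: "\<epsilon> (smul a x) = a \<odot>\<^bsub>M\<^esub> \<epsilon> x" if "a \<in> polys V" "x \<in> fvec V s" for a x
    using \<epsilon> that by (simp add: graded_hom_def graded_free_simps)
  have e0: "\<epsilon> 0 = coset 0"
  proof -
    obtain x where x: "x \<in> polys V" "\<epsilon> 0 = coset x"
      using \<epsilon> fvec_0[of V s] by (auto simp: graded_hom_def hom_def graded_free_simps M_simps Pi_iff)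
    \<comment> \<open>Cancellation of \<open>\<epsilon> 0\<close> is done on representatives: equal
      cosets of \<open>x\<close> and \<open>x + x\<close> put \<open>x\<close> into
      \<open>I\<close>.\<close>
    have "coset x = coset (x + x)" using add[OF fvec_0 fvec_0] x by (simp add: M_add)
    then have "x - (x + x) \<in> I" by (simp only: coset_eq_iff)
    then show ?thesis using I_uminus[of "- x"] x by (simp add: coset_eq_iff)
  qed
  have "\<epsilon> (trunc j u) = coset (dotp j u p)" if "j \<le> length s" for j
    using that
  proof (induction j)
    case 0
    show ?case unfolding trunc_0 e0 by (simp add: dotp_def)
  next
    case (Suc j)
    have uj: "u j \<in> polys V" using fvecD[OF u] Suc.prems by simp
    have b: "basis_vec j \<in> fvec V s" using Suc.prems by (simp add: fvec_basis)
    have "\<epsilon> (trunc (Suc j) u) = coset (dotp j u p) \<oplus>\<^bsub>M\<^esub> (u j \<odot>\<^bsub>M\<^esub> coset (p j))"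
      unfolding trunc_Suc using add[OF trunc_fvec[OF u] fvec_smul[OF uj b]] smult[OF uj b] Suc p[of j] by simp
    then show ?case using M_smult[OF uj] p[of j] Suc.prems by (simp add: M_add dotp_def)
  qed
  from this[of "length s"] show ?thesis using trunc_length[OF u] by simp
qed

text \<open>The rows of the matrices are the images of basis vectors. Since
  \<open>\<epsilon>\<close> preserves degrees, the image of a basis vector has a homogeneous
  representative in the ring, which becomes \<open>p k\<close>.\<close>

lemma resolution_matrix_res:
  assumes "minimal_graded_free_resolution V M s d \<epsilon>"
  obtains D p where "matrix_res V I s D p"
proof -
  note m = assms[unfolded minimal_graded_free_resolution_def Let_def]
  have \<epsilon>: "\<epsilon> \<in> graded_hom (mpoly_ring V) (graded_free V (s 0)) M"
    and d: "\<And>i. d i \<in> graded_hom (mpoly_ring V) (graded_free V (s (Suc i))) (graded_free V (s i))"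
    and surj: "\<epsilon> ` fvec V (s 0) = coset ` polys V"
    and ex0: "d 0 ` fvec V (s (Suc 0)) = {u \<in> fvec V (s 0). \<epsilon> u = I}"
    and ex: "\<And>i. d (Suc i) ` fvec V (s (Suc (Suc i))) = {u \<in> fvec V (s (Suc i)). d i u = 0}"
    and min: "\<And>i. d i ` fvec V (s (Suc i)) \<subseteq> {u \<in> fvec V (s i). \<forall>k. Poly_Mapping.lookup (u k) 0 = 0}"
    using m by (simp_all add: a_kernel_def' graded_free_simps M_simps ideal_smult_irrelevant)
  define D where "D i k = d i (basis_vec k)" for i k
  have dv: "d i u = vmul (length (s (Suc i))) u (D i)" if "u \<in> fvec V (s (Suc i))" for i u
    using vmul_expansion[OF d that] unfolding D_def .
  have img: "u \<in> d i ` fvec V (s (Suc i)) \<longleftrightarrow> (\<exists>v\<in>fvec V (s (Suc i)). vmul (length (s (Suc i))) v (D i) = u)" for i u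
    unfolding image_iff by (rule bex_cong[OF refl]) (use dv in auto)
  have "\<exists>p. p \<in> polys V \<and> homogeneous (s 0 ! k) p \<and> \<epsilon> (basis_vec k) = coset p" if k: "k < length (s 0)" for k
  proof -
    have "(basis_vec k :: nat \<Rightarrow> ('v, 'k) mpoly) \<in> component (graded_free V (s 0)) (s 0 ! k)"
      using k by (simp add: graded_free_simps fvec_basis hvec_basis)
    then have "\<epsilon> (basis_vec k) \<in> component M (s 0 ! k)"
      using \<epsilon> unfolding graded_hom_def by blast
    then show ?thesis by (auto simp: M_simps)
  qed
  then obtain p where p: "\<And>k. k < length (s 0) \<Longrightarrow> p k \<in> polys V \<and> homogeneous (s 0 ! k) (p k) \<and> \<epsilon> (basis_vec k) = coset (p k)"
    by metis
  have \<epsilon>v: "\<epsilon> u = coset (dotp (length (s 0)) u p)" if "u \<in> fvec V (s 0)" for u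
    by (rule coset_expansion[OF \<epsilon> that]) (use p in blast)
  have "matrix_res V I s D p"
  proof
    fix i k l assume k: "k < length (s (Suc i))"
    show "D i k \<in> fvec V (s i)"
      using d[of i] fvec_basis[OF k] unfolding D_def graded_hom_free_iff by blast
    show "hvec (s i) (s (Suc i) ! k) (D i k)"
      using d[of i] fvec_basis[OF k] hvec_basis[OF k] unfolding D_def graded_hom_free_iff by blast
    show "Poly_Mapping.lookup (D i k l) 0 = 0"
      using min[of i] fvec_basis[OF k] unfolding D_def by blast
  next
    fix q :: "('v, 'k) mpoly" assume "q \<in> polys V"
    then have "coset q \<in> \<epsilon> ` fvec V (s 0)" unfolding surj by blast
    then obtain u where "u \<in> fvec V (s 0)" "coset q = \<epsilon> u" by blast
    then show "\<exists>u\<in>fvec V (s 0). dotp (length (s 0)) u p - q \<in> I"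
      using \<epsilon>v[of u] coset_eq_iff[of "dotp (length (s 0)) u p" q] by auto
  next
    fix u :: "nat \<Rightarrow> ('v, 'k) mpoly" assume u: "u \<in> fvec V (s 0)"
    have "dotp (length (s 0)) u p \<in> I \<longleftrightarrow> \<epsilon> u = I"
      using \<epsilon>v[OF u] coset_eq_I by simp
    also have "\<dots> \<longleftrightarrow> u \<in> d 0 ` fvec V (s (Suc 0))" using ex0 u by simp
    finally show "dotp (length (s 0)) u p \<in> I \<longleftrightarrow> (\<exists>v\<in>fvec V (s (Suc 0)). vmul (length (s (Suc 0))) v (D 0) = u)"
      unfolding img .
  next
    fix u :: "nat \<Rightarrow> ('v, 'k) mpoly" and i assume u: "u \<in> fvec V (s (Suc i))"
    have "vmul (length (s (Suc i))) u (D i) = 0 \<longleftrightarrow> u \<in> d (Suc i) ` fvec V (s (Suc (Suc i)))"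
      using ex[of i] u dv[OF u] by simp
    then show "vmul (length (s (Suc i))) u (D i) = 0 \<longleftrightarrow>
        (\<exists>v\<in>fvec V (s (Suc (Suc i))). vmul (length (s (Suc (Suc i)))) v (D (Suc i)) = u)"
      unfolding img .
  qed (use p in auto)
  then show ?thesis by (rule that)
qed

lemma matrix_res_resolution:
  assumes "matrix_res V I s D p"
  shows "minimal_graded_free_resolution V M s (\<lambda>i u. vmul (length (s (Suc i))) u (D i))
    (\<lambda>u. coset (dotp (length (s 0)) u p))"
proof -
  interpret F: matrix_res V I s D p by fact
  let ?n = "length (s 0)"
  have dp: "dotp ?n u p \<in> polys V" if "u \<in> fvec V (s 0)" for u :: "nat \<Rightarrow> ('v, 'k) mpoly"
    using fvecD[OF that] F.p_polys unfolding dotp_def by (intro polys_sum polys_mult) auto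
  have "(\<lambda>u. coset (dotp ?n u p)) \<in> graded_hom (mpoly_ring V) (graded_free V (s 0)) M"
    unfolding graded_hom_def
  proof (intro CollectI conjI ballI allI)
    show "(\<lambda>u. coset (dotp ?n u p)) \<in> hom (add_monoid (graded_free V (s 0))) (add_monoid M)"
      using dp by (auto simp: hom_def graded_free_simps M_simps M_add dotp_def algebra_simps sum.distrib)
    show "coset (dotp ?n (a \<odot>\<^bsub>graded_free V (s 0)\<^esub> x) p) = a \<odot>\<^bsub>M\<^esub> coset (dotp ?n x p)"
      if "a \<in> polys V" "x \<in> carrier (graded_free V (s 0))" for a x
      using M_smult[OF that(1) dp[of x]] that(2)
      by (simp add: graded_free_simps smul_def dotp_def sum_distrib_left mult.assoc)
    show "(\<lambda>u. coset (dotp ?n u p)) ` component (graded_free V (s 0)) e \<subseteq> component M e" for e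
    proof (clarsimp simp: graded_free_simps M_simps)
      fix u :: "nat \<Rightarrow> ('v, 'k) mpoly" assume u: "u \<in> fvec V (s 0)" "hvec (s 0) e u"
      have "homogeneous e (dotp ?n u p)"
        unfolding dotp_def
      proof (rule homogeneous_sum)
        fix k assume "k \<in> {..<?n}"
        then show "homogeneous e (u k * p k)"
          using homogeneous_mult[of "e - s 0 ! k" "u k" "s 0 ! k" "p k"] u(2) F.p_hom[of k] by (simp add: hvec_def)
      qed
      then show "coset (dotp ?n u p) \<in> coset ` {p \<in> polys V. homogeneous e p}" using dp[OF u(1)] by blast
    qed
  qed
  moreover have "(\<lambda>u. vmul (length (s (Suc i))) u (D i))
      \<in> graded_hom (mpoly_ring V) (graded_free V (s (Suc i))) (graded_free V (s i))" for i
    by (rule graded_hom_vmul) (auto intro: F.D_fvec F.D_hom)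
  moreover have "(\<lambda>u. coset (dotp ?n u p)) ` fvec V (s 0) = coset ` polys V"
  proof (intro subset_antisym subsetI)
    fix y assume "y \<in> coset ` polys V"
    then obtain q where q: "q \<in> polys V" "y = coset q" by blast
    then obtain u where "u \<in> fvec V (s 0)" "dotp ?n u p - q \<in> I" using F.surj by blast
    then show "y \<in> (\<lambda>u. coset (dotp ?n u p)) ` fvec V (s 0)"
      using q(2) coset_eq_iff by (metis image_eqI)
  qed (use dp in auto)
  moreover have "(\<lambda>u. vmul (length (s (Suc 0))) u (D 0)) ` fvec V (s (Suc 0)) =
      {u \<in> fvec V (s 0). coset (dotp ?n u p) = I}"
  proof -
    have "vmul (length (s (Suc 0))) v (D 0) \<in> fvec V (s 0)" if "v \<in> fvec V (s (Suc 0))" for v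
      using fvecD[OF that] F.D_fvec by (intro fvec_vmul) auto
    then show ?thesis using F.exact_0 coset_eq_I by auto
  qed
  moreover have "(\<lambda>u. vmul (length (s (Suc (Suc i)))) u (D (Suc i))) ` fvec V (s (Suc (Suc i))) =
      {u \<in> fvec V (s (Suc i)). vmul (length (s (Suc i))) u (D i) = 0}" for i
  proof -
    have "vmul (length (s (Suc (Suc i)))) v (D (Suc i)) \<in> fvec V (s (Suc i))" if "v \<in> fvec V (s (Suc (Suc i)))" for v
      using fvecD[OF that] F.D_fvec by (intro fvec_vmul) auto
    then show ?thesis using F.exact_Suc by auto
  qed
  moreover have "(\<lambda>u. vmul (length (s (Suc i))) u (D i)) ` fvec V (s (Suc i)) \<subseteq>
      {u \<in> fvec V (s i). \<forall>k. Poly_Mapping.lookup (u k) 0 = 0}" for i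
  proof clarify
    fix v :: "nat \<Rightarrow> ('v, 'k) mpoly" assume v: "v \<in> fvec V (s (Suc i))"
    have "vmul (length (s (Suc i))) v (D i) \<in> fvec V (s i)"
      using fvecD[OF v] F.D_fvec by (intro fvec_vmul) auto
    moreover have "Poly_Mapping.lookup (vmul (length (s (Suc i))) v (D i) k) 0 = 0" for k
      by (simp add: vmul_def lookup_sum lookup_mult_zero F.D_min)
    ultimately show "vmul (length (s (Suc i))) v (D i) \<in> fvec V (s i) \<and>
        (\<forall>k. Poly_Mapping.lookup (vmul (length (s (Suc i))) v (D i) k) 0 = 0)" by blast
  qed
  ultimately show ?thesis
    unfolding minimal_graded_free_resolution_def Let_def
    by (simp add: a_kernel_def' graded_free_simps M_simps ideal_smult_irrelevant)
qed

text \<open>The given matrices witness the description; comparison with any other resolution in both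
  directions makes its value unique.\<close>

lemma graded_betti_matrix_res:
  assumes "matrix_res V I s D p"
  shows "graded_betti V M (int i) j = count_list (s i) j"
proof -
  have "(THE b. \<exists>s d \<epsilon>. minimal_graded_free_resolution V M s d \<epsilon> \<and> b = count_list (s i) j) = count_list (s i) j"
  proof (rule the_equality)
    show "\<exists>s' d \<epsilon>. minimal_graded_free_resolution V M s' d \<epsilon> \<and> count_list (s i) j = count_list (s' i) j"
      using matrix_res_resolution[OF assms] by blast
  next
    fix b assume "\<exists>s' d \<epsilon>. minimal_graded_free_resolution V M s' d \<epsilon> \<and> b = count_list (s' i) j"
    then obtain s' d \<epsilon> where *: "minimal_graded_free_resolution V M s' d \<epsilon>" "b = count_list (s' i) j" by blast
    obtain D' p' where G: "matrix_res V I s' D' p'" using resolution_matrix_res[OF *(1)] by blast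
    show "b = count_list (s i) j"
      unfolding *(2) using matrix_res_count_le[OF assms G] matrix_res_count_le[OF G assms] by (rule le_antisym[rotated])
  qed
  then show ?thesis by (simp add: graded_betti_def)
qed

end

text \<open>Lists of shifts call for initial segments as index sets, hence the reindexing. A shift
  is the size of a multidegree, so a negative \<open>j\<close> has multiplicity 0.\<close>

lemma graded_betti_sqfree_res:
  fixes c :: "nat \<Rightarrow> 'x \<Rightarrow> 'x \<Rightarrow> 'k::field"
  assumes res: "sqfree_res V U X a c z"
    and up: "\<And>W W'. W \<in> U \<Longrightarrow> W \<subseteq> W' \<Longrightarrow> W' \<subseteq> V \<Longrightarrow> W' \<in> U" and proper: "{} \<notin> U"
  shows "graded_betti V (quotient_module V (mono_ideal V U :: ('v, 'k) mpoly set)) (int i) j =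
    (if j < 0 then 0 else betti_count X a i (nat j))"
proof -
  obtain X' :: "nat \<Rightarrow> nat set" and a' and c' :: "nat \<Rightarrow> nat \<Rightarrow> nat \<Rightarrow> 'k"
    where *: "sqfree_res V U X' a' c' 0" "\<And>i. X' i = {..<card (X i)}"
      "\<And>i j. betti_count X' a' i j = betti_count X a i j"
    using sqfree_res_reindex[OF res] by blast
  interpret hom_ideal V "mono_ideal V U :: ('v, 'k) mpoly set" by (rule hom_ideal_mono_ideal[OF up])
  have "graded_betti V M (int i) j = count_list (map (\<lambda>k. int (card (a' i k))) [0..<card (X i)]) j"
    by (rule graded_betti_matrix_res[OF sqfree_res_matrix_res[OF *(1,2) up proper]])
  also have "\<dots> = card {k. k < card (X i) \<and> int (card (a' i k)) = j}"
    unfolding count_list_card by (intro arg_cong[where f = card]) auto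
  also have "{k. k < card (X i) \<and> int (card (a' i k)) = j} = (if j < 0 then {} else {k \<in> X' i. card (a' i k) = nat j})"
    by (auto simp: *(2))
  finally show ?thesis using *(3)[of i "nat j"] by (simp add: betti_count_def)
qed


section \<open>Wheel graphs\<close>

definition conn_sets :: "'v pair_pre_digraph \<Rightarrow> nat \<Rightarrow> 'v set set" where
  "conn_sets G r = {A. A \<subseteq> pverts G \<and> card A = r + 1 \<and> Digraph_Component.connected (with_proj G \<restriction> A)}"

definition conn_upset :: "'v pair_pre_digraph \<Rightarrow> nat \<Rightarrow> 'v set set" where
  "conn_upset G r = {W. \<exists>A\<in>conn_sets G r. A \<subseteq> W}"

lemma conn_upset_mono: "W \<in> conn_upset G r \<Longrightarrow> W \<subseteq> W' \<Longrightarrow> W' \<in> conn_upset G r"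
  unfolding conn_upset_def by blast

lemma connected_ideal_eq: "connected_ideal G r = mono_ideal (pverts G) (conn_upset G r)"
proof -
  have "connected_ideal G r = Idl\<^bsub>mpoly_ring (pverts G)\<^esub> ((\<lambda>A. \<Prod>x\<in>A. mpoly_var x) ` conn_sets G r)"
    unfolding connected_ideal_def conn_sets_def by (intro arg_cong[where f = "genideal _"]) auto
  also have "\<dots> = mono_ideal (pverts G) {W. \<exists>A\<in>conn_sets G r. A \<subseteq> W}"
    by (rule genideal_monomials) (auto simp: conn_sets_def intro: card_ge_0_finite)
  finally show ?thesis by (simp add: conn_upset_def)
qed

lemma graph_betti_sqfree_res:
  fixes c :: "nat \<Rightarrow> 'x \<Rightarrow> 'x \<Rightarrow> 'k::field"
  assumes "sqfree_res (pverts G) (conn_upset G r) X a c z"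
  shows "graph_betti TYPE('k) G r (int i) j = (if j < 0 then 0 else betti_count X a i (nat j))"
  unfolding graph_betti_def connected_ideal_eq
proof (rule graded_betti_sqfree_res[OF assms])
  show "{} \<notin> conn_upset G r" by (auto simp: conn_upset_def conn_sets_def)
qed (rule conn_upset_mono)

lemma induce_subgraph_wheel:
  "A \<subseteq> {0..<n} \<Longrightarrow> with_proj (wheel_graph n) \<restriction> A = with_proj (cycle_graph n) \<restriction> A"
  by (auto simp: induce_subgraph_def wheel_graph_def cycle_graph_def)

text \<open>Any two vertices are joined through the hub, which is adjacent to all others.\<close>

lemma connected_hub:
  assumes "n \<in> A" "A \<subseteq> pverts (wheel_graph n)"
  shows "Digraph_Component.connected (with_proj (wheel_graph n) \<restriction> A)"
proof -
  let ?S = "mk_symmetric (with_proj (wheel_graph n) \<restriction> A)"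
  have pv: "pverts ?S = A" by simp
  have hub: "(n, x) \<in> parcs ?S" "(x, n) \<in> parcs ?S" if "x \<in> A" "x \<noteq> n" for x
    using that assms by (force simp: mk_symmetric_def wheel_graph_def cycle_graph_def)+
  have to_hub: "(x, n) \<in> rtrancl_on A (parcs ?S)" and from_hub: "(n, x) \<in> rtrancl_on A (parcs ?S)" if "x \<in> A" for x
    using hub[of x] that assms(1) by (cases "x = n"; auto intro: rtrancl_on_into_rtrancl_on)+
  show ?thesis
    unfolding Digraph_Component.connected_def strongly_connected_def reachable_def
    using assms(1) to_hub from_hub pv by (auto intro: rtrancl_on_trans)
qed

text \<open>If \<open>n \<in> W\<close>, the hub together with any \<open>r\<close> vertices of
  \<open>W - {n}\<close> gives a generator, and conversely a generator inside \<open>W\<close>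
  forces the size. Otherwise wheel and cycle induce the same graphs on the subsets of
  \<open>W\<close>.\<close>

lemma conn_upset_wheel:
  assumes W: "W \<subseteq> insert n {0..<n}"
  shows "W \<in> conn_upset (wheel_graph n) r \<longleftrightarrow>
    (if n \<in> W then r \<le> card (W - {n}) else W \<in> conn_upset (cycle_graph n) r)"
proof (cases "n \<in> W")
  case True
  have fin: "finite W" using W finite_subset by blast
  show ?thesis
  proof
    assume "W \<in> conn_upset (wheel_graph n) r"
    then obtain A where "card A = r + 1" "A \<subseteq> W" by (auto simp: conn_upset_def conn_sets_def)
    then have "r + 1 \<le> card W" using card_mono[OF fin] by metis
    then show "if n \<in> W then r \<le> card (W - {n}) else W \<in> conn_upset (cycle_graph n) r"
      using True fin by simp
  next
    assume "if n \<in> W then r \<le> card (W - {n}) else W \<in> conn_upset (cycle_graph n) r"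
    then obtain B where B: "B \<subseteq> W - {n}" "card B = r" using True obtain_subset_with_card_n[of r "W - {n}"] by auto
    have "finite B" using B(1) fin finite_subset by blast
    then have "card (insert n B) = r + 1" using B by (auto simp: card_insert_if)
    moreover have iW: "insert n B \<subseteq> W" using B(1) True by auto
    moreover have "insert n B \<subseteq> pverts (wheel_graph n)"
      using iW W by (auto simp: wheel_graph_def cycle_graph_def)
    moreover from this have "Digraph_Component.connected (with_proj (wheel_graph n) \<restriction> insert n B)"
      by (intro connected_hub) auto
    ultimately show "W \<in> conn_upset (wheel_graph n) r"
      unfolding conn_upset_def conn_sets_def by blast
  qed
next
  case False
  then have WC: "W \<subseteq> {0..<n}" using W by auto
  have "A \<in> conn_sets (wheel_graph n) r \<longleftrightarrow> A \<in> conn_sets (cycle_graph n) r" if "A \<subseteq> W" for A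
  proof -
    have A: "A \<subseteq> {0..<n}" using that WC by blast
    then show ?thesis using induce_subgraph_wheel[OF A] by (auto simp: conn_sets_def wheel_graph_def cycle_graph_def)
  qed
  then show ?thesis using False by (auto simp: conn_upset_def)
qed

text \<open>The binomials of the theorem for homological degree \<open>i + 1\<close> and
  \<open>d = r\<close>. As \<open>r \<ge> 1\<close>, all arguments are nonnegative and
  \<open>int_binomial\<close> is the usual coefficient.\<close>

lemma int_binomial_linear_betti:
  assumes "r \<ge> 1"
  shows "int_binomial (int i + int r - 1) (int r - 1) * int_binomial (int n) (int i + int r) = linear_betti n r i"
proof -
  have "int_binomial (int i + int r - 1) (int r - 1) = (i + r - 1 choose (r - 1))"
    using assms by (auto simp: int_binomial_def nat_diff_distrib nat_add_distrib)
  moreover have "int_binomial (int n) (int i + int r) = (n choose (i + r))"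
    by (auto simp: int_binomial_def nat_add_distrib binomial_eq_0)
  ultimately show ?thesis using assms by (simp add: linear_betti_def)
qed

theorem theorem4p10:
  fixes n r :: nat and i d :: int
  assumes "n \<ge> 3" and "r \<ge> 1" and "i \<ge> 0"
  shows "(d = int r \<longrightarrow>
      graph_betti TYPE('k::field) (wheel_graph n) r i (i + d) =
        graph_betti TYPE('k) (cycle_graph n) r i (i + d)
        + graph_betti TYPE('k) (cycle_graph n) r (i - 1) (i + d - 1)
        + int_binomial (i + d - 2) (d - 1) * int_binomial (int n) (i + d - 1)) \<and>
    (d \<ge> int r + 1 \<longrightarrow>
      graph_betti TYPE('k) (wheel_graph n) r i (i + d) =
        graph_betti TYPE('k) (cycle_graph n) r i (i + d)
        + graph_betti TYPE('k) (cycle_graph n) r (i - 1) (i + d - 1))"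
proof -
  have VC: "pverts (cycle_graph n) = {0..<n}" and VW: "pverts (wheel_graph n) = insert n {0..<n}"
    by (simp_all add: wheel_graph_def cycle_graph_def)
  have card_ge: "r + 1 \<le> card W" if sub: "W \<subseteq> {0..<n}" and W: "W \<in> conn_upset (cycle_graph n) r" for W
  proof -
    obtain A where "card A = r + 1" "A \<subseteq> W" using W by (auto simp: conn_upset_def conn_sets_def)
    then show ?thesis using card_mono[of W A] finite_subset[OF sub] by simp
  qed
  obtain X :: "nat \<Rightarrow> nat set" and a and c :: "nat \<Rightarrow> nat \<Rightarrow> nat \<Rightarrow> 'k"
    where F: "sqfree_res {0..<n} (conn_upset (cycle_graph n) r) X a c 0"
    by (rule sqfree_res_exists[of "{0..<n}" "conn_upset (cycle_graph n) r"]) (auto intro: conn_upset_mono)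
  interpret F: sqfree_res "{0..<n}" "conn_upset (cycle_graph n) r" X a c 0 by (rule F)
  obtain X' :: "nat \<Rightarrow> nat set" and a' and c' :: "nat \<Rightarrow> nat \<Rightarrow> nat \<Rightarrow> 'k"
    where G: "sqfree_res {0..<n} {W. r \<le> card W} X' a' c' 0"
      "\<And>i j. betti_count X' a' (Suc i) j = (if j = i + r then linear_betti n r i else 0)"
    using linear_res_exists[where V = "{0..<n}" and r = r, OF finite_atLeastLessThan]
    unfolding card_atLeastLessThan diff_zero by blast
  obtain X'' :: "nat \<Rightarrow> nat set" and a'' and c'' :: "nat \<Rightarrow> nat \<Rightarrow> nat \<Rightarrow> 'k"
    where H: "sqfree_res (insert n {0..<n})
        {W. if n \<in> W then W - {n} \<in> {W. r \<le> card W} else W \<in> conn_upset (cycle_graph n) r} X'' a'' c'' 0"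
      "\<And>i j. betti_count X'' a'' i j =
        betti_count X a i j + (if i = 0 \<or> j = 0 then 0 else betti_count X' a' i (j - 1)) +
        (if i \<le> 1 \<or> j = 0 then 0 else betti_count X a (i - 1) (j - 1))"
  proof (rule cone_exists[OF F G(1), of n])
    show "W \<in> {W. r \<le> card W}" if "W \<subseteq> {0..<n}" "W \<in> conn_upset (cycle_graph n) r" for W
      using card_ge[OF that] by simp
    \<comment> \<open>Degrees in \<open>X (Suc i)\<close> have at least \<open>r + 1 + i\<close>
      elements, those in \<open>X' (Suc i)\<close> exactly \<open>i + r\<close>.\<close>
    show "card (a' (Suc i) y) \<noteq> card (a (Suc i) x)" if "x \<in> X (Suc i)" "y \<in> X' (Suc i)" for i x y
      using F.card_a_ge[OF card_ge that(1)] betti_count_pos[where i = "Suc i", OF G(1) that(2)]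
      by (auto simp: G(2) split: if_splits)
  qed auto
  have "sqfree_res (pverts (wheel_graph n)) (conn_upset (wheel_graph n) r) X'' a'' c'' 0"
    unfolding VW by (rule sqfree_res_cong[OF H(1)]) (simp add: conn_upset_wheel)
  note W = graph_betti_sqfree_res[OF this]
  note C = graph_betti_sqfree_res[OF F[folded VC]]
  have C0: "betti_count X a 0 j = (if j = 0 then 1 else 0)" for j
    by (auto simp: betti_count_def F.X_0 F.a_0 Collect_conv_if)
  have neg: "graph_betti TYPE('k) (cycle_graph n) r (- 1) j = 0" for j
    by (simp add: graph_betti_def graded_betti_def)
  obtain m where m: "i = int m" using assms(3) nonneg_int_cases by blast
  show ?thesis
  proof (cases "d \<ge> int r")
    case False
    then show ?thesis by auto
  next
    case True
    define e where "e = nat d"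
    have e: "d = int e" "e \<ge> r" using True assms(2) by (auto simp: e_def)
    have j: "nat (int m + int e) = m + e" "nat (int m + int e - 1) = m + e - 1" by simp_all
    show ?thesis
    proof (cases m)
      \<comment> \<open>All terms vanish: \<open>d \<ge> 1\<close> leaves nothing in homological
        degree 0, and \<open>int_binomial (d - 2) (d - 1)\<close> is 0, for \<open>d = 1\<close> by
        the convention on negative upper arguments.\<close>
      case 0
      then show ?thesis using e assms(2) neg
        by (auto simp: m W[of 0, simplified] C[of 0, simplified] H(2) C0 int_binomial_def)
    next
      case (Suc k)
      have wheel: "graph_betti TYPE('k) (wheel_graph n) r i (i + d) =
          betti_count X a m (m + e) + betti_count X' a' m (m + e - 1) +
          (if m = 1 then 0 else betti_count X a k (m + e - 1))"
        unfolding m e(1) W H(2) j using Suc by simp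
      have cyc: "graph_betti TYPE('k) (cycle_graph n) r i (i + d) = betti_count X a m (m + e)"
        unfolding m e(1) C j by simp
      have k: "i - 1 = int k" "i + d - 1 = int (k + e)" "m + e - 1 = k + e" using m Suc e(1) by simp_all
      have cyc': "graph_betti TYPE('k) (cycle_graph n) r (i - 1) (i + d - 1) = betti_count X a k (m + e - 1)"
        unfolding k C by (simp add: nat_int_add)
      \<comment> \<open>The cone has no third block in homological degree 1, whereas the formula has
        its summand there; the two agree because \<open>e \<ge> 1\<close> makes the summand
        0.\<close>
      have k0: "betti_count X a k (m + e - 1) = 0" if "m = 1"
        using that Suc e(2) assms(2) by (simp add: C0)
      \<comment> \<open>The linear strand sits at \<open>j = k + r\<close>, and here
        \<open>j = k + e\<close>; this separates the two cases of the formula.\<close>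
      have lin: "betti_count X' a' m (m + e - 1) = (if e = r then linear_betti n r k else 0)"
        using Suc by (simp add: G(2))
      have bin: "int_binomial (i + d - 2) (d - 1) * int_binomial (int n) (i + d - 1) = linear_betti n r k" if "e = r"
        using int_binomial_linear_betti[OF assms(2), of k n] that m Suc e(1) by (simp add: algebra_simps)
      show ?thesis
        unfolding wheel cyc cyc' lin using k0 bin e by auto
    qed
  qed
qed

end
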